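(* Let $(\Omega,d)$ be a compact metric space of diameter $1$, let $T:\Omega\to\Omega$ be topologically mixing, and assume that $(T,a)$ satisfies either Case 1 or Case 2 (defined in the context) with $\gamma>0$. (1) There exists a continuous and strictly positive function $h_a:\Omega\to\mathbb{R}$, unique up to multiplication by positive constants, such that $\mathcal{L}_a(h_a)=\lambda_a^{(1)}h_a$ for some $\lambda_a^{(1)}>0$. Moreover, $h_a$ is $\omega^\dagger$-Hölder continuous. (2) There exists a unique Borel probability measure $m_a$ such that, for some $\lambda_a^{(2)}>0$, $\int\mathcal{L}_a(f)\,dm_a=\lambda_a^{(2)}\int f\,dm_a$ for every continuous $f:\Omega\to\mathbb{R}$. (3) $\lambda_a^{(1)}=\lambda_a^{(2)}=:\lambda_a$. (4) Normalize $h_a$ by $\int h_a\,dm_a=1$. For every $M>0$ there exists $C>0$ such that for all potentials $a,b$ (in the same case, with the same parameters) with $\mathrm{H\ddot{o}l}_{(\ast)}(a),\mathrm{H\ddot{o}l}_{(\ast)}(b)<M$, where $(\ast)$ stands for $\omega_{0,\beta\log}$ in Case 1 and for $\omega_{\alpha,0\log}$ in Case 2, $$W_{\omega^\dagger}(m_a,m_b),\ \|h_a-h_b\|_\infty,\ |\lambda_a-\lambda_b|\ \le\ C\,\|a-b\|_\infty^{\frac{\gamma}{\gamma+1}} .$$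
   Context: $\mathbb{N}=\{1,2,\dots\}$. Ruelle expansive: let $r>0$ and let $c_n:[0,1]\to[0,\infty)$ be functions with $c_n(0)=0$, $t\mapsto c_n(t)$ strictly increasing, $n\mapsto c_n(t)$ decreasing and $\lim_n c_n(t)=0$ for all $t$. $T$ is $(c,r)$-Ruelle expansive (contraction rate $c_n$) if for all $n\in\mathbb{N}$ and $x,y,\tilde x\in\Omega$ with $d(x,y)<r$ and $T^n(\tilde x)=x$ there is a unique $\tilde y\in\Omega$ with $T^n(\tilde y)=y$ and $d(T^k\tilde x,T^k\tilde y)\le c_{n-k}(d(x,y))$ for $k=0,\dots,n$. Ruelle expanding: there are $\lambda\in(0,1)$, $r>0$ such that for all $x,y,\tilde x$ with $d(x,y)<r$, $T(\tilde x)=x$ there is a unique $\tilde y$ with $T(\tilde y)=y$ and $d(\tilde x,\tilde y)<\lambda r$, and furthermore $d(\tilde x,\tilde y)\le\lambda d(x,y)$. Throughout, $T$ and its iterates are local homeomorphisms of $\Omega$. Topologically mixing: for all nonempty open $U,V\subset\Omega$ there is $k$ with $T^{-n}(U)\cap V\ne\emptyset$ for all $n>k$. Ruelle operator: $\mathcal{L}_a(f)(x)=\sum_{T(y)=x}e^{a(y)}f(y)$. Hölder classes: $f$ is $\omega$-Hölder if there is a constant with $|f(x)-f(y)|\le \mathrm{H\ddot{o}l}_\omega(f)\,\omega(d(x,y))$ for all $x,y\in\Omega$; $\mathrm{H\ddot{o}l}_\omega(f)$ is the least such constant. For $\alpha,\beta\ge0$ (not both zero), $\omega_{\alpha,\beta\log}(t)=t^\alpha(\log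 t_0-\log t)^{-\beta}$, where $t_0>1$ is a constant chosen such that this function is concave on $[0,1]$; in particular $\omega_{\alpha,0\log}(t)=t^\alpha$. Case 1: $T$ is Ruelle expanding and $a$ is $\omega_{0,\beta\log}$-Hölder for some $\beta>1$. Then $\gamma:=\beta-1$, $\omega^\dagger:=\omega_{0,(\beta-1)\log}$. Case 2: $T$ is Ruelle expansive with contraction rate $c_n(t)=(t^{-1/\beta}+n)^{-\beta}$ (up to a multiplicative constant) for some $\beta>1$ and $a$ is $\omega_{\alpha,0\log}$-Hölder for some $\alpha>1/\beta$. Then $\gamma:=\alpha\beta-1$, $\omega^\dagger:=\omega_{\alpha-1/\beta,0\log}$. Wasserstein distance: $W_{\omega}(\mu_1,\mu_2)=\inf\{\int\omega(d(x,y))\,dQ(x,y): Q\text{ a coupling of }\mu_1,\mu_2\}$, a coupling being a probability measure on $\Omega\times\Omega$ with marginals $\mu_1,\mu_2$.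
   Formalization: In (4), the bound on |λ_a−λ_b| is stated only for ‖a‖_∞, ‖b‖_∞ < M; with only the Hölder constants bounded it fails (a=0, b=s constant gives λ_b=e^s λ_a, s large). The bounds for W(m_a,m_b) and ‖h_a−h_b‖_∞ are unchanged. *)

theory Defs
  imports "HOL-Probability.Probability"
begin

text \<open>The compact metric space \<open>\<Omega>\<close> is a type of class \<^class>\<open>metric_space\<close> whose universe is
  assumed compact and of diameter 1.\<close>

definition local_homeomorphism :: "('a::topological_space \<Rightarrow> 'b::topological_space) \<Rightarrow> bool" where
  "local_homeomorphism f \<longleftrightarrow>
     (\<forall>x. \<exists>U V g. open U \<and> x \<in> U \<and> open V \<and> homeomorphism U V f g)"

definition topologically_mixing :: "('a::topological_space \<Rightarrow> 'a) \<Rightarrow> bool" where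
  "topologically_mixing T \<longleftrightarrow>
     (\<forall>U V. open U \<and> open V \<and> U \<noteq> {} \<and> V \<noteq> {} \<longrightarrow>
        (\<exists>k. \<forall>n>k. (T ^^ n) -` U \<inter> V \<noteq> {}))"

text \<open>The rate \<open>c n\<close> is needed for all \<open>n \<ge> 0\<close>: the index \<open>n - k\<close> in the definition of
  Ruelle expansiveness takes the value 0.\<close>

definition contraction_rate :: "(nat \<Rightarrow> real \<Rightarrow> real) \<Rightarrow> bool" where
  "contraction_rate c \<longleftrightarrow>
     (\<forall>n. c n 0 = 0 \<and> (\<forall>t\<in>{0..1}. 0 \<le> c n t) \<and> strict_mono_on {0..1} (c n)) \<and>
     (\<forall>t\<in>{0..1}. antimono (\<lambda>n. c n t) \<and> (\<lambda>n. c n t) \<longlonglongrightarrow> 0)"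

definition ruelle_expansive ::
    "(nat \<Rightarrow> real \<Rightarrow> real) \<Rightarrow> real \<Rightarrow> ('a::metric_space \<Rightarrow> 'a) \<Rightarrow> bool" where
  "ruelle_expansive c r T \<longleftrightarrow> r > 0 \<and> contraction_rate c \<and>
     (\<forall>n\<ge>1. \<forall>x y x'. dist x y < r \<and> (T ^^ n) x' = x \<longrightarrow>
        (\<exists>!y'. (T ^^ n) y' = y \<and>
           (\<forall>k\<le>n. dist ((T ^^ k) x') ((T ^^ k) y') \<le> c (n - k) (dist x y))))"

definition ruelle_expanding :: "('a::metric_space \<Rightarrow> 'a) \<Rightarrow> bool" where
  "ruelle_expanding T \<longleftrightarrow> (\<exists>l r. 0 < l \<and> l < 1 \<and> r > 0 \<and>
     (\<forall>x y x'. dist x y < r \<and> T x' = x \<longrightarrow>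
        (\<exists>!y'. T y' = y \<and> dist x' y' < l * r) \<and>
        (\<forall>y'. T y' = y \<and> dist x' y' < l * r \<longrightarrow> dist x' y' \<le> l * dist x y)))"

text \<open>In the next two definitions the value at \<open>t = 0\<close> is given separately, since the
  conventions \<open>ln 0 = 0\<close> and \<open>0 powr s = 0\<close> would produce a nonzero value there.\<close>

definition poly_rate :: "real \<Rightarrow> real \<Rightarrow> nat \<Rightarrow> real \<Rightarrow> real" where
  "poly_rate K \<beta> n t =
     (if t = 0 then 0 else K * (t powr (- 1 / \<beta>) + real n) powr (- \<beta>))"

definition log_modulus :: "real \<Rightarrow> real \<Rightarrow> real \<Rightarrow> real \<Rightarrow> real" where
  "log_modulus \<alpha> \<beta> t0 t =
     (if t = 0 then 0 else t powr \<alpha> * (ln t0 - ln t) powr (- \<beta>))"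

definition admissible :: "real \<Rightarrow> real \<Rightarrow> real \<Rightarrow> bool" where
  "admissible \<alpha> \<beta> t0 \<longleftrightarrow> \<alpha> \<ge> 0 \<and> \<beta> \<ge> 0 \<and> (\<alpha> \<noteq> 0 \<or> \<beta> \<noteq> 0) \<and> t0 > 1 \<and>
     concave_on {0..1} (log_modulus \<alpha> \<beta> t0)"

definition holder :: "(real \<Rightarrow> real) \<Rightarrow> ('a::metric_space \<Rightarrow> real) \<Rightarrow> bool" where
  "holder \<omega> f \<longleftrightarrow> (\<exists>C. \<forall>x y. \<bar>f x - f y\<bar> \<le> C * \<omega> (dist x y))"

definition holder_const :: "(real \<Rightarrow> real) \<Rightarrow> ('a::metric_space \<Rightarrow> real) \<Rightarrow> real" where
  "holder_const \<omega> f = Inf {C. \<forall>x y. \<bar>f x - f y\<bar> \<le> C * \<omega> (dist x y)}"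

definition sup_norm :: "('a \<Rightarrow> real) \<Rightarrow> real" where
  "sup_norm f = (SUP x. \<bar>f x\<bar>)"

text \<open>The fibres of a local homeomorphism of a compact space are finite, so the finite sum
  below is never a default value.\<close>

definition ruelle_op :: "('a \<Rightarrow> 'a) \<Rightarrow> ('a \<Rightarrow> real) \<Rightarrow> ('a \<Rightarrow> real) \<Rightarrow> 'a \<Rightarrow> real" where
  "ruelle_op T a f x = (\<Sum>y | T y = x. exp (a y) * f y)"

definition borel_prob :: "'a::topological_space measure \<Rightarrow> bool" where
  "borel_prob m \<longleftrightarrow> prob_space m \<and> sets m = sets borel"

definition eigenfunction ::
    "('a::topological_space \<Rightarrow> 'a) \<Rightarrow> ('a \<Rightarrow> real) \<Rightarrow> ('a \<Rightarrow> real) \<Rightarrow> real \<Rightarrow> bool" where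
  "eigenfunction T a h l \<longleftrightarrow> l > 0 \<and> continuous_on UNIV h \<and> (\<forall>x. h x > 0) \<and>
     (\<forall>x. ruelle_op T a h x = l * h x)"

definition eigenmeasure ::
    "('a::topological_space \<Rightarrow> 'a) \<Rightarrow> ('a \<Rightarrow> real) \<Rightarrow> 'a measure \<Rightarrow> real \<Rightarrow> bool" where
  "eigenmeasure T a m l \<longleftrightarrow> l > 0 \<and> borel_prob m \<and>
     (\<forall>f. continuous_on UNIV f \<longrightarrow> (LINT x|m. ruelle_op T a f x) = l * (LINT x|m. f x))"

definition couplings ::
    "'a::topological_space measure \<Rightarrow> 'a measure \<Rightarrow> ('a \<times> 'a) measure set" where
  "couplings m1 m2 = {Q. borel_prob Q \<and> distr Q borel fst = m1 \<and> distr Q borel snd = m2}"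

definition wasserstein ::
    "(real \<Rightarrow> real) \<Rightarrow> 'a::metric_space measure \<Rightarrow> 'a measure \<Rightarrow> real" where
  "wasserstein \<omega> m1 m2 = (INF Q\<in>couplings m1 m2. LINT (x,y)|Q. \<omega> (dist x y))"

end

theory Submission
  imports Defs "HOL-Real_Asymp.Real_Asymp"
begin

text \<open>Write \<open>L\<^sub>a\<^sup>n\<close> for the iterated operator. Inverse branches of \<open>T\<^sup>n\<close> over nearby points come in pairs,
  and the distortion of Birkhoff sums along a pair is bounded by the modulus \<open>\<omega>'\<close>, since the
  \<open>\<omega>\<close>-variations along the backward orbits sum to it. The quotients \<open>L\<^sub>a\<^sup>n u / L\<^sub>a\<^sup>n 1\<close> are averages of \<open>u\<close>
  along a Markov chain. Over nearby points their difference at time \<open>n\<close> is at most a small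
  multiple of the oscillation at time \<open>n/2\<close> plus a term of order \<open>n\<^sup>-\<^sup>\<gamma>\<close>, and by mixing a definite
  proportion of the mass over any two points can be brought close together; hence the oscillation
  is of order \<open>n\<^sup>-\<^sup>\<gamma>\<close>, uniformly in \<open>a\<close>. This makes \<open>L\<^sub>a\<^sup>n 1\<close>, normalised at a point, converge to the
  eigenfunction.

  Perturbing \<open>a\<close> by \<open>\<epsilon>\<close> changes the quotients by order \<open>n\<epsilon>\<close>, and the choice \<open>n \<approx> \<epsilon>\<^sup>-\<^sup>1\<^sup>/\<^sup>(\<^sup>\<gamma>\<^sup>+\<^sup>1\<^sup>)\<close> balances this
  against \<open>n\<^sup>-\<^sup>\<gamma>\<close>. Eigenmeasures and optimal couplings are both obtained from one principle: a
  convex cone of continuous functions none of which is negative everywhere admits a probability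
  measure integrating all of them to nonnegative values.\<close>

section \<open>Linear functionals below sublinear ones\<close>

text \<open>The obstacle is the absence of geometric contraction for the moduli. Birkhoff sums along
  paired branches are controlled only by the weaker modulus \<open>\<omega>'\<close>, and iteration
  keeps the \<open>\<omega>'\<close>-modulus bounded without shrinking it. The decay is therefore
  proved by induction on time: waiting a fixed number \<open>N\<close> of steps shrinks the
  oscillation by a fixed factor, while \<open>rate n / rate (n - N)\<close> tends to 1, so a
  polynomial bound reproduces itself. Quotients by \<open>L\<^sub>a\<^sup>n 1\<close> serve because
  they involve no eigenvalue, which is only constructed from the decay. Stability needs constants
  common to all potentials, hence the estimates live in a locale that knows a potential only through
  the bound \<open>H\<close>. The cone principle applies to eigenmeasures because
  \<open>u - L u / l\<close> is nonnegative where \<open>u / h\<close> is maximal, and to couplings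
  because a negative element would yield a test function violating the dual bound. Both cases of the
  theorem enter through a single estimate: at depth \<open>j\<close> over two points at distance
  \<open>t\<close>, the modulus \<open>\<omega>\<close> is at most of order
  \<open>(s t + \<eta> * j) powr (- \<gamma> - 1)\<close>, and the sum over \<open>j\<close>, of
  order \<open>s t powr - \<gamma>\<close>, is bounded by a multiple of
  \<open>\<omega>' t\<close>.\<close>

definition sublinear :: "('v::real_vector \<Rightarrow> real) \<Rightarrow> bool" where
  "sublinear p \<longleftrightarrow> (\<forall>x y. p (x + y) \<le> p x + p y) \<and> (\<forall>c\<ge>0. \<forall>x. p (c *\<^sub>R x) = c * p x)"

lemma sublinear_add: "sublinear p \<Longrightarrow> p (x + y) \<le> p x + p y"
  by (simp add: sublinear_def)

lemma sublinear_scale: "sublinear p \<Longrightarrow> c \<ge> 0 \<Longrightarrow> p (c *\<^sub>R x) = c * p x"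
  by (simp add: sublinear_def)

lemma sublinear_zero: "sublinear p \<Longrightarrow> p 0 = 0"
  using sublinear_scale[of p 0 0] by simp

lemma sublinear_lower: "sublinear p \<Longrightarrow> - p (- x) \<le> p x"
  using sublinear_add[of p x "- x"] sublinear_zero[of p] by simp

text \<open>Applying the inequality with \<open>1 / c\<close> to \<open>c *\<^sub>R x\<close> gives
  the reverse one.\<close>

lemma sublinear_of_positive_scale:
  assumes "\<And>x y. p (x + y) \<le> p x + p y" and "\<And>c x. c > 0 \<Longrightarrow> p (c *\<^sub>R x) \<le> c * p x" and "p 0 = 0"
  shows "sublinear p"
  unfolding sublinear_def
proof (intro conjI allI impI)
  fix c :: real and x
  assume "c \<ge> 0"
  then show "p (c *\<^sub>R x) = c * p x"
  proof (cases "c = 0")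
    case False
    with \<open>c \<ge> 0\<close> have c: "c > 0" by simp
    have "p ((1 / c) *\<^sub>R (c *\<^sub>R x)) \<le> (1 / c) * p (c *\<^sub>R x)"
      by (rule assms(2)) (use c in simp)
    then have "c * p x \<le> p (c *\<^sub>R x)"
      using c by (simp add: field_simps)
    with assms(2)[OF c, of x] show ?thesis by simp
  qed (simp add: assms(3))
qed (fact assms(1))

text \<open>Sliding along the ray of \<open>y\<close> gives the competitor \<open>q'\<close>, an
  infimum of \<open>q (x + t *\<^sub>R y) - t * q y\<close>, again sublinear and below
  \<open>q\<close>. Minimality makes it equal to \<open>q\<close>; the value \<open>t = 1\<close> at
  \<open>- y\<close> then shows \<open>q (- y) \<le> - q y\<close>, and an odd sublinear functional
  is linear.\<close>

lemma sublinear_minimal_linear: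
  assumes q: "sublinear q"
    and minimal: "\<And>q'. sublinear q' \<Longrightarrow> (\<And>x. q' x \<le> q x) \<Longrightarrow> q' = q"
  shows "linear q"
proof -
  have odd: "q (- y) = - q y" for y
  proof -
    define q' where "q' x = (INF t\<in>{0..}. q (x + t *\<^sub>R y) - t * q y)" for x
    have bdd: "bdd_below ((\<lambda>t. q (x + t *\<^sub>R y) - t * q y) ` {0..})" for x
    proof (rule bdd_belowI2)
      fix t :: real assume "t \<in> {0..}"
      then have "t * q y = q (t *\<^sub>R y)" by (simp add: sublinear_scale[OF q])
      also have "\<dots> \<le> q (x + t *\<^sub>R y) + q (- x)"
        using sublinear_add[OF q, of "x + t *\<^sub>R y" "- x"] by simp
      finally show "- q (- x) \<le> q (x + t *\<^sub>R y) - t * q y" by simp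
    qed
    have lower: "q' x \<le> q (x + t *\<^sub>R y) - t * q y" if "t \<ge> 0" for x t
      unfolding q'_def using that by (intro cINF_lower bdd) auto
    have le: "q' x \<le> q x" for x
      using lower[of 0 x] by simp
    have "sublinear q'"
    proof (rule sublinear_of_positive_scale)
      fix x z
      have "q' (x + z) - (q (z + s *\<^sub>R y) - s * q y) \<le> q (x + t *\<^sub>R y) - t * q y"
        if "t \<ge> 0" "s \<ge> 0" for t s
      proof -
        have "q' (x + z) \<le> q ((x + t *\<^sub>R y) + (z + s *\<^sub>R y)) - (t + s) * q y"
          using lower[of "t + s" "x + z"] that by (simp add: algebra_simps)
        with sublinear_add[OF q, of "x + t *\<^sub>R y" "z + s *\<^sub>R y"] show ?thesis
          by (simp add: algebra_simps)
      qed
      then have "q' (x + z) - (q (z + s *\<^sub>R y) - s * q y) \<le> q' x" if "s \<ge> 0" for s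
        unfolding q'_def[of x] using that by (intro cINF_greatest) auto
      then have "q' (x + z) - q' x \<le> q (z + s *\<^sub>R y) - s * q y" if "s \<ge> 0" for s
        using that by (simp add: algebra_simps)
      then have "q' (x + z) - q' x \<le> q' z"
        unfolding q'_def[of z] by (intro cINF_greatest) auto
      then show "q' (x + z) \<le> q' x + q' z" by simp
    next
      fix c :: real and x assume c: "c > 0"
      have "q' (c *\<^sub>R x) / c \<le> q (x + t *\<^sub>R y) - t * q y" if "t \<ge> 0" for t
      proof -
        have "q' (c *\<^sub>R x) \<le> q (c *\<^sub>R (x + t *\<^sub>R y)) - (c * t) * q y"
          using lower[of "c * t" "c *\<^sub>R x"] that c by (simp add: algebra_simps)
        also have "\<dots> = c * (q (x + t *\<^sub>R y) - t * q y)"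
          using c by (simp add: sublinear_scale[OF q] algebra_simps del: scaleR_add_right)
        finally show ?thesis using c by (simp add: field_simps)
      qed
      then have "q' (c *\<^sub>R x) / c \<le> q' x"
        unfolding q'_def[of x] by (intro cINF_greatest) auto
      then show "q' (c *\<^sub>R x) \<le> c * q' x" using c by (simp add: field_simps)
    next
      have "q (0 + t *\<^sub>R y) - t * q y = 0" if "t \<ge> 0" for t
        using that by (simp add: sublinear_scale[OF q])
      then have "q' 0 = (INF t\<in>{0::real..}. 0)"
        unfolding q'_def by (intro INF_cong) auto
      then show "q' 0 = 0" by simp
    qed
    then have "q' = q" using le by (rule minimal)
    then have "q (- y) \<le> q (- y + 1 *\<^sub>R y) - 1 * q y" using lower[of 1 "- y"] by simp
    then have "q (- y) \<le> - q y" by (simp add: sublinear_zero[OF q])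
    with sublinear_lower[OF q, of y] show ?thesis by simp
  qed
  show ?thesis
  proof (rule linearI)
    fix x y
    have "q (- (x + y)) \<le> q (- x) + q (- y)"
      using sublinear_add[OF q, of "- x" "- y"] by simp
    then show "q (x + y) = q x + q y"
      using sublinear_add[OF q, of x y] odd[of "x + y"] odd[of x] odd[of y] by linarith
  next
    fix c :: real and x
    show "q (c *\<^sub>R x) = c *\<^sub>R q x"
    proof (cases "c \<ge> 0")
      case False
      have "q (c *\<^sub>R x) = - q ((- c) *\<^sub>R x)" using odd[of "c *\<^sub>R x"] by simp
      also have "q ((- c) *\<^sub>R x) = (- c) * q x"
        using False by (intro sublinear_scale[OF q]) simp
      finally show ?thesis by simp
    qed (simp add: sublinear_scale[OF q])
  qed
qed

text \<open>Hahn-Banach by Zorn's lemma applied downwards to the sublinear functionals below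
  \<open>p\<close>. Infima along chains are finite, since \<open>- p (- x)\<close> bounds every
  member at \<open>x\<close> from below.\<close>

theorem sublinear_dominates_linear:
  fixes p :: "'v::real_vector \<Rightarrow> real"
  assumes p: "sublinear p"
  obtains L where "linear L" "\<And>x. L x \<le> p x"
proof -
  define A where "A = {q. sublinear q \<and> q \<le> p}"
  \<comment> \<open>The order is reversed, so the maximal element of Zorn's lemma is a minimal
    functional.\<close>
  have po: "partial_order_on A (relation_of (\<lambda>q q'. q' \<le> q) A)"
    by (rule partial_order_on_relation_ofI) auto
  have "\<exists>u\<in>A. \<forall>q\<in>C. u \<le> q" if C: "C \<in> Chains (relation_of (\<lambda>q q'. q' \<le> q) A)" for C
  proof (cases "C = {}")
    case True
    with p show ?thesis by (auto simp: A_def)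
  next
    case False
    have CA: "q \<in> A" if "q \<in> C" for q
      using C that by (auto simp: Chains_def relation_of_def)
    have chain: "q \<le> q' \<or> q' \<le> q" if "q \<in> C" "q' \<in> C" for q q'
      using C that by (auto simp: Chains_def relation_of_def)
    define u where "u x = (INF q\<in>C. q x)" for x
    have bdd: "bdd_below ((\<lambda>q. q x) ` C)" for x
    proof (rule bdd_belowI2)
      fix q assume "q \<in> C"
      then have "sublinear q" "q (- x) \<le> p (- x)" using CA by (auto simp: A_def le_fun_def)
      with sublinear_lower[of q x] show "- p (- x) \<le> q x" by linarith
    qed
    have lower: "u x \<le> q x" if "q \<in> C" for q x
      unfolding u_def using that bdd by (intro cINF_lower)
    have "sublinear u"
    proof (rule sublinear_of_positive_scale)
      fix x y
      have "u (x + y) - q2 y \<le> q1 x" if q: "q1 \<in> C" "q2 \<in> C" for q1 q2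
      proof -
        \<comment> \<open>The chain property enters here: a single member below both
          \<open>q1\<close> and \<open>q2\<close> has its own subadditivity to offer, which an
          infimum of unrelated sublinear functionals need not inherit.\<close>
        obtain q where "q \<in> C" "q \<le> q1" "q \<le> q2" using chain q by blast
        then show ?thesis
          using lower[of q "x + y"] sublinear_add[of q x y] CA[of q]
          by (auto simp: A_def le_fun_def) (smt (verit, best))
      qed
      then have "u (x + y) - q2 y \<le> u x" if "q2 \<in> C" for q2
        unfolding u_def[of x] using False that by (intro cINF_greatest) auto
      then have "u (x + y) - u x \<le> q2 y" if "q2 \<in> C" for q2
        using that by (simp add: algebra_simps)
      then have "u (x + y) - u x \<le> u y"
        unfolding u_def[of y] using False by (intro cINF_greatest) auto
      then show "u (x + y) \<le> u x + u y" by simp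
    next
      fix c :: real and x assume c: "c > 0"
      have "u (c *\<^sub>R x) / c \<le> q x" if "q \<in> C" for q
        using lower[OF that, of "c *\<^sub>R x"] CA[OF that] c
        by (auto simp: A_def sublinear_scale field_simps)
      then have "u (c *\<^sub>R x) / c \<le> u x"
        unfolding u_def[of x] using False by (intro cINF_greatest) auto
      then show "u (c *\<^sub>R x) \<le> c * u x" using c by (simp add: field_simps)
    next
      have "u 0 = (INF q\<in>C. 0)"
        unfolding u_def using CA by (intro INF_cong) (auto simp: A_def sublinear_zero)
      then show "u 0 = 0" using False by simp
    qed
    moreover obtain q where "q \<in> C" using False by blast
    then have "u \<le> p"
      using lower[of q] CA[of q] by (auto simp: A_def le_fun_def intro: order_trans)
    ultimately show ?thesis using lower by (auto simp: A_def le_fun_def)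
  qed
  from predicate_Zorn[OF po this] obtain q where q: "q \<in> A" "\<And>q'. q' \<in> A \<Longrightarrow> q' \<le> q \<Longrightarrow> q' = q"
    by metis
  have "linear q"
  proof (rule sublinear_minimal_linear)
    show "sublinear q" using q(1) by (simp add: A_def)
    fix q' assume "sublinear q'" "\<And>x. q' x \<le> q x"
    moreover from this have "\<forall>x. q' x \<le> p x" using q(1)
      by (fastforce simp: A_def le_fun_def intro: order_trans)
    ultimately show "q' = q" using q(2)[of q'] by (simp add: A_def le_fun_def)
  qed
  moreover have "q x \<le> p x" for x using q(1) by (simp add: A_def le_fun_def)
  ultimately show thesis by (rule that)
qed

section \<open>The Riesz representation theorem on compact metric spaces\<close>

lemma suminf_ennreal_telescope:
  fixes u :: "nat \<Rightarrow> real"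
  assumes "incseq u" and "u 0 = 0"
  shows "(\<Sum>k. ennreal (u (Suc k) - u k)) = (SUP k. ennreal (u k))"
proof -
  have "(\<Sum>k<n. ennreal (u (Suc k) - u k)) = ennreal (u n)" for n
  proof -
    have "(\<Sum>k<n. ennreal (u (Suc k) - u k)) = ennreal (\<Sum>k<n. u (Suc k) - u k)"
      by (rule sum_ennreal) (use assms(1) in \<open>auto simp: incseq_SucD\<close>)
    also have "(\<Sum>k<n. u (Suc k) - u k) = u n"
      using sum_lessThan_telescope[of u n] assms(2) by simp
    finally show ?thesis .
  qed
  then show ?thesis by (simp add: suminf_eq_SUP)
qed

lemma bounded_continuous_compact:
  fixes f :: "'a::topological_space \<Rightarrow> real"
  assumes "compact (UNIV :: 'a set)" "continuous_on UNIV f"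
  obtains B where "B > 0" "\<And>x. \<bar>f x\<bar> \<le> B"
proof -
  have "compact (f ` UNIV)" by (rule compact_continuous_image[OF assms(2,1)])
  then obtain B where "\<And>x. \<bar>f x\<bar> \<le> B"
    using compact_imp_bounded[of "f ` UNIV"] unfolding bounded_iff by auto
  then show thesis by (intro that[of "max 1 B"]) (auto intro: order_trans[OF _ max.cobounded2])
qed

lemma integrable_continuous_compact:
  fixes f :: "'a::topological_space \<Rightarrow> real"
  assumes "compact (UNIV :: 'a set)" "borel_prob m" "continuous_on UNIV f"
  shows "integrable m f"
proof -
  interpret prob_space m using assms(2) by (simp add: borel_prob_def)
  have sets: "sets m = sets borel" using assms(2) by (simp add: borel_prob_def)
  obtain B where "\<And>x. \<bar>f x\<bar> \<le> B" using bounded_continuous_compact[OF assms(1,3)] by blast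
  moreover have "f \<in> borel_measurable m"
    using borel_measurable_continuous_onI[OF assms(3)] by (simp cong: measurable_cong_sets add: sets)
  ultimately show ?thesis by (intro integrable_const_bound[of _ B]) auto
qed

text \<open>\<open>L\<close> is total on real functions but constrained only on continuous ones,
  hence the continuity premises in every law.\<close>

locale mean_functional =
  fixes L :: "('a::metric_space \<Rightarrow> real) \<Rightarrow> real"
  assumes compact_space: "compact (UNIV :: 'a set)"
    and add: "continuous_on UNIV f \<Longrightarrow> continuous_on UNIV g \<Longrightarrow> L (\<lambda>x. f x + g x) = L f + L g"
    and scale: "continuous_on UNIV f \<Longrightarrow> L (\<lambda>x. c * f x) = c * L f"
    and pos: "continuous_on UNIV f \<Longrightarrow> (\<And>x. 0 \<le> f x) \<Longrightarrow> 0 \<le> L f"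
    and one: "L (\<lambda>x. 1) = 1"
begin

lemma diff:
  assumes "continuous_on UNIV f" "continuous_on UNIV g"
  shows "L (\<lambda>x. f x - g x) = L f - L g"
  using add[of f "\<lambda>x. (-1) * g x"] scale[of g "-1"] assms by (simp add: continuous_intros)

lemma const: "L (\<lambda>x. c) = c"
  using scale[of "\<lambda>x. 1" c] one by (simp add: continuous_intros)

lemma mono:
  assumes "continuous_on UNIV f" "continuous_on UNIV g" "\<And>x. f x \<le> g x"
  shows "L f \<le> L g"
  using pos[of "\<lambda>x. g x - f x"] diff[of g f] assms by (simp add: continuous_intros)

lemma sum_cont:
  assumes "\<And>i. i \<in> I \<Longrightarrow> continuous_on UNIV (f i)"
  shows "L (\<lambda>x. \<Sum>i\<in>I. f i x) = (\<Sum>i\<in>I. L (f i))"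
  using assms
  by (induction I rule: infinite_finite_induct) (simp_all add: const add continuous_on_sum)

section \<open>Outer measure of a positive functional and Caratheodory's extension\<close>

definition covering :: "(nat \<Rightarrow> 'a \<Rightarrow> real) \<Rightarrow> 'a set \<Rightarrow> bool" where
  "covering g A \<longleftrightarrow> (\<forall>n. continuous_on UNIV (g n)) \<and> (\<forall>n x. 0 \<le> g n x) \<and>
     (\<forall>x\<in>A. 1 \<le> (\<Sum>n. ennreal (g n x)))"

text \<open>The Daniell upper integral of the indicator of \<open>A\<close>. Countable covers by
  functions make countable subadditivity a matter of merging double sequences; the work shifts to
  showing that the whole space keeps mass one.\<close>

definition outer :: "'a set \<Rightarrow> ennreal" where
  "outer A = (INF g\<in>{g. covering g A}. \<Sum>n. ennreal (L (g n)))"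

lemma outer_le: "covering g A \<Longrightarrow> outer A \<le> (\<Sum>n. ennreal (L (g n)))"
  unfolding outer_def by (rule INF_lower) simp

lemma outer_close:
  assumes "outer A < c"
  obtains g where "covering g A" "(\<Sum>n. ennreal (L (g n))) < c"
  using assms unfolding outer_def INF_less_iff by auto

lemma outer_mono: "A \<subseteq> B \<Longrightarrow> outer A \<le> outer B"
  unfolding outer_def by (rule INF_superset_mono) (auto simp: covering_def)

lemma outer_le_single:
  assumes f: "continuous_on UNIV f" "\<And>x. 0 \<le> f x" "\<And>x. x \<in> A \<Longrightarrow> 1 \<le> f x"
  shows "outer A \<le> ennreal (L f)"
proof -
  define g where "g n x = (if n = 0 then f x else 0)" for n :: nat and x
  have g: "g 0 = f" "\<And>n. n \<noteq> 0 \<Longrightarrow> g n = (\<lambda>x. 0)" by (auto simp: g_def)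
  have "(\<Sum>n. ennreal (g n x)) = ennreal (f x)" for x
    by (subst suminf_finite[of "{0}"]) (auto simp: g_def)
  moreover have "continuous_on UNIV (g n)" for n using f(1) by (cases "n = 0") (simp_all add: g)
  ultimately have "covering g A"
    using f by (simp add: covering_def) (simp add: g_def)
  then have "outer A \<le> (\<Sum>n. ennreal (L (g n)))" by (rule outer_le)
  also have "\<dots> = ennreal (L f)"
    by (subst suminf_finite[of "{0}"]) (auto simp: g const)
  finally show ?thesis .
qed

lemma outer_empty: "outer {} = 0"
  using outer_le_single[of "\<lambda>x. 0" "{}"] by (simp add: const)

lemma outer_countably_subadditive: "outer (\<Union>i. A i) \<le> (\<Sum>i. outer (A i))"
proof (rule ennreal_le_epsilon)
  fix e :: real assume e: "0 < e" "(\<Sum>i. outer (A i)) < top"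
  then have "outer (A n) < outer (A n) + e * (1/2)^Suc n" for n
    by (auto simp add: less_top dest!: ennreal_suminf_lessD)
  then have "\<exists>g. covering g (A n) \<and> (\<Sum>k. ennreal (L (g k))) \<le> outer (A n) + e * (1/2)^Suc n" for n
    by (metis less_imp_le outer_close)
  then obtain g where g: "\<And>n. covering (g n) (A n)"
    and gle: "\<And>n. (\<Sum>k. ennreal (L (g n k))) \<le> outer (A n) + e * (1/2)^Suc n"
    by metis
  define G where "G i = case_prod g (prod_decode i)" for i
  have "covering G (\<Union>i. A i)"
    unfolding covering_def
  proof (intro conjI allI ballI)
    fix x assume "x \<in> (\<Union>i. A i)"
    then obtain n where n: "x \<in> A n" by blast
    have "1 \<le> (\<Sum>k. ennreal (g n k x))" using g[of n] n by (auto simp: covering_def)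
    also have "\<dots> \<le> (\<Sum>n. \<Sum>k. ennreal (g n k x))"
      using sum_le_suminf[of "\<lambda>n. \<Sum>k. ennreal (g n k x)" "{n}"] by simp
    also have "\<dots> = (\<Sum>i. ennreal (G i x))"
      using suminf_ennreal_2dimen[of "\<lambda>n. \<Sum>k. ennreal (g n k x)" "\<lambda>(n,k). ennreal (g n k x)"]
      by (simp add: G_def split_def)
    finally show "1 \<le> (\<Sum>i. ennreal (G i x))" .
  qed (use g in \<open>auto simp: covering_def G_def split_def\<close>)
  then have "outer (\<Union>i. A i) \<le> (\<Sum>i. ennreal (L (G i)))" by (rule outer_le)
  also have "\<dots> = (\<Sum>n. \<Sum>k. ennreal (L (g n k)))"
    using suminf_ennreal_2dimen[of "\<lambda>n. \<Sum>k. ennreal (L (g n k))" "\<lambda>(n,k). ennreal (L (g n k))"]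
    by (simp add: G_def split_def)
  also have "\<dots> \<le> (\<Sum>n. outer (A n) + e * (1/2)^Suc n)"
    by (intro suminf_le gle) auto
  also have "\<dots> = (\<Sum>n. outer (A n)) + (\<Sum>n. ennreal e * ennreal ((1/2) ^ Suc n))"
    using \<open>0 < e\<close> by (subst suminf_add[symmetric])
                     (auto simp del: ennreal_suminf_cmult simp add: ennreal_mult[symmetric])
  also have "\<dots> = (\<Sum>n. outer (A n)) + e"
    unfolding ennreal_suminf_cmult
    by (subst suminf_ennreal_eq[OF zero_le_power power_half_series]) auto
  finally show "outer (\<Union>i. A i) \<le> (\<Sum>n. outer (A n)) + e" .
qed

text \<open>The ramps \<open>t k\<close> vanish on \<open>C\<close> and reach 1 at every point
  outside. For a cover \<open>g\<close> of \<open>E\<close>, the functions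
  \<open>g n * (1 - t k)\<close> cover \<open>E \<inter> C\<close> for each \<open>k\<close>, and
  the increments \<open>g n * (t (Suc k) - t k)\<close>, over all \<open>n\<close> and
  \<open>k\<close>, cover \<open>E - C\<close>. The increments telescope to a supremum over
  \<open>k\<close>, and for each fixed \<open>k\<close> the two costs add up to that of
  \<open>g\<close>.\<close>

lemma outer_split_closed:
  assumes C: "closed C"
  shows "outer (E \<inter> C) + outer (E - C) \<le> outer E"
proof (cases "C = {}")
  case True
  then show ?thesis by (simp add: outer_empty)
next
  case False
  define t where "t k x = min 1 (real k * infdist x C)" for k :: nat and x
  have t_cont: "continuous_on UNIV (t k)" for k
    unfolding t_def by (intro continuous_intros)
  have t_bounds: "0 \<le> t k x" "t k x \<le> 1" for k x by (auto simp: t_def infdist_nonneg)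
  have t_mono: "t k x \<le> t (Suc k) x" for k x
    unfolding t_def by (intro min.mono mult_right_mono) (auto simp: infdist_nonneg)
  have t_C: "t k x = 0" if "x \<in> C" for k x using that by (simp add: t_def)
  have t_out: "\<exists>k. t k x = 1" if "x \<notin> C" for x
  proof -
    have "infdist x C > 0" using that C False by (simp add: infdist_pos_not_in_closed)
    then obtain k where "1 < real k * infdist x C" using reals_Archimedean3 by blast
    then show ?thesis by (intro exI[of _ k]) (simp add: t_def)
  qed
  show ?thesis
    unfolding outer_def[of E]
  proof (rule INF_greatest)
    fix g assume "g \<in> {g. covering g E}"
    then have gc: "continuous_on UNIV (g n)" and g0: "0 \<le> g n x"
      and gE: "x \<in> E \<Longrightarrow> 1 \<le> (\<Sum>n. ennreal (g n x))" for n x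
      by (auto simp: covering_def)
    have gt_cont: "continuous_on UNIV (\<lambda>x. g n x * t k x)" for n k
      by (intro continuous_on_mult gc t_cont)
    have Lgt_mono: "L (\<lambda>x. g n x * t k x) \<le> L (\<lambda>x. g n x * t (Suc k) x)" for n k
      by (intro mono gt_cont mult_left_mono t_mono g0)
    have Lgt_inc: "incseq (\<lambda>k. L (\<lambda>x. g n x * t k x))" for n
      by (rule incseq_SucI) (rule Lgt_mono)
    have inner: "outer (E \<inter> C) \<le> (\<Sum>n. ennreal (L (\<lambda>x. g n x * (1 - t k x))))" for k
      by (rule outer_le) (use gE g0 t_bounds t_C in \<open>auto simp: covering_def intro!:
        continuous_intros gc t_cont\<close>)
    define G where "G i = (case prod_decode i of (n, k) \<Rightarrow> \<lambda>x. g n x * (t (Suc k) x - t k x))" for i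
    have "covering G (E - C)"
      unfolding covering_def
    proof (intro conjI allI ballI)
      fix x assume x: "x \<in> E - C"
      have "g n x \<le> (\<Sum>k. ennreal (g n x * (t (Suc k) x - t k x)))" for n
      proof -
        have inc: "incseq (\<lambda>k. g n x * t k x)"
          by (intro incseq_SucI mult_left_mono t_mono g0)
        obtain k where "t k x = 1" using t_out x by blast
        then have "ennreal (g n x) \<le> (SUP k. ennreal (g n x * t k x))"
          by (intro SUP_upper2[of k]) auto
        then show ?thesis
          using suminf_ennreal_telescope[OF inc] by (simp add: t_def right_diff_distrib)
      qed
      then have "(\<Sum>n. ennreal (g n x)) \<le> (\<Sum>n. \<Sum>k. ennreal (g n x * (t (Suc k) x - t k x)))"
        by (intro suminf_le) auto
      also have "\<dots> = (\<Sum>i. ennreal (G i x))"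
        using suminf_ennreal_2dimen[of "\<lambda>n. \<Sum>k. ennreal (g n x * (t (Suc k) x - t k x))"
            "\<lambda>(n,k). ennreal (g n x * (t (Suc k) x - t k x))"]
        by (simp add: G_def split_def)
      finally show "1 \<le> (\<Sum>i. ennreal (G i x))" using gE[of x] x by (auto intro: order_trans)
    qed (use g0 t_mono in \<open>auto simp: G_def split_def intro!: continuous_intros gc t_cont\<close>)
    then have "outer (E - C) \<le> (\<Sum>i. ennreal (L (G i)))" by (rule outer_le)
    also have "\<dots> = (\<Sum>n. \<Sum>k. ennreal (L (\<lambda>x. g n x * (t (Suc k) x - t k x))))"
      using suminf_ennreal_2dimen[of "\<lambda>n. \<Sum>k. ennreal (L (\<lambda>x. g n x * (t (Suc k) x - t k x)))"
          "\<lambda>(n,k). ennreal (L (\<lambda>x. g n x * (t (Suc k) x - t k x)))"]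
      by (simp add: G_def split_def)
    also have "\<dots> = (\<Sum>n. SUP k. ennreal (L (\<lambda>x. g n x * t k x)))"
    proof (intro suminf_cong)
      fix n
      have "L (\<lambda>x. g n x * (t (Suc k) x - t k x)) = L (\<lambda>x. g n x * t (Suc k) x) - L (\<lambda>x. g n x *
        t k x)" for k
        using diff[OF gt_cont gt_cont] by (simp add: right_diff_distrib)
      moreover have "L (\<lambda>x. g n x * t 0 x) = 0" by (simp add: t_def const infdist_nonneg)
      ultimately show "(\<Sum>k. ennreal (L (\<lambda>x. g n x * (t (Suc k) x - t k x)))) =
        (SUP k. ennreal (L (\<lambda>x. g n x * t k x)))"
        using suminf_ennreal_telescope[OF Lgt_inc] by simp
    qed
    also have "\<dots> = (SUP k. \<Sum>n. ennreal (L (\<lambda>x. g n x * t k x)))"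
      by (intro ennreal_suminf_SUP_eq incseq_SucI ennreal_leI Lgt_mono)
    finally have "outer (E \<inter> C) + outer (E - C) \<le> (SUP k. outer (E \<inter> C) + (\<Sum>n. ennreal (L (\<lambda>x. g n x
      * t k x))))"
      by (simp add: ennreal_SUP_add_right[symmetric] add_left_mono)
    also have "\<dots> \<le> (\<Sum>n. ennreal (L (g n)))"
    proof (rule SUP_least)
      fix k
      have "L (\<lambda>x. g n x * (1 - t k x)) + L (\<lambda>x. g n x * t k x) = L (g n)" for n
        using diff[OF gc[of n] gt_cont[of n k]] by (simp add: right_diff_distrib)
      moreover have "0 \<le> L (\<lambda>x. g n x * (1 - t k x))" "0 \<le> L (\<lambda>x. g n x * t k x)" for n
        using g0 t_bounds by (auto intro!: pos continuous_intros gc t_cont)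
      ultimately have "ennreal (L (\<lambda>x. g n x * (1 - t k x))) + ennreal (L (\<lambda>x. g n x * t k x)) =
        ennreal (L (g n))" for n
        by (simp flip: ennreal_plus)
      then have "(\<Sum>n. ennreal (L (\<lambda>x. g n x * (1 - t k x)))) + (\<Sum>n. ennreal (L (\<lambda>x. g n x * t k x)))
          = (\<Sum>n. ennreal (L (g n)))"
        by (subst suminf_add) auto
      with add_right_mono[OF inner[of k], of "\<Sum>n. ennreal (L (\<lambda>x. g n x * t k x))"]
      show "outer (E \<inter> C) + (\<Sum>n. ennreal (L (\<lambda>x. g n x * t k x))) \<le> (\<Sum>n. ennreal (L (g n)))"
        by simp
    qed
    finally show "outer (E \<inter> C) + outer (E - C) \<le> (\<Sum>n. ennreal (L (g n)))" .
  qed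
qed

text \<open>For the lower bound, compactness replaces a countable cover by one finite partial sum
  exceeding \<open>1 - e\<close> everywhere, to which monotonicity of \<open>L\<close>
  applies.\<close>

lemma outer_UNIV: "outer UNIV = 1"
proof (rule antisym)
  show "outer UNIV \<le> 1" using outer_le_single[of "\<lambda>x. 1" UNIV] by (simp add: one)
  show "1 \<le> outer UNIV"
    unfolding outer_def
  proof (rule INF_greatest)
    fix g assume "g \<in> {g. covering g (UNIV :: 'a set)}"
    then have gc: "continuous_on UNIV (g n)" and g0: "0 \<le> g n x"
      and g1: "1 \<le> (\<Sum>n. ennreal (g n x))" for n x
      by (auto simp: covering_def)
    show "1 \<le> (\<Sum>n. ennreal (L (g n)))"
    proof (rule ennreal_le_epsilon)
      fix e :: real assume e: "0 < e"
      define S where "S N x = (\<Sum>n<N. g n x)" for N x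
      have S_cont: "continuous_on UNIV (S N)" for N
        unfolding S_def by (intro continuous_intros gc)
      have "open {x. 1 - e < S N x}" for N
        by (intro open_Collect_less continuous_intros S_cont)
      moreover have "\<exists>N. 1 - e < S N x" for x
      proof -
        have "ennreal (1 - e) < 1" using e by (simp add: ennreal_less_one_iff)
        also have "\<dots> \<le> (SUP N. \<Sum>n<N. ennreal (g n x))"
          using g1[of x] by (simp add: suminf_eq_SUP)
        finally have "ennreal (1 - e) < (SUP N. \<Sum>n<N. ennreal (g n x))" .
        then obtain N where "ennreal (1 - e) < (\<Sum>n<N. ennreal (g n x))"
          by (auto simp: less_SUP_iff)
        also have "\<dots> = ennreal (S N x)" unfolding S_def by (rule sum_ennreal) (rule g0)
        finally have "1 - e < S N x" by (metis ennreal_leI not_less)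
        then show ?thesis by blast
      qed
      ultimately obtain I where I: "finite I" "UNIV \<subseteq> (\<Union>N\<in>I. {x. 1 - e < S N x})"
        by (rule_tac compactE_image[OF compact_space, of UNIV "\<lambda>N. {x. 1 - e < S N x}"]) auto
      have "1 - e \<le> S (Max I) x" for x
      proof -
        obtain N where N: "N \<in> I" "1 - e < S N x" using I(2) by blast
        have "S N x \<le> S (Max I) x"
          unfolding S_def using I(1) N(1) g0 by (intro sum_mono2) auto
        with N(2) show ?thesis by simp
      qed
      then have "1 - e \<le> L (S (Max I))"
        using mono[of "\<lambda>x. 1 - e" "S (Max I)"] S_cont by (simp add: const)
      also have "L (S (Max I)) = (\<Sum>n<Max I. L (g n))"
        unfolding S_def by (rule sum_cont) (rule gc)
      finally have "ennreal (1 - e) \<le> (\<Sum>n<Max I. ennreal (L (g n)))"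
        by (subst sum_ennreal) (auto intro!: ennreal_leI pos gc g0)
      also have "\<dots> \<le> (\<Sum>n. ennreal (L (g n)))" by (rule sum_le_suminf) auto
      finally have "ennreal (1 - e) + ennreal e \<le> (\<Sum>n. ennreal (L (g n))) + ennreal e"
        by (rule add_right_mono)
      \<comment> \<open>For \<open>e > 1\<close> the first summand is 0 by truncation.\<close>
      moreover have "1 \<le> ennreal (1 - e) + ennreal e"
        using e by (cases "e \<le> 1") (auto simp flip: ennreal_plus simp: ennreal_neg)
      ultimately show "1 \<le> (\<Sum>n. ennreal (L (g n))) + ennreal e" by (rule order_trans[rotated])
    qed
  qed
qed

text \<open>Closed sets satisfy Caratheodory's criterion by \<open>outer_split_closed\<close>, and
  they generate the Borel sets.\<close>

lemma sets_borel_measure_space: "measure_space UNIV (sets borel) outer"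
proof -
  interpret sigma_algebra UNIV "UNIV :: 'a set set" by (metis Pow_UNIV sigma_algebra_Pow)
  have oms: "outer_measure_space UNIV outer"
    by (auto simp: outer_measure_space_def positive_def increasing_def countably_subadditive_def
        outer_empty outer_mono outer_countably_subadditive)
  have ms: "measure_space UNIV (lambda_system UNIV UNIV outer) outer"
    by (rule caratheodory_lemma[OF oms])
  have "Collect closed \<subseteq> lambda_system UNIV UNIV outer"
  proof
    fix C :: "'a set" assume "C \<in> Collect closed"
    then have "outer (E \<inter> C) + outer (E - C) \<le> outer E" for E by (simp add: outer_split_closed)
    moreover have "outer E \<le> outer (E \<inter> C) + outer (E - C)" for E
    proof -
      have "(E \<inter> C) \<inter> (E - C) = {}" "(E \<inter> C) \<union> (E - C) = E" by blast+
      then show ?thesis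
        using subadditiveD[OF countably_subadditive_subadditive, of outer "E \<inter> C" "E - C"] oms
        by (simp add: outer_measure_space_def)
    qed
    ultimately show "C \<in> lambda_system UNIV UNIV outer"
      by (auto simp: lambda_system_eq intro!: antisym)
  qed
  then have sub: "sets (borel :: 'a measure) \<subseteq> lambda_system UNIV UNIV outer"
    using sigma_algebra.sigma_sets_subset[of UNIV "lambda_system UNIV UNIV outer" "Collect closed"] ms
    by (simp add: borel_eq_closed measure_space_def)
  then show ?thesis
    using ms sets.sigma_algebra_axioms[of borel]
    by (auto simp: measure_space_def positive_def countably_additive_def subset_iff image_subset_iff)
qed

definition riesz_measure :: "'a measure" where
  "riesz_measure = measure_of UNIV (sets borel) outer"

lemma sets_riesz: "sets riesz_measure = sets borel"
  unfolding riesz_measure_def by (metis sets.sets_measure_of_eq space_borel)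

lemma emeasure_riesz: "A \<in> sets borel \<Longrightarrow> emeasure riesz_measure A = outer A"
  unfolding riesz_measure_def
  by (rule emeasure_measure_of_sigma) (use sets_borel_measure_space in \<open>auto simp: measure_space_def\<close>)

lemma prob_space_riesz: "prob_space riesz_measure"
proof
  have "space riesz_measure = UNIV" using sets_eq_imp_space_eq[OF sets_riesz] by simp
  then show "emeasure riesz_measure (space riesz_measure) = 1"
    by (simp add: emeasure_riesz outer_UNIV)
qed

lemma borel_prob_riesz: "borel_prob riesz_measure"
  by (simp add: borel_prob_def prob_space_riesz sets_riesz)


lemma measure_le_functional:
  assumes f: "continuous_on UNIV f" "\<And>x. 0 \<le> f x" and A: "A \<in> sets borel" "\<And>x. x \<in> A \<Longrightarrow> 1 \<le> f x"
  shows "measure riesz_measure A \<le> L f"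
proof -
  have "emeasure riesz_measure A \<le> ennreal (L f)"
    using outer_le_single[OF f] A by (simp add: emeasure_riesz)
  then show ?thesis
    using pos[OF f] by (simp add: measure_def enn2real_leI)
qed

lemma integrable_riesz:
  "continuous_on UNIV f \<Longrightarrow> integrable riesz_measure (f :: 'a \<Rightarrow> real)"
  by (rule integrable_continuous_compact[OF compact_space borel_prob_riesz])

text \<open>Layer cake: \<open>f\<close> differs by at most \<open>1/n\<close> from the average of the indicators of
  \<open>{f \<ge> i/n}\<close>, and the continuous ramps dominating them average to \<open>f\<close>.\<close>

lemma integral_le_unit:
  assumes f: "continuous_on UNIV f" and f01: "\<And>x. 0 \<le> f x" "\<And>x. f x \<le> 1"
  shows "(LINT x|riesz_measure. f x) \<le> L f"
proof (rule field_le_epsilon)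
  interpret prob_space riesz_measure by (rule prob_space_riesz)
  fix e :: real assume "0 < e"
  then obtain n where n: "n > 0" "1 / real n < e"
    by (metis One_nat_def inverse_eq_divide ex_inverse_of_nat_less)
  define t where "t i x = max 0 (min 1 (real n * f x - real i))" for i x
  define A where "A i = {x. 1 \<le> real n * f x - real i}" for i
  have t_cont: "continuous_on UNIV (t i)" for i
    unfolding t_def by (intro continuous_intros f)
  have A_sets: "A i \<in> sets borel" for i
    unfolding A_def by (intro borel_closed closed_Collect_le continuous_intros f)
  have sum_ramp: "(\<Sum>i<m. max 0 (min 1 (s - real i))) = min s (real m)" if "0 \<le> s" for s m
  proof (induction m)
    case (Suc m)
    then show ?case by (simp add: min_def max_def)
  qed (use that in simp)
  have sum_t: "(\<Sum>i<n. t i x) = real n * f x" for x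
    using sum_ramp[of "real n * f x" n] f01[of x] n unfolding t_def
    by (simp add: min_absorb1 mult_left_le)
  have ind: "real n * f x \<le> 1 + (\<Sum>i<n. indicator (A i) x)" for x
  proof -
    have "s \<le> 1 + (\<Sum>i<m. of_bool (1 \<le> s - real i))" if "0 \<le> s" "s \<le> real m" for s and m :: nat
      using that
    proof (induction m)
      case (Suc m)
      show ?case
      proof (cases "s \<le> real m")
        case False
        then have "(\<Sum>i<m. of_bool (1 \<le> s - real i)) = (\<Sum>i<m. 1 :: real)"
          by (intro sum.cong) auto
        then show ?thesis using Suc.prems by simp
      qed (use Suc in auto)
    qed simp
    from this[of "real n * f x" n] show ?thesis
      using f01[of x] n by (simp add: A_def indicator_def mult_left_le)
  qed
  have "real n * (LINT x|riesz_measure. f x) = (LINT x|riesz_measure. real n * f x)"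
    by simp
  also have "\<dots> \<le> (LINT x|riesz_measure. 1 + (\<Sum>i<n. indicator (A i) x))"
    by (intro integral_mono ind integrable_mult_right integrable_riesz[OF f]
      Bochner_Integration.integrable_add
        Bochner_Integration.integrable_sum)
       (auto simp: sets_riesz A_sets less_top[symmetric])
  also have "\<dots> = 1 + (\<Sum>i<n. measure riesz_measure (A i))"
    by (subst Bochner_Integration.integral_add)
       (auto simp: sets_riesz A_sets less_top[symmetric] Bochner_Integration.integral_sum
         prob_space[unfolded sets_eq_imp_space_eq[OF sets_riesz] space_borel]
           sets_eq_imp_space_eq[OF sets_riesz])
  also have "\<dots> \<le> 1 + (\<Sum>i<n. L (t i))"
    by (intro add_left_mono sum_mono measure_le_functional t_cont A_sets) (auto simp: t_def A_def)
  also have "(\<Sum>i<n. L (t i)) = real n * L f"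
    using sum_cont[of "{..<n}" t] t_cont scale[OF f, of "real n"] by (simp add: sum_t)
  finally have "(LINT x|riesz_measure. f x) \<le> L f + 1 / real n"
    using n by (simp add: field_simps)
  with n show "(LINT x|riesz_measure. f x) \<le> L f + e" by simp
qed

text \<open>The one-sided bound for \<open>g\<close> and for \<open>1 - g\<close> gives equality on
  functions with values in the unit interval; an affine change of values brings a general
  \<open>f\<close> there.\<close>

theorem integral_riesz:
  assumes f: "continuous_on UNIV f"
  shows "(LINT x|riesz_measure. f x) = L f"
proof -
  interpret prob_space riesz_measure by (rule prob_space_riesz)
  have unit: "(LINT x|riesz_measure. g x) = L g"
    if g: "continuous_on UNIV g" "\<And>x. 0 \<le> g x" "\<And>x. g x \<le> 1" for g
  proof (rule antisym)
    have "(LINT x|riesz_measure. 1 - g x) \<le> L (\<lambda>x. 1 - g x)"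
      by (rule integral_le_unit) (use g in \<open>auto intro: continuous_intros\<close>)
    moreover have "(LINT x|riesz_measure. 1 - g x) = 1 - (LINT x|riesz_measure. g x)"
      using integrable_riesz[OF g(1)] by (simp add: prob_space)
    ultimately show "L g \<le> (LINT x|riesz_measure. g x)"
      using diff[of "\<lambda>x. 1" g] g(1) one by simp
  qed (rule integral_le_unit[OF g])
  obtain B where B: "B > 0" "\<And>x. \<bar>f x\<bar> \<le> B" using bounded_continuous_compact[OF compact_space f]
    by blast
  define g where "g x = (f x + B) / (2 * B)" for x
  have g: "continuous_on UNIV g" unfolding g_def by (intro continuous_intros f) (use B in auto)
  have "0 \<le> g x" "g x \<le> 1" for x using B(2)[of x] B(1) by (auto simp: g_def field_simps)
  note unit[OF g this]
  moreover have "L f = 2 * B * L g - B"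
    using diff[of "\<lambda>x. 2 * B * g x" "\<lambda>x. B"] g scale[OF g, of "2 * B"] const[of B] B(1)
    by (simp add: continuous_intros f g_def)
  moreover have "f x = 2 * B * g x - B" for x using B(1) by (simp add: g_def)
  then have "(LINT x|riesz_measure. f x) = 2 * B * (LINT x|riesz_measure. g x) - B"
    using integrable_riesz[OF g] by (simp add: prob_space)
  ultimately show ?thesis by simp
qed

end

section \<open>Duality for probability measures\<close>

text \<open>The Lipschitz functions \<open>max 0 (1 - n * infdist x C)\<close> decrease to the
  indicator of a closed set \<open>C\<close>, and closed sets form an intersection-stable
  generator.\<close>

lemma borel_prob_eqI:
  fixes m1 m2 :: "'a::metric_space measure"
  assumes m: "borel_prob m1" "borel_prob m2"
    and eq: "\<And>f C. (\<And>x y. \<bar>f x - f y\<bar> \<le> C * dist x y) \<Longrightarrow> (LINT x|m1. f x) = (LINT x|m2. f x)"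
  shows "m1 = m2"
proof (rule measure_eqI_generator_eq[of "Collect closed" UNIV m1 m2 "\<lambda>_. UNIV"])
  interpret m1: prob_space m1 using m by (simp add: borel_prob_def)
  interpret m2: prob_space m2 using m by (simp add: borel_prob_def)
  show "Int_stable (Collect closed :: 'a set set)" by (auto simp: Int_stable_def)
  show "sets m1 = sigma_sets UNIV (Collect closed)" "sets m2 = sigma_sets UNIV (Collect closed)"
    using m by (simp_all add: borel_prob_def borel_eq_closed)
  fix C :: "'a set" assume "C \<in> Collect closed"
  then have C: "closed C" by simp
  show "emeasure m1 C = emeasure m2 C"
  proof (cases "C = {}")
    case False
    define u where "u n x = max 0 (1 - real n * infdist x C)" for n :: nat and x
    have u_cont: "continuous_on UNIV (u n)" for n
      unfolding u_def by (intro continuous_intros)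
    have u_lim: "(\<lambda>n. u n x) \<longlonglongrightarrow> indicator C x" for x
    proof (cases "x \<in> C")
      case True then show ?thesis by (simp add: u_def)
    next
      case outside: False
      then have d: "infdist x C > 0" using C False by (simp add: infdist_pos_not_in_closed)
      then obtain N where N: "1 < real N * infdist x C" using reals_Archimedean3 by blast
      have "u n x = 0" if "n \<ge> N" for n
      proof -
        have "real N * infdist x C \<le> real n * infdist x C" using that d
          by (intro mult_right_mono) auto
        then show ?thesis using N by (simp add: u_def)
      qed
      then have "(\<lambda>n. u n x) \<longlonglongrightarrow> 0"
        by (intro tendsto_eventually eventually_sequentiallyI[of N])
      then show ?thesis using outside by simp
    qed
    have lim: "(\<lambda>n. LINT x|M. u n x) \<longlonglongrightarrow> measure M C" if "borel_prob M" for M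
    proof -
      interpret prob_space M using that by (simp add: borel_prob_def)
      have sets: "sets M = sets borel" using that by (simp add: borel_prob_def)
      have "(\<lambda>n. LINT x|M. u n x) \<longlonglongrightarrow> (LINT x|M. indicator C x)"
      proof (rule integral_dominated_convergence[where w = "\<lambda>x. 1"])
        show "indicator C \<in> borel_measurable M" 
          by (intro borel_measurable_indicator) (simp add: sets C)
        show "u n \<in> borel_measurable M" for n
          using borel_measurable_continuous_onI[OF u_cont]
            by (simp cong: measurable_cong_sets add: sets)
      qed (use u_lim in \<open>auto simp: u_def infdist_nonneg\<close>)
      then show ?thesis using C by (simp add: sets sets_eq_imp_space_eq[OF sets])
    qed
    have "\<bar>u n x - u n y\<bar> \<le> real n * dist x y" for n x y
    proof -
      have "\<bar>u n x - u n y\<bar> \<le> \<bar>real n * infdist x C - real n * infdist y C\<bar>"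
        unfolding u_def by (auto simp: max_def)
      also have "\<dots> = real n * \<bar>infdist x C - infdist y C\<bar>"
        by (simp add: abs_mult flip: right_diff_distrib)
      also have "\<dots> \<le> real n * dist x y"
        using infdist_triangle_abs[of x C y] by (intro mult_left_mono) auto
      finally show ?thesis .
    qed
    then have "(LINT x|m1. u n x) = (LINT x|m2. u n x)" for n by (rule eq)
    then have "measure m1 C = measure m2 C"
      using LIMSEQ_unique[OF lim[OF m(1)]] lim[OF m(2)] by simp
    then show ?thesis by (simp add: m1.emeasure_eq_measure m2.emeasure_eq_measure)
  qed simp
next
  interpret prob_space m1 using m by (simp add: borel_prob_def)
  show "emeasure m1 UNIV \<noteq> \<infinity>" by simp
qed auto

text \<open>The functional \<open>f \<mapsto> inf\<^sub>k sup (f + k)\<close> is sublinear, and the linear functionals below it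
  are the means that are nonnegative on the cone.\<close>

theorem exists_measure_nonneg_on_cone:
  fixes K :: "('a::metric_space \<Rightarrow> real) set"
  assumes compact: "compact (UNIV :: 'a set)"
    and cont: "\<And>k. k \<in> K \<Longrightarrow> continuous_on UNIV k"
    and zero: "(\<lambda>x. 0) \<in> K"
    and add: "\<And>k k'. k \<in> K \<Longrightarrow> k' \<in> K \<Longrightarrow> (\<lambda>x. k x + k' x) \<in> K"
    and scale: "\<And>c k. c > 0 \<Longrightarrow> k \<in> K \<Longrightarrow> (\<lambda>x. c * k x) \<in> K"
    and nonneg: "\<And>k. k \<in> K \<Longrightarrow> \<exists>x. 0 \<le> k x"
  obtains m where "borel_prob m" "\<And>k. k \<in> K \<Longrightarrow> 0 \<le> (LINT x|m. k x)"
proof -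
  have bdd: "bdd_above (range g)" if "continuous_on UNIV g" for g :: "'a \<Rightarrow> real"
    using compact_continuous_image[OF that compact]
    by (intro bounded_imp_bdd_above compact_imp_bounded)
  \<comment> \<open>Bounded continuous functions form a real vector space as a type, which
    \<open>sublinear_dominates_linear\<close> requires; by compactness they are all the continuous
    functions.\<close>
  define p :: "('a \<Rightarrow>\<^sub>C real) \<Rightarrow> real" where "p f = (INF k\<in>K. SUP x. f x + k x)" for f
  have cont_sum: "continuous_on UNIV (\<lambda>x. apply_bcontfun f x + k x)" if "k \<in> K"
    for f :: "'a \<Rightarrow>\<^sub>C real" and k
    by (rule continuous_on_add[OF continuous_on_apply_bcontfun cont[OF that]])
  have upper: "apply_bcontfun f x + k x \<le> (SUP x. apply_bcontfun f x + k x)" if "k \<in> K"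
    for f :: "'a \<Rightarrow>\<^sub>C real" and k x
    by (rule cSUP_upper[OF UNIV_I bdd[OF cont_sum[OF that]]])
  have bddb: "bdd_below ((\<lambda>k. SUP x. apply_bcontfun f x + k x) ` K)" for f :: "'a \<Rightarrow>\<^sub>C real"
  proof (rule bdd_belowI2)
    fix k assume k: "k \<in> K"
    obtain x where "0 \<le> k x" using nonneg[OF k] by blast
    with upper[OF k, of f x] norm_bounded[of f x] show "- norm f \<le> (SUP x. apply_bcontfun f x + k x)"
      by simp
  qed
  have p_le: "p f \<le> b" if "k \<in> K" "\<And>x. apply_bcontfun f x + k x \<le> b" for f k b
    unfolding p_def using that by (intro cINF_lower2[OF bddb that(1)] cSUP_least) auto
  have p_ge: "c \<le> p f" if "\<And>k. k \<in> K \<Longrightarrow> c \<le> (SUP x. apply_bcontfun f x + k x)" for f c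
    unfolding p_def using that zero by (intro cINF_greatest) auto
  have "sublinear p"
  proof (rule sublinear_of_positive_scale)
    fix f g
    have "p (f + g) - (SUP x. apply_bcontfun g x + k' x) \<le> (SUP x. apply_bcontfun f x + k x)"
      if "k \<in> K" "k' \<in> K" for k k'
    proof -
      have "p (f + g) \<le> (SUP x. apply_bcontfun f x + k x) + (SUP x. apply_bcontfun g x + k' x)"
      proof (rule p_le[OF add[OF that]])
        fix x
        show "apply_bcontfun (f + g) x + (k x + k' x) \<le>
            (SUP x. apply_bcontfun f x + k x) + (SUP x. apply_bcontfun g x + k' x)"
          using upper[OF that(1), of f x] upper[OF that(2), of g x] by simp
      qed
      then show ?thesis by simp
    qed
    then have "p (f + g) - (SUP x. apply_bcontfun g x + k' x) \<le> p f" if "k' \<in> K" for k'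
      using that by (intro p_ge)
    then have "p (f + g) - p f \<le> (SUP x. apply_bcontfun g x + k' x)" if "k' \<in> K" for k'
      using that by (simp add: algebra_simps)
    then have "p (f + g) - p f \<le> p g" by (intro p_ge)
    then show "p (f + g) \<le> p f + p g" by simp
  next
    fix c :: real and f assume c: "c > 0"
    have "p (c *\<^sub>R f) / c \<le> (SUP x. apply_bcontfun f x + k x)" if k: "k \<in> K" for k
    proof -
      have "p (c *\<^sub>R f) \<le> c * (SUP x. apply_bcontfun f x + k x)"
      proof (rule p_le[OF scale[OF c k]])
        fix x
        show "apply_bcontfun (c *\<^sub>R f) x + c * k x \<le> c * (SUP x. apply_bcontfun f x + k x)"
          using mult_left_mono[OF upper[OF k, of f x], of c] c by (simp add: algebra_simps)
      qed
      then show ?thesis using c by (simp add: field_simps)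
    qed
    then have "p (c *\<^sub>R f) / c \<le> p f" by (rule p_ge)
    then show "p (c *\<^sub>R f) \<le> c * p f" using c by (simp add: field_simps)
  next
    have "0 \<le> p 0"
    proof (rule p_ge)
      fix k assume k: "k \<in> K"
      obtain x where "0 \<le> k x" using nonneg[OF k] by blast
      with upper[OF k, of 0 x] show "0 \<le> (SUP x. apply_bcontfun 0 x + k x)" by simp
    qed
    moreover have "p 0 \<le> 0" by (rule p_le[OF zero]) simp
    ultimately show "p 0 = 0" by simp
  qed
  then obtain L where L: "linear L" "\<And>f. L f \<le> p f" by (rule sublinear_dominates_linear) blast
  define M where "M f = L (Bcontfun f)" for f
  have app: "apply_bcontfun (Bcontfun f) = f" if f: "continuous_on UNIV f" for f :: "'a \<Rightarrow> real"
  proof -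
    obtain B where "\<And>x. \<bar>f x\<bar> \<le> B" using bounded_continuous_compact[OF compact f] by blast
    then have "f \<in> bcontfun" by (intro bcontfun_normI[OF f, of B]) simp
    then show ?thesis by (rule Bcontfun_inverse)
  qed
  \<comment> \<open>With \<open>k = 0\<close> this yields positivity and the lower half of the
    normalisation; with \<open>f = k\<close> and \<open>b = 0\<close> it yields nonnegativity on the
    cone.\<close>
  have M_neg: "- M f \<le> b" if f: "continuous_on UNIV f" and "k \<in> K" "\<And>x. k x - f x \<le> b" for f k b
  proof -
    have "- M f = L (- Bcontfun f)" unfolding M_def using L(1) by (simp add: linear_neg)
    also have "\<dots> \<le> p (- Bcontfun f)" by (rule L(2))
    also have "\<dots> \<le> b" by (rule p_le[OF that(2)]) (use that(3) in \<open>simp add: app[OF f] algebra_simps\<close>)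
    finally show ?thesis .
  qed
  interpret M: mean_functional M
  proof
    fix f g :: "'a \<Rightarrow> real" assume fg: "continuous_on UNIV f" "continuous_on UNIV g"
    have "Bcontfun (\<lambda>x. f x + g x) = Bcontfun f + Bcontfun g"
      by (rule bcontfun_eqI) (simp add: app fg continuous_intros)
    then show "M (\<lambda>x. f x + g x) = M f + M g" unfolding M_def by (simp add: linear_add[OF L(1)])
  next
    fix f :: "'a \<Rightarrow> real" and c assume f: "continuous_on UNIV f"
    have "Bcontfun (\<lambda>x. c * f x) = c *\<^sub>R Bcontfun f"
      by (rule bcontfun_eqI) (simp add: app f continuous_intros)
    then show "M (\<lambda>x. c * f x) = c * M f" unfolding M_def by (simp add: linear_scale[OF L(1)])
  next
    fix f :: "'a \<Rightarrow> real" assume "continuous_on UNIV f" "\<And>x. 0 \<le> f x"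
    then show "0 \<le> M f" using M_neg[OF _ zero, of f 0] by simp
  next
    have "M (\<lambda>x. 1) \<le> p (Bcontfun (\<lambda>x. 1))" unfolding M_def by (rule L(2))
    also have "\<dots> \<le> 1" by (rule p_le[OF zero]) (simp add: app)
    finally show "M (\<lambda>x. 1) = 1" using M_neg[OF _ zero, of "\<lambda>x. 1" "-1"] by simp
  qed (rule compact)
  show thesis
  proof
    show "borel_prob M.riesz_measure" by (rule M.borel_prob_riesz)
    fix k assume k: "k \<in> K"
    then show "0 \<le> (LINT x|M.riesz_measure. k x)"
      using M_neg[OF cont[OF k] k, of 0] by (simp add: M.integral_riesz[OF cont[OF k]])
  qed
qed

text \<open>The nontrivial half of Kantorovich duality. A measure nonnegative on the cone of the
  functions \<open>k f g c\<close> is a coupling of cost at most \<open>s\<close>. If some element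
  of the cone were negative everywhere, \<open>f\<close> and \<open>g\<close> could be replaced by
  \<open>h\<close> and \<open>- h\<close> for one function \<open>h\<close> with modulus
  \<open>c * \<omega>\<close>, and \<open>dual\<close> would be violated.\<close>

theorem wasserstein_le:
  fixes ma mb :: "'a::metric_space measure"
  assumes compact: "compact (UNIV :: 'a set)"
    and m: "borel_prob ma" "borel_prob mb"
    and \<omega>_cont: "continuous_on UNIV (\<lambda>p :: 'a \<times> 'a. \<omega> (dist (fst p) (snd p)))"
    and \<omega>_zero: "\<omega> 0 = 0"
    and \<omega>_nonneg: "\<And>x y :: 'a. 0 \<le> \<omega> (dist x y)"
    and \<omega>_triangle: "\<And>x y z :: 'a. \<omega> (dist x z) \<le> \<omega> (dist x y) + \<omega> (dist y z)"
    and dual: "\<And>f. continuous_on UNIV f \<Longrightarrow> (\<And>x y. \<bar>f x - f y\<bar> \<le> \<omega> (dist x y)) \<Longrightarrow>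
        (LINT x|ma. f x) - (LINT x|mb. f x) \<le> s"
  shows "wasserstein \<omega> ma mb \<le> s"
proof -
  interpret ma: prob_space ma using m by (simp add: borel_prob_def)
  interpret mb: prob_space mb using m by (simp add: borel_prob_def)
  note int_a = integrable_continuous_compact[OF compact m(1)]
  note int_b = integrable_continuous_compact[OF compact m(2)]
  have cont_section: "continuous_on UNIV (\<lambda>y. \<omega> (dist x y))" for x :: 'a
    using continuous_on_compose2[OF \<omega>_cont, of UNIV "\<lambda>y. (x, y)"]
    by (simp add: continuous_on_Pair continuous_on_id)
  have cont_lip: "continuous_on UNIV f" if "\<And>x y. \<bar>f x - f y\<bar> \<le> c * \<omega> (dist x y)"
    for f :: "'a \<Rightarrow> real" and c
  proof -
    have "isCont f x" for x
    proof -
      have "isCont (\<lambda>y. \<omega> (dist x y)) x"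
        using cont_section[of x] by (simp add: continuous_on_eq_continuous_at)
      then have "((\<lambda>y. \<omega> (dist x y)) \<longlongrightarrow> 0) (at x)"
        by (simp add: isCont_def \<omega>_zero)
      then have "((\<lambda>y. c * \<omega> (dist x y)) \<longlongrightarrow> 0) (at x)"
        by (rule tendsto_mult_right_zero)
      then have "((\<lambda>y. f y - f x) \<longlongrightarrow> 0) (at x)"
        by (rule Lim_null_comparison[rotated]) (use that[of _ x] in \<open>auto simp: dist_commute\<close>)
      then show ?thesis by (simp add: isCont_def LIM_zero_iff)
    qed
    then show ?thesis by (simp add: continuous_at_imp_continuous_on)
  qed
  define k where "k f g c = (\<lambda>p :: 'a \<times> 'a. (f (fst p) - (LINT x|ma. f x)) + (g (snd p) -
    (LINT x|mb. g x))
      + c * (s - \<omega> (dist (fst p) (snd p))))" for f g c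
  \<comment> \<open>\<open>f\<close> and \<open>g\<close> range over linear spaces, which forces
    equality of the marginals, while \<open>c\<close> is only nonnegative, which bounds the cost
    from above.\<close>
  define K where "K = {k f g c | f g c. continuous_on UNIV f \<and> continuous_on UNIV g \<and> 0 \<le> c}"
  have k_cont: "continuous_on UNIV (k f g c)" if "continuous_on UNIV f" "continuous_on UNIV g"
    for f g c
    unfolding k_def
    by (intro continuous_intros \<omega>_cont continuous_on_compose2[OF that(1)] continuous_on_compose2[OF
      that(2)]) auto
  have compact2: "compact (UNIV :: ('a \<times> 'a) set)"
    using compact_Times[OF compact compact] by simp
  have "\<exists>p. 0 \<le> k f g c p" if fg: "continuous_on UNIV f" "continuous_on UNIV g" and c: "0 \<le> c"
    for f g c
  proof (rule ccontr)
    assume neg: "\<nexists>p. 0 \<le> k f g c p"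
    obtain p0 where p0: "\<And>p. k f g c p \<le> k f g c p0"
      using continuous_attains_sup[OF compact2 _ k_cont[OF fg, of c]] by blast
    define e where "e = - k f g c p0"
    have e: "e > 0" using neg unfolding e_def by (metis neg_0_less_iff_less not_le)
    define A where "A = (LINT x|ma. f x) + (LINT x|mb. g x) - c * s"
    have fg_le: "f x + g y \<le> A - e + c * \<omega> (dist x y)" for x y
      using p0[of "(x, y)"] by (simp add: k_def e_def A_def algebra_simps)
    \<comment> \<open>The transform of \<open>g\<close> with respect to the cost: it inherits the
      modulus \<open>c * \<omega>\<close> from the triangle inequality, lies above
      \<open>f - (A - e)\<close> and satisfies \<open>g \<le> - h\<close>.\<close>
    define h where "h x = (INF y. c * \<omega> (dist x y) - g y)" for x
    obtain B where B: "\<And>x. \<bar>g x\<bar> \<le> B" using bounded_continuous_compact[OF compact fg(2)] by blast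
    have bdd: "bdd_below (range (\<lambda>y. c * \<omega> (dist x y) - g y))" for x
    proof (rule bdd_belowI2)
      fix y
      show "- B \<le> c * \<omega> (dist x y) - g y"
        using B[of y] mult_nonneg_nonneg[OF c \<omega>_nonneg[of x y]] by linarith
    qed
    have h_le: "h x \<le> c * \<omega> (dist x y) - g y" for x y
      unfolding h_def by (rule cINF_lower[OF bdd]) simp
    have f_h: "f x \<le> h x + (A - e)" for x
    proof -
      have "f x - (A - e) \<le> c * \<omega> (dist x y) - g y" for y using fg_le[of x y] by simp
      then have "f x - (A - e) \<le> h x" unfolding h_def by (intro cINF_greatest) auto
      then show ?thesis by simp
    qed
    have g_h: "g y \<le> - h y" for y using h_le[of y y] \<omega>_zero by simp
    have h_diff: "h x - h z \<le> c * \<omega> (dist x z)" for x z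
    proof -
      have "h x - c * \<omega> (dist x z) \<le> c * \<omega> (dist z y) - g y" for y
        using h_le[of x y] mult_left_mono[OF \<omega>_triangle[where x = x and y = z and z = y] c]
        by (simp add: algebra_simps)
      then have "h x - c * \<omega> (dist x z) \<le> h z" unfolding h_def[of z] by (intro cINF_greatest) auto
      then show ?thesis by simp
    qed
    have h_lip: "\<bar>h x - h z\<bar> \<le> c * \<omega> (dist x z)" for x z
      using h_diff[of x z] h_diff[of z x] by (simp add: dist_commute)
    have h_cont: "continuous_on UNIV h" by (rule cont_lip) (rule h_lip)
    have "(LINT x|ma. h x) - (LINT x|mb. h x) \<le> c * s"
    \<comment> \<open>\<open>dual\<close> speaks of modulus exactly \<open>\<omega>\<close>, so
      \<open>h\<close> is divided by \<open>c\<close>; for \<open>c = 0\<close> it is constant and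
      both integrals agree.\<close>
    proof (cases "c = 0")
      case True
      then have "h x = h z" for x z using h_lip[of x z] by simp
      then have "h = (\<lambda>x. h undefined)" by (intro ext)
      then obtain b where "h = (\<lambda>x. b)" by blast
      then show ?thesis using True by (simp add: ma.prob_space mb.prob_space)
    next
      case False
      with c have c: "c > 0" by simp
      have "(LINT x|ma. h x / c) - (LINT x|mb. h x / c) \<le> s"
      proof (rule dual)
        show "continuous_on UNIV (\<lambda>x. h x / c)" using c by (intro continuous_intros h_cont) auto
        show "\<bar>h x / c - h y / c\<bar> \<le> \<omega> (dist x y)" for x y
          using h_lip[of x y] c by (simp add: field_simps flip: diff_divide_distrib)
      qed
      then show ?thesis using c by (simp add: field_simps flip: diff_divide_distrib)
    qed
    moreover have "(LINT x|ma. f x) \<le> (LINT x|ma. h x + (A - e))"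
      by (intro integral_mono int_a fg f_h continuous_intros h_cont)
    then have "(LINT x|ma. f x) \<le> (LINT x|ma. h x) + (A - e)"
      using int_a[OF h_cont] by (simp add: ma.prob_space)
    moreover have "(LINT x|mb. g x) \<le> (LINT x|mb. - h x)"
      by (intro integral_mono int_b fg g_h continuous_intros h_cont)
    then have "(LINT x|mb. g x) \<le> - (LINT x|mb. h x)" by simp
    ultimately show False using e by (simp add: A_def)
  qed
  note nonneg = this
  obtain Q where Q: "borel_prob Q" "\<And>k. k \<in> K \<Longrightarrow> 0 \<le> (LINT p|Q. k p)"
  proof (rule exists_measure_nonneg_on_cone[OF compact2, of K])
    show "(\<lambda>p. 0) \<in> K"
      unfolding K_def by (intro CollectI exI[of _ "\<lambda>x. 0"] exI[of _ "0 :: real"]) (simp add: k_def)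
  next
    fix a b assume "a \<in> K" "b \<in> K"
    then obtain f g c f' g' c' where *: "a = k f g c" "b = k f' g' c'"
      "continuous_on UNIV f" "continuous_on UNIV g" "continuous_on UNIV f'" "continuous_on UNIV g'"
        "0 \<le> c" "0 \<le> c'"
      by (auto simp: K_def)
    have "(\<lambda>x. a x + b x) = k (\<lambda>x. f x + f' x) (\<lambda>x. g x + g' x) (c + c')"
      using *(3-6) unfolding *(1,2) by (simp add: k_def fun_eq_iff int_a int_b algebra_simps)
    then show "(\<lambda>x. a x + b x) \<in> K"
      unfolding K_def using * by (auto intro!: exI continuous_intros)
  next
    fix r a assume "a \<in> K" and r: "(r::real) > 0"
    then obtain f g c where *: "a = k f g c" "continuous_on UNIV f" "continuous_on UNIV g" "0 \<le> c"
      by (auto simp: K_def)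
    have "(\<lambda>x. r * a x) = k (\<lambda>x. r * f x) (\<lambda>x. r * g x) (r * c)"
      unfolding *(1) by (simp add: k_def fun_eq_iff algebra_simps)
    then show "(\<lambda>x. r * a x) \<in> K"
      unfolding K_def using * r by (auto intro!: exI continuous_intros)
  qed (use nonneg k_cont in \<open>auto simp: K_def\<close>)
  interpret Q: prob_space Q using Q(1) by (simp add: borel_prob_def)
  have sets_Q: "sets Q = sets borel" using Q(1) by (simp add: borel_prob_def)
  note int_Q = integrable_continuous_compact[OF compact2 Q(1)]
  have int_fst: "integrable Q (\<lambda>p. f (fst p))" and int_snd: "integrable Q (\<lambda>p. f (snd p))"
    if "continuous_on UNIV f" for f :: "'a \<Rightarrow> real"
    by (intro int_Q continuous_on_compose2[OF that] continuous_intros; simp)+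
  have k_Q: "0 \<le> ((LINT p|Q. f (fst p)) - (LINT x|ma. f x)) + ((LINT p|Q. g (snd p)) -
    (LINT x|mb. g x))
      + c * (s - (LINT p|Q. \<omega> (dist (fst p) (snd p))))"
    if "continuous_on UNIV f" "continuous_on UNIV g" "0 \<le> c" for f g c
  proof -
    have "0 \<le> (LINT p|Q. k f g c p)" using Q(2)[of "k f g c"] that by (auto simp: K_def)
    then show ?thesis
      unfolding k_def using int_fst[OF that(1)] int_snd[OF that(2)] int_Q[OF \<omega>_cont]
      by (simp add: Q.prob_space)
  qed
  have marg_fst: "(LINT p|Q. f (fst p)) = (LINT x|ma. f x)" if f: "continuous_on UNIV f"
    for f :: "'a \<Rightarrow> real"
    using k_Q[OF f, of "\<lambda>x. 0" 0] k_Q[of "\<lambda>x. - f x" "\<lambda>x. 0" 0] f by (simp add: continuous_intros)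
  have marg_snd: "(LINT p|Q. f (snd p)) = (LINT x|mb. f x)" if f: "continuous_on UNIV f"
    for f :: "'a \<Rightarrow> real"
    using k_Q[of "\<lambda>x. 0" f 0] k_Q[of "\<lambda>x. 0" "\<lambda>x. - f x" 0] f by (simp add: continuous_intros)
  have meas: "fst \<in> measurable Q borel" "snd \<in> measurable Q borel"
    using borel_measurable_continuous_onI[of "fst :: 'a \<times> 'a \<Rightarrow> 'a"]
      borel_measurable_continuous_onI[of "snd :: 'a \<times> 'a \<Rightarrow> 'a"]
    by (simp_all cong: measurable_cong_sets add: sets_Q continuous_intros)
  have lip_cont: "continuous_on UNIV f" if "\<And>x y. \<bar>f x - f y\<bar> \<le> C * dist x y" for f :: "'a \<Rightarrow> real"
    and C
    by (rule lipschitz_on_continuous_on[of "\<bar>C\<bar>"], rule lipschitz_onI)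
       (use that in \<open>auto simp: dist_real_def intro: order_trans[OF _ mult_right_mono[OF
         abs_ge_self]]\<close>)
  have "distr Q borel fst = ma"
  proof (rule borel_prob_eqI)
    fix f :: "'a \<Rightarrow> real" and C assume "\<And>x y. \<bar>f x - f y\<bar> \<le> C * dist x y"
    then have f: "continuous_on UNIV f" by (rule lip_cont)
    show "(LINT x|distr Q borel fst. f x) = (LINT x|ma. f x)"
      using integral_distr[OF meas(1) borel_measurable_continuous_onI[OF f]] marg_fst[OF f] by simp
  qed (use m Q.prob_space_distr[OF meas(1)] in \<open>auto simp: borel_prob_def\<close>)
  moreover have "distr Q borel snd = mb"
  proof (rule borel_prob_eqI)
    fix f :: "'a \<Rightarrow> real" and C assume "\<And>x y. \<bar>f x - f y\<bar> \<le> C * dist x y"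
    then have f: "continuous_on UNIV f" by (rule lip_cont)
    show "(LINT x|distr Q borel snd. f x) = (LINT x|mb. f x)"
      using integral_distr[OF meas(2) borel_measurable_continuous_onI[OF f]] marg_snd[OF f] by simp
  qed (use m Q.prob_space_distr[OF meas(2)] in \<open>auto simp: borel_prob_def\<close>)
  ultimately have "Q \<in> couplings ma mb" using Q(1) by (simp add: couplings_def)
  then have "wasserstein \<omega> ma mb \<le> (LINT (x,y)|Q. \<omega> (dist x y))"
    unfolding wasserstein_def
    by (intro cINF_lower bdd_belowI2[of _ 0] integral_nonneg_AE) (auto simp: \<omega>_nonneg split_def)
  also have "\<dots> \<le> s" using k_Q[of "\<lambda>x. 0" "\<lambda>x. 0" 1] by (simp add: split_def)
  finally show ?thesis .
qed

section \<open>Ruelle operators and paired inverse branches\<close>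

lemma abs_exp_minus_one_le: "\<bar>exp d - 1\<bar> \<le> \<bar>d\<bar> * exp \<bar>d\<bar>" for d :: real
proof (cases "d \<ge> 0")
  case True
  have "exp d * (1 - d) \<le> exp d * exp (- d)"
    using exp_ge_add_one_self[of "- d"] by (intro mult_left_mono) auto
  then show ?thesis using True by (simp add: exp_minus algebra_simps)
next
  case False
  have "1 - exp d \<le> - d" using exp_ge_add_one_self[of d] by linarith
  also have "- d \<le> - d * exp (- d)" using False by (simp add: mult_le_cancel_left1)
  finally show ?thesis using False by simp
qed

lemma finite_net:
  assumes "compact (UNIV :: 'a::metric_space set)" and "\<rho> > 0"
  shows "\<exists>C :: 'a set. finite C \<and> (\<forall>x. \<exists>c\<in>C. dist c x < \<rho>)"
proof -
  have "\<exists>C. finite C \<and> (UNIV :: 'a set) \<subseteq> (\<Union>c\<in>C. ball c \<rho>)"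
    using assms by (simp add: compact_eq_totally_bounded)
  then show ?thesis by (auto simp: subset_iff)
qed

text \<open>Couple the two averages independently: the pair \<open>(i0, j0)\<close> has weight at
  least \<open>\<delta>\<^sup>2\<close>, and on it the bound \<open>E\<close> replaces the bound
  \<open>m\<close>.\<close>

lemma weighted_diff_le:
  fixes p u :: "'i \<Rightarrow> real" and q v :: "'j \<Rightarrow> real"
  assumes fin: "finite I" "finite J"
    and p: "\<And>i. i \<in> I \<Longrightarrow> 0 \<le> p i" "sum p I = 1"
    and q: "\<And>j. j \<in> J \<Longrightarrow> 0 \<le> q j" "sum q J = 1"
    and i0: "i0 \<in> I" "\<delta> \<le> p i0" and j0: "j0 \<in> J" "\<delta> \<le> q j0" and \<delta>: "0 \<le> \<delta>"
    and m: "\<And>i j. i \<in> I \<Longrightarrow> j \<in> J \<Longrightarrow> u i - v j \<le> m" and E: "u i0 - v j0 \<le> E"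
  shows "(\<Sum>i\<in>I. p i * u i) - (\<Sum>j\<in>J. q j * v j) \<le> (1 - \<delta>\<^sup>2) * m + \<delta>\<^sup>2 * E"
proof -
  define W where "W i j = p i * q j * (m - (u i - v j))" for i j
  have W: "0 \<le> W i j" if "i \<in> I" "j \<in> J" for i j
    unfolding W_def using that p q m by simp
  have "\<delta>\<^sup>2 * (m - E) \<le> \<delta>\<^sup>2 * (m - (u i0 - v j0))" using E by (intro mult_left_mono) auto
  also have "\<dots> \<le> p i0 * q j0 * (m - (u i0 - v j0))"
    unfolding power2_eq_square using m i0 j0 \<delta> by (intro mult_right_mono mult_mono) auto
  also have "\<dots> = W i0 j0" by (simp add: W_def)
  also have "\<dots> \<le> (\<Sum>j\<in>J. W i0 j)" using W i0 j0 fin by (intro member_le_sum) auto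
  also have "\<dots> \<le> (\<Sum>i\<in>I. \<Sum>j\<in>J. W i j)"
    using W i0 fin by (intro member_le_sum[of i0 I "\<lambda>i. \<Sum>j\<in>J. W i j"] sum_nonneg) auto
  also have "\<dots> = (\<Sum>i\<in>I. p i * (m - u i) * (\<Sum>j\<in>J. q j) + p i * (\<Sum>j\<in>J. q j * v j))"
    unfolding W_def by (intro sum.cong refl)
      (simp add: sum_distrib_left sum_distrib_right algebra_simps flip: sum.distrib sum_subtractf)
  also have "\<dots> = m - (\<Sum>i\<in>I. p i * u i) + (\<Sum>j\<in>J. q j * v j)"
    using p(2) q(2)
      by (simp add: sum.distrib right_diff_distrib sum_subtractf flip: sum_distrib_right)
  finally show ?thesis by (simp add: algebra_simps)
qed

section \<open>Birkhoff sums and iterated Ruelle operators\<close>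

definition birkhoff :: "('a \<Rightarrow> 'a) \<Rightarrow> ('a \<Rightarrow> real) \<Rightarrow> nat \<Rightarrow> 'a \<Rightarrow> real" where
  "birkhoff T a n y = (\<Sum>k<n. a ((T ^^ k) y))"

text \<open>The iterates of \<open>ruelle_op\<close> in closed form (\<open>iter_0\<close>,
  \<open>iter_Suc\<close>), as a sum over the branches of \<open>T ^^ n\<close> that the pairing
  acts on.\<close>

definition ruelle_iter :: "('a \<Rightarrow> 'a) \<Rightarrow> ('a \<Rightarrow> real) \<Rightarrow> nat \<Rightarrow> ('a \<Rightarrow> real) \<Rightarrow> 'a \<Rightarrow> real" where
  "ruelle_iter T a n u x = (\<Sum>y | (T ^^ n) y = x. exp (birkhoff T a n y) * u y)"

lemma birkhoff_add: "birkhoff T a (n + m) y = birkhoff T a m y + birkhoff T a n ((T ^^ m) y)"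
  by (induction n) (simp_all add: birkhoff_def funpow_add)

lemma birkhoff_uniform_le:
  assumes "\<And>y. \<bar>a y - b y\<bar> \<le> e"
  shows "\<bar>birkhoff T a n y - birkhoff T b n y\<bar> \<le> real n * e"
proof -
  have "\<bar>birkhoff T a n y - birkhoff T b n y\<bar> \<le> (\<Sum>k<n. \<bar>a ((T ^^ k) y) - b ((T ^^ k) y)\<bar>)"
    unfolding birkhoff_def sum_subtractf[symmetric] by (rule sum_abs)
  also have "\<dots> \<le> (\<Sum>k<n. e)" by (intro sum_mono assms)
  finally show ?thesis by simp
qed

locale finite_fibres =
  fixes T :: "'a \<Rightarrow> 'a"
  assumes finite_fibre: "finite {y. (T ^^ n) y = x}"
begin

abbreviation "iter \<equiv> ruelle_iter T"

lemma iter_0: "iter a 0 u = u"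
  by (simp add: ruelle_iter_def birkhoff_def fun_eq_iff)

lemma iter_1: "iter a 1 u = ruelle_op T a u"
  by (simp add: ruelle_iter_def birkhoff_def ruelle_op_def fun_eq_iff)

lemma iter_add: "iter a (n + m) u = iter a n (iter a m u)"
proof
  fix x
  have "iter a n (iter a m u) x =
      (\<Sum>z | (T ^^ n) z = x. \<Sum>y | (T ^^ m) y = z. exp (birkhoff T a (n + m) y) * u y)"
    unfolding ruelle_iter_def sum_distrib_left
    by (intro sum.cong refl) (auto simp: birkhoff_add exp_add)
  also have "\<dots> = (\<Sum>z | (T ^^ n) z = x. \<Sum>y\<in>{y. y \<in> {y. (T ^^ (n + m)) y = x} \<and> (T ^^ m) y = z}.
      exp (birkhoff T a (n + m) y) * u y)"
    by (intro sum.cong) (auto simp: funpow_add)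
  also have "\<dots> = iter a (n + m) u x"
    unfolding ruelle_iter_def
      by (rule sum.group) (use finite_fibre[of "n + m" x] finite_fibre[of n x] in \<open>auto simp:
        funpow_add\<close>)
  finally show "iter a (n + m) u x = iter a n (iter a m u) x" by simp
qed

lemma iter_Suc: "iter a (Suc n) u = ruelle_op T a (iter a n u)"
  using iter_add[of a 1 n u] by (simp add: iter_1 del: One_nat_def) (simp add: iter_1[symmetric])

lemma iter_plus: "iter a n (\<lambda>y. u y + v y) x = iter a n u x + iter a n v x"
  by (simp add: ruelle_iter_def algebra_simps sum.distrib)

lemma iter_diff: "iter a n (\<lambda>y. u y - v y) x = iter a n u x - iter a n v x"
  by (simp add: ruelle_iter_def algebra_simps sum_subtractf)

lemma iter_scale: "iter a n (\<lambda>y. c * u y) x = c * iter a n u x"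
  by (simp add: ruelle_iter_def sum_distrib_left algebra_simps)

lemma iter_mono: "(\<And>y. u y \<le> v y) \<Longrightarrow> iter a n u x \<le> iter a n v x"
  by (simp add: ruelle_iter_def sum_mono)

lemma iter_nonneg: "(\<And>y. 0 \<le> u y) \<Longrightarrow> 0 \<le> iter a n u x"
  by (simp add: ruelle_iter_def sum_nonneg)

lemma iter_ge_term:
  assumes "\<And>y. 0 \<le> u y" "(T ^^ n) y = x"
  shows "exp (birkhoff T a n y) * u y \<le> iter a n u x"
  unfolding ruelle_iter_def using assms finite_fibre by (intro member_le_sum) auto

lemma iter_le_exp:
  assumes "\<And>y. \<bar>a y - b y\<bar> \<le> e" "\<And>y. 0 \<le> u y"
  shows "iter a n u x \<le> exp (real n * e) * iter b n u x"
  unfolding ruelle_iter_def sum_distrib_left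
proof (rule sum_mono)
  fix y
  have "birkhoff T a n y \<le> real n * e + birkhoff T b n y"
    using birkhoff_uniform_le[of a b e T n y] assms(1) by simp
  then have "exp (birkhoff T a n y) \<le> exp (real n * e) * exp (birkhoff T b n y)"
    by (simp flip: exp_add)
  then show "exp (birkhoff T a n y) * u y \<le> exp (real n * e) * (exp (birkhoff T b n y) * u y)"
    using mult_right_mono[OF _ assms(2)] by (simp add: mult.assoc[symmetric])
qed

end

text \<open>The hypotheses on the paired inverse branches are all that is used of the expansion of \<open>T\<close>;
  \<open>\<omega>\<close> is the modulus of the potentials and \<open>\<omega>'\<close> that of the eigenfunctions.\<close>

locale paired_branches = finite_fibres T for T :: "'a::metric_space \<Rightarrow> 'a" +
  fixes r K0 K1 K2 K3 K4 W H \<gamma> :: real and e :: "nat \<Rightarrow> real" and \<omega> \<omega>' :: "real \<Rightarrow> real"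
  assumes compact_space: "compact (UNIV :: 'a set)"
    and dist_le_1: "\<And>x y :: 'a. dist x y \<le> 1"
    and mixing: "topologically_mixing T"
    and r_pos: "r > 0" and \<gamma>_pos: "\<gamma> > 0" and H_nonneg: "H \<ge> 0"
    and K_nonneg: "K0 \<ge> 0" "K1 \<ge> 0" "K2 \<ge> 0" "K3 \<ge> 0" "K4 \<ge> 0"
    and pairing: "dist x y < r \<Longrightarrow>
      \<exists>\<phi>. bij_betw \<phi> {u. (T ^^ n) u = x} {u. (T ^^ n) u = y} \<and>
        (\<forall>u. (T ^^ n) u = x \<longrightarrow>
          (\<Sum>k<n. \<omega> (dist ((T ^^ k) u) ((T ^^ k) (\<phi> u)))) \<le> K1 * \<omega>' (dist x y) \<and>
          dist u (\<phi> u) \<le> K0 * dist x y \<and> dist u (\<phi> u) \<le> e n \<and>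
          \<omega>' (dist u (\<phi> u)) \<le> K2 * \<omega>' (dist x y) \<and>
          \<omega>' (dist u (\<phi> u)) \<le> K3 * (1 + real n) powr - \<gamma>)"
    and e_lim: "e \<longlonglongrightarrow> 0"
    and \<omega>_bounds: "\<And>t. 0 \<le> t \<Longrightarrow> t \<le> 1 \<Longrightarrow> 0 \<le> \<omega> t \<and> \<omega> t \<le> W"
    and \<omega>_lim: "\<And>\<epsilon>. \<epsilon> > 0 \<Longrightarrow> \<exists>\<eta>>0. \<forall>t. 0 \<le> t \<and> t \<le> 1 \<and> t < \<eta> \<longrightarrow> \<omega> t < \<epsilon>"
    and \<omega>'_zero: "\<omega>' 0 = 0"
    and \<omega>'_pos: "\<And>t. 0 < t \<Longrightarrow> t \<le> 1 \<Longrightarrow> 0 < \<omega>' t"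
    and \<omega>'_mono: "\<And>s t. 0 \<le> s \<Longrightarrow> s \<le> t \<Longrightarrow> t \<le> 1 \<Longrightarrow> \<omega>' s \<le> \<omega>' t"
    and \<omega>'_subadd: "\<And>s t u. 0 \<le> s \<Longrightarrow> s \<le> 1 \<Longrightarrow> 0 \<le> t \<Longrightarrow> t \<le> 1 \<Longrightarrow> 0 \<le> u \<Longrightarrow> u \<le> 1 \<Longrightarrow> u \<le> s + t \<Longrightarrow>
      \<omega>' u \<le> \<omega>' s + \<omega>' t"
    and \<omega>'_lim: "\<And>\<epsilon>. \<epsilon> > 0 \<Longrightarrow> \<exists>\<eta>>0. \<forall>t. 0 \<le> t \<and> t \<le> 1 \<and> t < \<eta> \<longrightarrow> \<omega>' t < \<epsilon>"
    and \<omega>'_linear: "\<And>t. 0 \<le> t \<Longrightarrow> t \<le> 1 \<Longrightarrow> t \<le> K4 * \<omega>' t"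
begin

text \<open>One constant \<open>H\<close> for the whole class, so that the constants obtained below
  do not depend on the individual potential.\<close>

definition pot :: "('a \<Rightarrow> real) \<Rightarrow> bool" where
  "pot a \<longleftrightarrow> (\<forall>x y. \<bar>a x - a y\<bar> \<le> H * \<omega> (dist x y))"

text \<open>The constant is 1 so that the decay has a universal constant; other functions are
  rescaled first.\<close>

definition lip :: "('a \<Rightarrow> real) \<Rightarrow> bool" where
  "lip u \<longleftrightarrow> (\<forall>x y. \<bar>u x - u y\<bar> \<le> \<omega>' (dist x y))"

abbreviation G :: "('a \<Rightarrow> real) \<Rightarrow> nat \<Rightarrow> 'a \<Rightarrow> real" where
  "G a n \<equiv> iter a n (\<lambda>y. 1)"

abbreviation rate :: "nat \<Rightarrow> real" where
  "rate n \<equiv> (1 + real n) powr - \<gamma>"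

lemma \<omega>'_nonneg: "0 \<le> t \<Longrightarrow> t \<le> 1 \<Longrightarrow> 0 \<le> \<omega>' t"
  using \<omega>'_pos[of t] \<omega>'_zero by (cases "t = 0") auto

lemma \<omega>'_dist_nonneg [simp]: "0 \<le> \<omega>' (dist x y)" for x y :: 'a
  by (simp add: \<omega>'_nonneg dist_le_1)

lemma \<omega>'_dist_le: "\<omega>' (dist x y) \<le> \<omega>' 1" for x y :: 'a
  by (simp add: \<omega>'_mono dist_le_1)

lemma \<omega>'_1_pos: "0 < \<omega>' 1" by (rule \<omega>'_pos) auto

lemma W_nonneg: "0 \<le> W" using \<omega>_bounds[of 0] by simp

lemma pot_osc: "pot a \<Longrightarrow> \<bar>a x - a y\<bar> \<le> H * W"
  using \<omega>_bounds[of "dist x y"] mult_left_mono[OF _ H_nonneg, of "\<omega> (dist x y)" W]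
  by (fastforce simp: pot_def dist_le_1 intro: order_trans)

lemma birkhoff_osc:
  assumes "pot a" shows "\<bar>birkhoff T a n x - birkhoff T a n y\<bar> \<le> real n * (H * W)"
proof -
  have "\<bar>birkhoff T a n x - birkhoff T a n y\<bar> \<le> (\<Sum>k<n. \<bar>a ((T ^^ k) x) - a ((T ^^ k) y)\<bar>)"
    unfolding birkhoff_def sum_subtractf[symmetric] by (rule sum_abs)
  also have "\<dots> \<le> (\<Sum>k<n. H * W)" by (intro sum_mono pot_osc assms)
  finally show ?thesis by simp
qed

text \<open>Mixing only reaches neighbourhoods. Between two finite nets one time \<open>N\<close>
  serves all pairs; an orbit starting near \<open>z\<close> and ending within \<open>r\<close> of
  \<open>x\<close> is then exchanged for its paired branch ending at \<open>x\<close> itself, whose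
  starting point has moved by at most \<open>e N\<close>.\<close>

lemma exact:
  assumes \<epsilon>: "\<epsilon> > 0"
  obtains N where "N \<ge> 1" "\<And>x z. \<exists>u. (T ^^ N) u = x \<and> dist u z < \<epsilon>"
proof -
  obtain C :: "'a set" where C: "finite C" "\<forall>x. \<exists>c\<in>C. dist c x < r / 2"
    using finite_net[OF compact_space half_gt_zero[OF r_pos]] by blast
  obtain D :: "'a set" where D: "finite D" "\<forall>x. \<exists>c\<in>D. dist c x < \<epsilon> / 3"
    using finite_net[OF compact_space, of "\<epsilon> / 3"] \<epsilon> by (metis divide_pos_pos zero_less_numeral)
  have "\<forall>c d. \<exists>k. \<forall>n>k. (T ^^ n) -` ball c (r / 2) \<inter> ball d (\<epsilon> / 3) \<noteq> {}"
    using mixing r_pos \<epsilon> unfolding topologically_mixing_def by simp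
  then obtain k where k: "\<And>c d n. n > k c d \<Longrightarrow> (T ^^ n) -` ball c (r / 2) \<inter> ball d (\<epsilon> / 3) \<noteq> {}"
    by metis
  obtain N0 where N0: "\<And>n. n \<ge> N0 \<Longrightarrow> e n < \<epsilon> / 3"
    using order_tendstoD(2)[OF e_lim, of "\<epsilon> / 3"] \<epsilon> by (auto simp: eventually_sequentially)
  \<comment> \<open>The sum bounds each of the finitely many waiting times, and \<open>Suc\<close>
    makes the inequality strict.\<close>
  define N where "N = Suc (max N0 (\<Sum>p\<in>C \<times> D. k (fst p) (snd p)))"
  have "\<exists>u. (T ^^ N) u = x \<and> dist u z < \<epsilon>" for x z
  proof -
    obtain c where c: "c \<in> C" "dist c x < r / 2" using C by blast
    obtain d where d: "d \<in> D" "dist d z < \<epsilon> / 3" using D by blast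
    have "k c d \<le> (\<Sum>p\<in>C \<times> D. k (fst p) (snd p))"
      using member_le_sum[of "(c, d)" "C \<times> D" "\<lambda>p. k (fst p) (snd p)"] c d C(1) D(1) by simp
    then have "N > k c d" by (simp add: N_def)
    then obtain v where v: "dist c ((T ^^ N) v) < r / 2" "dist d v < \<epsilon> / 3"
      using k[of c d N] by auto
    have "dist ((T ^^ N) v) x < r"
      using dist_triangle[of "(T ^^ N) v" x c] v(1) c(2) by (simp add: dist_commute)
    then obtain \<phi> where \<phi>: "bij_betw \<phi> {u. (T ^^ N) u = (T ^^ N) v} {u. (T ^^ N) u = x}"
      "dist v (\<phi> v) \<le> e N"
      using pairing[of "(T ^^ N) v" x N] by blast
    have "(T ^^ N) (\<phi> v) = x" using bij_betwE[OF \<phi>(1)] by auto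
    moreover have "e N < \<epsilon> / 3" by (rule N0) (simp add: N_def)
    then have "dist (\<phi> v) z < \<epsilon>"
      using \<phi>(2) v(2) d(2) dist_triangle[of "\<phi> v" z v] dist_triangle[of v z d]
        by (simp add: dist_commute)
    ultimately show ?thesis by blast
  qed
  moreover have "N \<ge> 1" by (simp add: N_def)
  ultimately show thesis by (rule that[rotated])
qed

lemma fibre_nonempty: "\<exists>u. (T ^^ n) u = x"
proof -
  obtain N where N: "N \<ge> 1" "\<And>x z. \<exists>u. (T ^^ N) u = x \<and> dist u z < 1" by (rule exact[of 1]) auto
  have "surj T"
  proof
    show "UNIV \<subseteq> range T"
    proof
      fix x obtain u where "(T ^^ N) u = x" using N(2) by blast
      with N(1) show "x \<in> range T" by (cases N) auto
    qed
  qed simp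
  then have "surj (T ^^ n)" by (rule surj_fn)
  then show ?thesis by (metis surjD)
qed

text \<open>The pairing makes the cardinality of a fibre constant at scale \<open>r\<close>, so a
  finite net sees all its values.\<close>

lemma card_fibre_bounded:
  obtains D where "D \<ge> 1" "\<And>x. real (card {u. (T ^^ n) u = x}) \<le> D"
proof -
  obtain C :: "'a set" where C: "finite C" "\<forall>x. \<exists>c\<in>C. dist c x < r"
    using finite_net[OF compact_space r_pos] by blast
  have "real (card {u. (T ^^ n) u = x}) \<le> 1 + (\<Sum>c\<in>C. real (card {u. (T ^^ n) u = c}))" for x
  proof -
    obtain c where c: "c \<in> C" "dist c x < r" using C(2) by blast
    then have "card {u. (T ^^ n) u = x} = card {u. (T ^^ n) u = c}"
      using pairing[of c x n] by (auto dest: bij_betw_same_card)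
    also have "real \<dots> \<le> (\<Sum>c\<in>C. real (card {u. (T ^^ n) u = c}))"
      using c C(1) by (intro member_le_sum[of c C "\<lambda>c. real (card {u. (T ^^ n) u = c})"]) auto
    finally show ?thesis by simp
  qed
  then show thesis by (rule that[rotated]) (simp add: sum_nonneg)
qed

lemma iter_pos: "(\<And>y. 0 < u y) \<Longrightarrow> 0 < iter a n u x"
  using fibre_nonempty[of n x] unfolding ruelle_iter_def
  by (intro sum_pos finite_fibre) auto

lemma G_pos: "0 < G a n x" by (rule iter_pos) simp

lemma G_ne_0 [simp]: "G a n x \<noteq> 0" using G_pos[of a n x] by simp

text \<open>\<open>J * \<omega>' (dist x y)\<close> bounds the difference of the Birkhoff sums along
  two paired branches, and \<open>\<Theta>\<close> the quotient of their exponentials at any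
  distance.\<close>

definition J :: real where "J = H * K1"
definition \<Theta> :: real where "\<Theta> = exp (J * \<omega>' 1)"

lemma J_nonneg: "J \<ge> 0" by (simp add: J_def H_nonneg K_nonneg)
lemma \<Theta>_ge_1: "\<Theta> \<ge> 1" using J_nonneg \<omega>'_1_pos by (simp add: \<Theta>_def)

text \<open>Two errors are separated along each pair of branches: the weights differ, which costs
  \<open>J * \<omega>' (dist x y)\<close> times the size \<open>m\<close> of \<open>u\<close>, and
  the values of \<open>u\<close> differ, which costs \<open>E\<close>. Both are measured against
  \<open>g\<close>, so that \<open>u\<close> may itself be an iterate and \<open>g\<close> the
  corresponding iterate of 1. In \<open>uE\<close> the two bounds on the paired points are both on
  offer: one keeps the modulus of \<open>u\<close>, the other exploits contraction.\<close>

lemma distortion: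
  assumes a: "pot a" and xy: "dist x y < r"
    and g: "\<And>z. 0 \<le> g z" and u: "\<And>z. \<bar>u z\<bar> \<le> m * g z" and m: "0 \<le> m" and E: "0 \<le> E"
    and uE: "\<And>z z'. \<omega>' (dist z z') \<le> K2 * \<omega>' (dist x y) \<Longrightarrow> \<omega>' (dist z z') \<le> K3 * rate n \<Longrightarrow>
      \<bar>u z - u z'\<bar> \<le> E * g z"
  shows "\<bar>iter a n u x - iter a n u y\<bar> \<le> \<Theta> * (J * \<omega>' (dist x y) * m + E) * iter a n g x"
proof -
  let ?S = "birkhoff T a n"
  obtain \<phi> where bij: "bij_betw \<phi> {z. (T ^^ n) z = x} {z. (T ^^ n) z = y}"
    and \<phi>: "\<And>z. (T ^^ n) z = x \<Longrightarrow>
          (\<Sum>k<n. \<omega> (dist ((T ^^ k) z) ((T ^^ k) (\<phi> z)))) \<le> K1 * \<omega>' (dist x y) \<and>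
          \<omega>' (dist z (\<phi> z)) \<le> K2 * \<omega>' (dist x y) \<and>
          \<omega>' (dist z (\<phi> z)) \<le> K3 * rate n"
    using pairing[OF xy, of n] by blast
  have "iter a n u y = (\<Sum>z | (T ^^ n) z = x. exp (?S (\<phi> z)) * u (\<phi> z))"
    unfolding ruelle_iter_def by (rule sum.reindex_bij_betw[OF bij, symmetric])
  then have "\<bar>iter a n u x - iter a n u y\<bar> = \<bar>\<Sum>z | (T ^^ n) z = x. exp (?S z) * u z -
    exp (?S (\<phi> z)) * u (\<phi> z)\<bar>"
    by (simp add: ruelle_iter_def sum_subtractf)
  also have "\<dots> \<le> (\<Sum>z | (T ^^ n) z = x. \<bar>exp (?S z) * u z - exp (?S (\<phi> z)) * u (\<phi> z)\<bar>)"
    by (rule sum_abs)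
  also have "\<dots> \<le> (\<Sum>z | (T ^^ n) z = x. \<Theta> * (J * \<omega>' (dist x y) * m + E) * (exp (?S z) * g z))"
  proof (rule sum_mono)
    fix z assume "z \<in> {z. (T ^^ n) z = x}"
    then have z: "(T ^^ n) z = x" by simp
    define d where "d = ?S (\<phi> z) - ?S z"
    have "\<bar>d\<bar> \<le> (\<Sum>k<n. \<bar>a ((T ^^ k) (\<phi> z)) - a ((T ^^ k) z)\<bar>)"
      unfolding d_def birkhoff_def sum_subtractf[symmetric] by (rule sum_abs)
    also have "\<dots> \<le> (\<Sum>k<n. H * \<omega> (dist ((T ^^ k) z) ((T ^^ k) (\<phi> z))))"
      using a unfolding pot_def by (intro sum_mono) (metis dist_commute)
    also have "\<dots> \<le> J * \<omega>' (dist x y)"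
      using \<phi>[OF z] H_nonneg by (simp add: J_def mult.assoc mult_left_mono flip: sum_distrib_left)
    finally have d: "\<bar>d\<bar> \<le> J * \<omega>' (dist x y)" .
    also have "\<dots> \<le> J * \<omega>' 1" by (intro mult_left_mono \<omega>'_dist_le J_nonneg)
    finally have ed: "exp \<bar>d\<bar> \<le> \<Theta>" by (simp add: \<Theta>_def)
    have "\<bar>exp d - 1\<bar> \<le> \<bar>d\<bar> * exp \<bar>d\<bar>" by (rule abs_exp_minus_one_le)
    also have "\<dots> \<le> (J * \<omega>' (dist x y)) * \<Theta>" by (intro mult_mono d ed) (auto simp: J_nonneg)
    finally have 1: "\<bar>exp d - 1\<bar> \<le> J * \<omega>' (dist x y) * \<Theta>" .
    have 2: "exp d \<le> \<Theta>" using ed by (meson abs_ge_self exp_le_cancel_iff order_trans)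
    \<comment> \<open>Change of value at the new weight, minus change of weight at the old
      value.\<close>
    have "exp (?S z) * u z - exp (?S (\<phi> z)) * u (\<phi> z)
        = exp (?S z) * (exp d * (u z - u (\<phi> z)) - (exp d - 1) * u z)"
      by (simp add: d_def exp_diff field_simps)
    then have "\<bar>exp (?S z) * u z - exp (?S (\<phi> z)) * u (\<phi> z)\<bar>
        = exp (?S z) * \<bar>exp d * (u z - u (\<phi> z)) - (exp d - 1) * u z\<bar>"
      by (simp add: abs_mult)
    also have "\<dots> \<le> exp (?S z) * (\<Theta> * (E * g z) + J * \<omega>' (dist x y) * \<Theta> * (m * g z))"
    proof (rule mult_left_mono)
      have "\<bar>exp d * (u z - u (\<phi> z)) - (exp d - 1) * u z\<bar>
          \<le> exp d * \<bar>u z - u (\<phi> z)\<bar> + \<bar>exp d - 1\<bar> * \<bar>u z\<bar>"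
        by (metis abs_exp_cancel abs_mult abs_triangle_ineq4)
      also have "\<dots> \<le> \<Theta> * (E * g z) + J * \<omega>' (dist x y) * \<Theta> * (m * g z)"
        using \<phi>[OF z] \<Theta>_ge_1 by (intro add_mono mult_mono 1 2 uE u) (auto simp: J_nonneg E g)
      finally show "\<bar>exp d * (u z - u (\<phi> z)) - (exp d - 1) * u z\<bar>
          \<le> \<Theta> * (E * g z) + J * \<omega>' (dist x y) * \<Theta> * (m * g z)" .
    qed simp
    finally show "\<bar>exp (?S z) * u z - exp (?S (\<phi> z)) * u (\<phi> z)\<bar>
        \<le> \<Theta> * (J * \<omega>' (dist x y) * m + E) * (exp (?S z) * g z)"
      by (simp add: algebra_simps)
  qed
  also have "\<dots> = \<Theta> * (J * \<omega>' (dist x y) * m + E) * iter a n g x"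
    by (simp add: ruelle_iter_def sum_distrib_left)
  finally show ?thesis .
qed

text \<open>A Harnack inequality uniform in \<open>n\<close> and \<open>a\<close>. Within distance
  \<open>r\<close> it is \<open>distortion\<close>. For arbitrary points exactness helps: each point
  \<open>w\<close> over \<open>x\<close> has a companion over \<open>y\<close> within
  \<open>r\<close> of it, and the first \<open>N\<close> steps cost only a bounded factor. Times
  below \<open>N\<close> are handled by counting branches.\<close>

lemma G_comparable:
  obtains R where "R \<ge> 1" "\<And>a n x y. pot a \<Longrightarrow> G a n x \<le> R * G a n y"
proof -
  obtain N where N: "\<And>x z. \<exists>u. (T ^^ N) u = x \<and> dist u z < r" using exact[OF r_pos] by blast
  have "\<exists>D\<ge>1. \<forall>x. real (card {u. (T ^^ n) u = x}) \<le> D" for n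
    using card_fibre_bounded[of n] by blast
  then obtain D where D: "\<And>n. D n \<ge> 1" "\<And>n x. real (card {u. (T ^^ n) u = x}) \<le> D n" by metis
  \<comment> \<open>One bound on the number of branches for all times up to \<open>N\<close>: both
    case branches below draw on it.\<close>
  define D' where "D' = (\<Sum>n\<le>N. D n)"
  have D': "D n \<le> D'" if "n \<le> N" for n
    unfolding D'_def using that D(1) by (intro member_le_sum) (auto intro: order_trans[of 0 1])
  have D'1: "D' \<ge> 1" using D'[of N] D(1)[of N] by simp
  define Q where "Q = exp (real N * (H * W))"
  have Q1: "Q \<ge> 1" using H_nonneg W_nonneg by (simp add: Q_def)
  define L where "L = 1 + \<Theta> * J * \<omega>' 1"
  have L1: "L \<ge> 1" using \<Theta>_ge_1 J_nonneg \<omega>'_1_pos by (simp add: L_def)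
  have loc: "G a n x \<le> L * G a n y" if "pot a" "dist x y < r" for a n x y
  proof -
    have "\<bar>G a n y - G a n x\<bar> \<le> \<Theta> * (J * \<omega>' (dist y x) * 1 + 0) * G a n y"
      by (rule distortion) (use that in \<open>auto simp: dist_commute\<close>)
    also have "\<dots> \<le> \<Theta> * (J * \<omega>' 1) * G a n y"
      using \<Theta>_ge_1 J_nonneg G_pos[of a n y]
      by (intro mult_right_mono mult_left_mono) (auto intro!: mult_left_mono \<omega>'_dist_le)
    finally show ?thesis by (simp add: L_def algebra_simps)
  qed
  have "G a n x \<le> (D' * Q * L) * G a n y" if a: "pot a" for a n x y
  proof (cases "n < N")
    case True
    obtain u where u: "(T ^^ n) u = y" using fibre_nonempty by blast
    have "G a n x \<le> (\<Sum>z | (T ^^ n) z = x. Q * exp (birkhoff T a n u))"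
      unfolding ruelle_iter_def
    proof (rule sum_mono)
      fix z
      have "birkhoff T a n z \<le> real n * (H * W) + birkhoff T a n u"
        using birkhoff_osc[OF a, of n z u] by simp
      also have "real n * (H * W) \<le> real N * (H * W)"
        using True H_nonneg W_nonneg by (intro mult_right_mono) auto
      finally show "exp (birkhoff T a n z) * 1 \<le> Q * exp (birkhoff T a n u)"
        by (simp add: Q_def flip: exp_add)
    qed
    also have "\<dots> = real (card {z. (T ^^ n) z = x}) * (Q * exp (birkhoff T a n u))" by simp
    also have "\<dots> \<le> D' * (Q * exp (birkhoff T a n u))"
      using D(2)[of n x] D'[of n] True Q1 by (intro mult_right_mono) auto
    also have "\<dots> \<le> D' * (Q * G a n y)"
      using D'1 Q1 iter_ge_term[of "\<lambda>_. 1" n u y a] u by (intro mult_left_mono) auto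
    also have "\<dots> \<le> D' * (Q * G a n y) * L"
      using mult_left_mono[OF L1, of "D' * (Q * G a n y)"] D'1 Q1 G_pos[of a n y] by simp
    finally show ?thesis by (simp add: algebra_simps)
  next
    case False
    then obtain q where n: "n = N + q" by (metis le_Suc_ex not_less)
    \<comment> \<open>The companion \<open>z\<close> lies over \<open>y\<close> near
      \<open>w\<close>: the weights of the first \<open>N\<close> steps differ by the factor
      \<open>Q\<close> at most, the remaining \<open>G a q\<close> by \<open>L\<close>.\<close>
    have key: "exp (birkhoff T a N w) * G a q w \<le> Q * L * G a n y" for w
    proof -
      obtain z where z: "(T ^^ N) z = y" "dist z w < r" using N by blast
      have "exp (birkhoff T a N w) \<le> Q * exp (birkhoff T a N z)"
        using birkhoff_osc[OF a, of N w z] by (simp add: Q_def flip: exp_add)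
      moreover have "G a q w \<le> L * G a q z" using z(2) by (intro loc a) (simp add: dist_commute)
      ultimately have "exp (birkhoff T a N w) * G a q w \<le> (Q * exp (birkhoff T a N z)) * (L *
        G a q z)"
        using G_pos[of a q w] Q1 by (intro mult_mono) auto
      also have "\<dots> = Q * L * (exp (birkhoff T a N z) * G a q z)" by simp
      also have "\<dots> \<le> Q * L * G a n y"
        unfolding n iter_add using Q1 L1 z(1)
        by (intro mult_left_mono iter_ge_term) (auto intro: less_imp_le[OF G_pos])
      finally show ?thesis .
    qed
    have "G a n x \<le> (\<Sum>w | (T ^^ N) w = x. Q * L * G a n y)"
      unfolding n iter_add unfolding ruelle_iter_def[of T a N _ x]
      using key unfolding n iter_add by (intro sum_mono) auto
    also have "\<dots> = real (card {w. (T ^^ N) w = x}) * (Q * L * G a n y)" by simp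
    also have "\<dots> \<le> D' * (Q * L * G a n y)"
      using D(2)[of N x] D'[of N] Q1 L1 G_pos[of a n y] by (intro mult_right_mono) auto
    finally show ?thesis by (simp add: algebra_simps)
  qed
  moreover have "D' * Q * L \<ge> 1"
    using D'1 Q1 L1 by (metis mult_ge1_I)
  ultimately show thesis by (rule that[rotated])
qed

end

section \<open>Decay of oscillation\<close>

context paired_branches begin

text \<open>The modulus \<open>\<omega>'\<close> survives iteration uniformly in \<open>n\<close>,
  relative to \<open>G a n\<close>. Nearby points are treated by \<open>distortion\<close> with
  \<open>E = K2 * \<omega>' (dist x y)\<close>; for distant ones \<open>\<omega>' (dist x y)\<close>
  is bounded below and the Harnack inequality suffices.\<close>

lemma lip_iter:
  obtains C where "C \<ge> 0"
    "\<And>a n u x y. pot a \<Longrightarrow> lip u \<Longrightarrow> (\<And>z. \<bar>u z\<bar> \<le> \<omega>' 1) \<Longrightarrow>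
      \<bar>iter a n u x - iter a n u y\<bar> \<le> C * \<omega>' (dist x y) * G a n x"
proof -
  obtain R where R: "R \<ge> 1" "\<And>a n x y. pot a \<Longrightarrow> G a n x \<le> R * G a n y" using G_comparable by blast
  \<comment> \<open>Cut off at 1 because \<open>\<omega>'\<close> is controlled on the unit interval
    only.\<close>
  define \<rho> where "\<rho> = min r 1"
  have \<rho>: "0 < \<omega>' \<rho>" "0 < \<rho>" "\<rho> \<le> 1" using r_pos by (auto simp: \<rho>_def intro!: \<omega>'_pos)
  define C1 where "C1 = \<Theta> * (J * \<omega>' 1 + K2)"
  define C2 where "C2 = (1 + R) * \<omega>' 1 / \<omega>' \<rho>"
  have C: "C1 \<ge> 0" "C2 \<ge> 0"
    using \<Theta>_ge_1 J_nonneg \<omega>'_1_pos K_nonneg R(1) \<rho> by (auto simp: C1_def C2_def)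
  have "\<bar>iter a n u x - iter a n u y\<bar> \<le> max C1 C2 * \<omega>' (dist x y) * G a n x"
    if a: "pot a" and u: "lip u" and ub: "\<And>z. \<bar>u z\<bar> \<le> \<omega>' 1" for a n u x y
  proof (cases "dist x y < r")
    case True
    have "\<bar>iter a n u x - iter a n u y\<bar> \<le> \<Theta> * (J * \<omega>' (dist x y) * \<omega>' 1 + K2 * \<omega>' (dist x y)) *
      G a n x"
    proof (rule distortion[OF a True])
      fix z z' :: 'a assume "\<omega>' (dist z z') \<le> K2 * \<omega>' (dist x y)"
      then show "\<bar>u z - u z'\<bar> \<le> K2 * \<omega>' (dist x y) * 1"
        using u unfolding lip_def by (metis mult.right_neutral order_trans)
    qed (use ub \<omega>'_1_pos K_nonneg in auto)
    also have "\<dots> = C1 * \<omega>' (dist x y) * G a n x" by (simp add: C1_def algebra_simps)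
    also have "\<dots> \<le> max C1 C2 * \<omega>' (dist x y) * G a n x"
      using G_pos[of a n x] by (intro mult_right_mono) auto
    finally show ?thesis .
  next
    case False
    have bound: "\<bar>iter a n u z\<bar> \<le> \<omega>' 1 * G a n z" for z
    proof -
      have "iter a n u z \<le> iter a n (\<lambda>y. \<omega>' 1 * 1) z" "iter a n (\<lambda>y. - \<omega>' 1 * 1) z \<le> iter a n u z"
        using ub by (auto intro!: iter_mono simp: abs_le_iff minus_le_iff)
      then show ?thesis unfolding iter_scale by (simp add: abs_le_iff)
    qed
    have "\<bar>iter a n u x - iter a n u y\<bar> \<le> \<omega>' 1 * G a n x + \<omega>' 1 * G a n y"
      using bound[of x] bound[of y] by linarith
    also have "\<dots> \<le> \<omega>' 1 * G a n x + \<omega>' 1 * (R * G a n x)"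
      using R(2)[OF a] \<omega>'_1_pos by (intro add_left_mono mult_left_mono) auto
    also have "\<dots> = C2 * \<omega>' \<rho> * G a n x" using \<rho> by (simp add: C2_def field_simps)
    also have "\<dots> \<le> max C1 C2 * \<omega>' (dist x y) * G a n x"
      using False C G_pos[of a n x] \<rho> dist_le_1[of x y]
      by (intro mult_right_mono mult_mono \<omega>'_mono) (auto simp: \<rho>_def)
    finally show ?thesis .
  qed
  then show thesis using C by (intro that[of "max C1 C2"]) auto
qed

lemma G_lip:
  obtains C where "C \<ge> 0"
    "\<And>a n x y. pot a \<Longrightarrow> \<bar>G a n x - G a n y\<bar> \<le> C * \<omega>' (dist x y) * G a n x"
proof -
  obtain C where C: "C \<ge> 0" "\<And>a n u x y. pot a \<Longrightarrow> lip u \<Longrightarrow> (\<And>z. \<bar>u z\<bar> \<le> \<omega>' 1) \<Longrightarrow>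
      \<bar>iter a n u x - iter a n u y\<bar> \<le> C * \<omega>' (dist x y) * G a n x"
    using lip_iter by blast
  have "\<bar>G a n x - G a n y\<bar> \<le> C / \<omega>' 1 * \<omega>' (dist x y) * G a n x" if a: "pot a" for a n x y
  proof -
    have "\<bar>iter a n (\<lambda>y. \<omega>' 1 * 1) x - iter a n (\<lambda>y. \<omega>' 1 * 1) y\<bar> \<le> C * \<omega>' (dist x y) * G a n x"
      by (rule C(2)[OF a]) (use \<omega>'_1_pos in \<open>auto simp: lip_def\<close>)
    then have "\<omega>' 1 * \<bar>G a n x - G a n y\<bar> \<le> C * \<omega>' (dist x y) * G a n x"
      unfolding iter_scale using \<omega>'_1_pos by (simp add: abs_mult flip: right_diff_distrib)
    then show ?thesis using \<omega>'_1_pos by (simp add: field_simps)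
  qed
  then show thesis using that[of "C / \<omega>' 1"] C(1) \<omega>'_1_pos by simp
qed

text \<open>Dividing by \<open>G\<close> rather than by powers of an eigenvalue gives an average of
  \<open>u\<close> before any eigenvalue is known.\<close>

definition ratio :: "('a \<Rightarrow> real) \<Rightarrow> nat \<Rightarrow> ('a \<Rightarrow> real) \<Rightarrow> 'a \<Rightarrow> real" where
  "ratio a n u x = iter a n u x / G a n x"

lemma iter_eq_ratio: "iter a n u x = ratio a n u x * G a n x"
  by (simp add: ratio_def)

lemma ratio_0 [simp]: "ratio a 0 u = u"
  by (simp add: ratio_def iter_0 fun_eq_iff)

lemma ratio_le:
  assumes "\<And>z. ratio a q u z \<le> c" shows "ratio a (p + q) u x \<le> c"
proof -
  have "iter a (p + q) u x \<le> iter a p (\<lambda>z. c * G a q z) x"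
    unfolding iter_add using assms G_pos by (intro iter_mono) (simp add: ratio_def field_simps)
  then show ?thesis
    unfolding iter_scale iter_add[symmetric] using G_pos[of a "p + q" x]
      by (simp add: ratio_def field_simps)
qed

lemma ratio_ge:
  assumes "\<And>z. c \<le> ratio a q u z" shows "c \<le> ratio a (p + q) u x"
proof -
  have "iter a p (\<lambda>z. c * G a q z) x \<le> iter a (p + q) u x"
    unfolding iter_add using assms G_pos by (intro iter_mono) (simp add: ratio_def field_simps)
  then show ?thesis
    unfolding iter_scale iter_add[symmetric] using G_pos[of a "p + q" x]
      by (simp add: ratio_def field_simps)
qed

text \<open>The later quotient is an average of the earlier ones and hence lies in their
  range.\<close>

lemma ratio_near:
  assumes "\<And>z z'. ratio a q u z - ratio a q u z' \<le> m"
  shows "\<bar>ratio a q u z - ratio a (p + q) u x\<bar> \<le> m"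
proof -
  have "ratio a (p + q) u x \<le> ratio a q u z + m"
    using assms by (intro ratio_le) (simp add: algebra_simps)
  moreover have "ratio a q u z - m \<le> ratio a (p + q) u x"
    using assms by (intro ratio_ge) (simp add: algebra_simps)
  ultimately show ?thesis by (simp add: abs_le_iff)
qed

lemma ratio_osc_mono:
  assumes "\<And>z z'. ratio a q u z - ratio a q u z' \<le> m"
  shows "ratio a (p + q) u x - ratio a (p + q) u y \<le> m"
proof -
  have "ratio a (p + q) u x - m \<le> ratio a q u z" for z
    using ratio_near[OF assms, of z p x] by (simp add: abs_le_iff)
  then have "ratio a (p + q) u x - m \<le> ratio a (p + q) u y" by (rule ratio_ge)
  then show ?thesis by simp
qed

lemma rate_pos: "0 < rate n" by simp

lemma rate_halve: assumes "n \<le> 2 * p + 1" shows "rate p \<le> 2 powr \<gamma> * rate n"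
proof -
  have "(1 + real n) powr \<gamma> \<le> (2 * (1 + real p)) powr \<gamma>"
    using assms \<gamma>_pos by (intro powr_mono2) auto
  also have "\<dots> = 2 powr \<gamma> * (1 + real p) powr \<gamma>" by (rule powr_mult)
  finally show ?thesis by (simp add: powr_minus field_simps)
qed

text \<open>Subtracting the constant \<open>v = ratio a n u y\<close> makes \<open>iter a n (u - v)\<close> vanish at \<open>y\<close>. Splitting
  \<open>n\<close> in halves, the first half of the iteration bounds \<open>u - v\<close> by the oscillation at that time,
    and in
  the second half the distances contract, so that the modulus is not needed at full scale.\<close>

lemma ratio_modulus:
  obtains C where "C \<ge> 0"
    "\<And>a n u x y m. pot a \<Longrightarrow> lip u \<Longrightarrow> dist x y < r \<Longrightarrow>
      (\<And>z z'. ratio a (n div 2) u z - ratio a (n div 2) u z' \<le> m) \<Longrightarrow>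
      ratio a n u x - ratio a n u y \<le> C * (\<omega>' (dist x y) * m + rate n)"
proof -
  obtain C where C: "C \<ge> 0" "\<And>a n u x y. pot a \<Longrightarrow> lip u \<Longrightarrow> (\<And>z. \<bar>u z\<bar> \<le> \<omega>' 1) \<Longrightarrow>
      \<bar>iter a n u x - iter a n u y\<bar> \<le> C * \<omega>' (dist x y) * G a n x"
    using lip_iter by blast
  \<comment> \<open>\<open>C\<close> is the modulus after the first half, \<open>K3 * rate p\<close>
    the size of \<open>\<omega>'\<close> on points contracted for \<open>p\<close> steps, and
    \<open>2 powr \<gamma>\<close> turns \<open>rate p\<close> into \<open>rate n\<close>.\<close>
  define B where "B = C * K3 * 2 powr \<gamma>"
  have B: "B \<ge> 0" using C(1) K_nonneg by (simp add: B_def)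
  define C' where "C' = \<Theta> * (J + B)"
  have "ratio a n u x - ratio a n u y \<le> C' * (\<omega>' (dist x y) * m + rate n)"
    if a: "pot a" and u: "lip u" and xy: "dist x y < r"
      and m: "\<And>z z'. ratio a (n div 2) u z - ratio a (n div 2) u z' \<le> m" for a n u x y m
  proof -
    define q where "q = n div 2"
    define p where "p = n - q"
    have n: "n = p + q" "n \<le> 2 * p + 1" by (auto simp: p_def q_def)
    have m0: "m \<ge> 0" using m[of x x] by simp
    define v where "v = ratio a n u y"
    have "\<bar>u z - v\<bar> \<le> \<omega>' 1" for z
    proof -
      have "ratio a 0 u z - ratio a 0 u z' \<le> \<omega>' 1" for z z'
        using u \<omega>'_dist_le[of z z'] unfolding lip_def by (simp, smt (verit, ccfv_threshold))
      from ratio_near[OF this, of z n y] show ?thesis by (simp add: v_def)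
    qed
    moreover have "lip (\<lambda>z. u z - v)" using u by (simp add: lip_def)
    ultimately have mod: "\<bar>iter a q (\<lambda>z. u z - v) z - iter a q (\<lambda>z. u z - v) z'\<bar> \<le> C *
      \<omega>' (dist z z') * G a q z" for z z'
      using C(2)[OF a] by blast
    have shift: "iter a k (\<lambda>z. u z - v) z = (ratio a k u z - v) * G a k z" for k z
      using iter_scale[of a k v "\<lambda>_. 1" z]
        by (simp add: iter_diff iter_eq_ratio[of a k u] algebra_simps)
    have "\<bar>iter a p (iter a q (\<lambda>z. u z - v)) x - iter a p (iter a q (\<lambda>z. u z - v)) y\<bar>
        \<le> \<Theta> * (J * \<omega>' (dist x y) * m + C * (K3 * rate p)) * iter a p (G a q) x"
    proof (rule distortion[OF a xy])
      fix z
      have "\<bar>ratio a q u z - v\<bar> \<le> m"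
        unfolding v_def n(1) by (rule ratio_near) (use m in \<open>simp add: q_def\<close>)
      then show "\<bar>iter a q (\<lambda>z. u z - v) z\<bar> \<le> m * G a q z"
        unfolding shift using G_pos[of a q z] by (simp add: abs_mult mult_right_mono)
    next
      fix z z' :: 'a assume "\<omega>' (dist z z') \<le> K3 * rate p"
      then have "C * \<omega>' (dist z z') * G a q z \<le> C * (K3 * rate p) * G a q z"
        using C(1) G_pos[of a q z] by (intro mult_right_mono mult_left_mono) auto
      with mod[of z z'] show "\<bar>iter a q (\<lambda>z. u z - v) z - iter a q (\<lambda>z. u z - v) z'\<bar> \<le> C * (K3 *
        rate p) * G a q z"
        by linarith
    qed (use m0 C(1) K_nonneg in \<open>auto intro: less_imp_le[OF G_pos]\<close>)
    then have "\<bar>(ratio a n u x - v) * G a n x - (ratio a n u y - v) * G a n y\<bar>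
        \<le> \<Theta> * (J * \<omega>' (dist x y) * m + C * (K3 * rate p)) * G a n x"
      unfolding iter_add[symmetric] n(1)[symmetric] shift .
    then have "\<bar>ratio a n u x - v\<bar> * G a n x \<le> \<Theta> * (J * \<omega>' (dist x y) * m + C * (K3 * rate p)) *
      G a n x"
      using G_pos[of a n x] by (simp add: v_def abs_mult)
    then have "ratio a n u x - ratio a n u y \<le> \<Theta> * (J * \<omega>' (dist x y) * m + C * (K3 * rate p))"
      using G_pos[of a n x] by (simp add: v_def mult_le_cancel_right)
    also have "\<dots> \<le> \<Theta> * ((J + B) * (\<omega>' (dist x y) * m + rate n))"
    proof (intro mult_left_mono)
      have "C * (K3 * rate p) \<le> B * rate n"
        using rate_halve[OF n(2)] C(1) K_nonneg by (simp add: B_def mult.assoc mult_left_mono)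
      moreover have "0 \<le> J * rate n" "0 \<le> B * (\<omega>' (dist x y) * m)"
        using J_nonneg B m0 by auto
      ultimately show "J * \<omega>' (dist x y) * m + C * (K3 * rate p) \<le> (J + B) * (\<omega>' (dist x y) * m +
        rate n)"
        by (simp add: algebra_simps)
    qed (use \<Theta>_ge_1 in simp)
    finally show ?thesis by (simp add: C'_def)
  qed
  then show thesis using that[of C'] \<Theta>_ge_1 J_nonneg B by (simp add: C'_def)
qed

text \<open>\<open>G a (N + k) x\<close> is a sum of at most \<open>D\<close> terms, each at most
  \<open>Q * R\<close> times any chosen one; so no branch of the fixed length \<open>N\<close> has
  negligible probability, whatever \<open>k\<close> is.\<close>

lemma branch_weight_ge:
  obtains \<delta> where "0 < \<delta>" "\<delta> \<le> 1"
    "\<And>a k u x. pot a \<Longrightarrow> (T ^^ N) u = x \<Longrightarrow> \<delta> \<le> exp (birkhoff T a N u) * G a k u / G a (N + k) x"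
proof -
  obtain R where R: "R \<ge> 1" "\<And>a n x y. pot a \<Longrightarrow> G a n x \<le> R * G a n y" using G_comparable by blast
  obtain D where D: "D \<ge> 1" "\<And>x. real (card {u. (T ^^ N) u = x}) \<le> D" using card_fibre_bounded
    by blast
  define Q where "Q = exp (real N * (H * W))"
  have Q1: "Q \<ge> 1" using H_nonneg W_nonneg by (simp add: Q_def)
  have DQR: "D * Q * R \<ge> 1" using D(1) Q1 R(1) by (metis mult_ge1_I)
  have "1 / (D * Q * R) \<le> exp (birkhoff T a N u) * G a k u / G a (N + k) x"
    if a: "pot a" and u: "(T ^^ N) u = x" for a k u x
  proof -
    have "G a (N + k) x \<le> (\<Sum>z | (T ^^ N) z = x. (Q * R) * (exp (birkhoff T a N u) * G a k u))"
      unfolding iter_add unfolding ruelle_iter_def[of T a N _ x]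
    proof (rule sum_mono)
      fix z
      have "exp (birkhoff T a N z) \<le> Q * exp (birkhoff T a N u)"
        using birkhoff_osc[OF a, of N z u] by (simp add: Q_def flip: exp_add)
      then have "exp (birkhoff T a N z) * G a k z \<le> (Q * exp (birkhoff T a N u)) * (R * G a k u)"
        using R(2)[OF a, of k z u] G_pos[of a k z] Q1 by (intro mult_mono) auto
      then show "exp (birkhoff T a N z) * G a k z \<le> (Q * R) * (exp (birkhoff T a N u) * G a k u)"
        by (simp add: algebra_simps)
    qed
    also have "\<dots> = real (card {z. (T ^^ N) z = x}) * ((Q * R) * (exp (birkhoff T a N u) * G a k u))"
      by simp
    also have "\<dots> \<le> D * ((Q * R) * (exp (birkhoff T a N u) * G a k u))"
      using D(2)[of x] Q1 R(1) G_pos[of a k u] by (intro mult_right_mono) auto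
    finally have "G a (N + k) x \<le> (D * Q * R) * (exp (birkhoff T a N u) * G a k u)"
      by (simp add: mult.assoc)
    then show ?thesis
      using DQR G_pos[of a "N + k" x] by (simp add: field_simps)
  qed
  then show thesis using that[of "1 / (D * Q * R)"] DQR by simp
qed

text \<open>The weights are the transition probabilities of the Markov chain. They depend on
  \<open>k\<close>, so the chain is inhomogeneous in time.\<close>

lemma ratio_weights:
  "ratio a (N + k) u x = (\<Sum>z | (T ^^ N) z = x. exp (birkhoff T a N z) * G a k z / G a (N + k) x *
    ratio a k u z)"
proof -
  have "iter a (N + k) u x = (\<Sum>z | (T ^^ N) z = x. exp (birkhoff T a N z) * (ratio a k u z *
    G a k z))"
    unfolding iter_add iter_eq_ratio[of a k u, abs_def] ruelle_iter_def[of T a N] ..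
  then show ?thesis
    unfolding ratio_def[of a "N + k"] by (simp add: sum_divide_distrib mult_ac)
qed

lemma weight_nonneg: "0 \<le> exp c * G a k z / G a n x"
  using G_pos[of a k z] G_pos[of a n x] by simp

lemma weights_sum: "(\<Sum>z | (T ^^ N) z = x. exp (birkhoff T a N z) * G a k z / G a (N + k) x) = 1"
proof -
  have "ratio a (N + k) (\<lambda>_. 1) x = 1" by (simp add: ratio_def)
  moreover have "ratio a k (\<lambda>_. 1) z = 1" for z by (simp add: ratio_def)
  ultimately show ?thesis using ratio_weights[of a N k "\<lambda>_. 1" x] by simp
qed

text \<open>Strong induction with \<open>n = N + j\<close>. Over any two points, branches ending
  within \<open>\<epsilon>\<close> of a common point carry product weight at least \<open>d\<close>.
  On that part \<open>ratio_modulus\<close> bounds the gap through the hypothesis at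
  \<open>j div 2\<close>, with a small factor \<open>\<eta>\<close>; the rest uses the hypothesis at
  \<open>j\<close>. Together this gives \<open>(1 - d / 2) * B * rate j\<close>, which is at most
  \<open>B * rate n\<close> once \<open>j\<close> is large.\<close>

theorem ratio_decay:
  obtains B where "B > 0"
    "\<And>a u n x y. pot a \<Longrightarrow> lip u \<Longrightarrow> \<bar>ratio a n u x - ratio a n u y\<bar> \<le> B * rate n"
proof -
  obtain C0 where C0: "C0 \<ge> 0"
    "\<And>a n u x y m. pot a \<Longrightarrow> lip u \<Longrightarrow> dist x y < r \<Longrightarrow>
      (\<And>z z'. ratio a (n div 2) u z - ratio a (n div 2) u z' \<le> m) \<Longrightarrow>
      ratio a n u x - ratio a n u y \<le> C0 * (\<omega>' (dist x y) * m + rate n)"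
    using ratio_modulus by metis
  define C where "C = C0 + 1"
  have C1: "C \<ge> 1" using C0(1) by (simp add: C_def)
  \<comment> \<open>Replacing \<open>rate (j div 2)\<close> by \<open>rate j\<close> costs
    \<open>2 powr \<gamma>\<close>; this choice leaves a quarter after that loss.\<close>
  define \<eta> where "\<eta> = 1 / (4 * C * 2 powr \<gamma>)"
  have \<eta>: "\<eta> > 0" "C * \<eta> * 2 powr \<gamma> = 1 / 4" using C1 by (auto simp: \<eta>_def)
  obtain \<epsilon>0 where \<epsilon>0: "\<epsilon>0 > 0" "\<And>t. 0 \<le> t \<Longrightarrow> t \<le> 1 \<Longrightarrow> t < \<epsilon>0 \<Longrightarrow> \<omega>' t < \<eta>"
    using \<omega>'_lim[OF \<eta>(1)] by blast
  \<comment> \<open>Two points within \<open>\<epsilon>\<close> of a third are then closer than both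
    \<open>\<epsilon>0\<close> and \<open>r\<close>.\<close>
  define \<epsilon> where "\<epsilon> = min \<epsilon>0 r / 2"
  have \<epsilon>: "\<epsilon> > 0" using \<epsilon>0 r_pos by (simp add: \<epsilon>_def)
  obtain N where N: "N \<ge> 1" "\<And>x z. \<exists>u. (T ^^ N) u = x \<and> dist u z < \<epsilon>" using exact[OF \<epsilon>] by blast
  obtain \<delta> where \<delta>: "0 < \<delta>" "\<delta> \<le> 1"
    "\<And>a k u x. pot a \<Longrightarrow> (T ^^ N) u = x \<Longrightarrow> \<delta> \<le> exp (birkhoff T a N u) * G a k u / G a (N + k) x"
    using branch_weight_ge[of N] by blast
  define d where "d = \<delta>\<^sup>2"
  have d: "0 < d" "d \<le> 1" using \<delta>(1,2) by (auto simp: d_def power_le_one)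
  \<comment> \<open>A polynomial rate hardly changes over \<open>N\<close> steps, so the gain
    \<open>1 - d / 2\<close> outweighs the passage from \<open>rate j\<close> to
    \<open>rate n\<close>.\<close>
  have "(\<lambda>j::nat. ((1 + real j) / (1 + real N + real j)) powr \<gamma>) \<longlonglongrightarrow> 1"
    using \<gamma>_pos by real_asymp
  then have "\<forall>\<^sub>F j in sequentially. 1 - d / 2 < ((1 + real j) / (1 + real N + real j)) powr \<gamma>"
    using d by (intro order_tendstoD) auto
  then obtain j0 where j0: "\<And>j. j \<ge> j0 \<Longrightarrow> 1 - d / 2 < ((1 + real j) / (1 + real N + real j)) powr \<gamma>"
    by (auto simp: eventually_sequentially)
  \<comment> \<open>The first entry absorbs the term \<open>C * rate j\<close> into
    \<open>B / 4 * rate j\<close>; the second covers the initial times, where the oscillation is at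
    most \<open>\<omega>' 1\<close>.\<close>
  define B where "B = max (4 * C) (\<omega>' 1 / rate (N + j0))"
  have B: "B \<ge> 4 * C" "B * rate (N + j0) \<ge> \<omega>' 1" "B > 0"
    using C1 \<omega>'_1_pos rate_pos[of "N + j0"] by (auto simp: B_def field_simps max_def)
  have main: "ratio a n u x - ratio a n u y \<le> B * rate n" if a: "pot a" and u: "lip u" for a u n x y
  proof (induction n arbitrary: x y rule: less_induct)
    case (less n)
    show ?case
    proof (cases "n < N + j0")
      case True
      have "ratio a 0 u z - ratio a 0 u z' \<le> \<omega>' 1" for z z'
        using u \<omega>'_dist_le[of z z'] unfolding lip_def by (simp, smt (verit, ccfv_threshold))
      then have "ratio a (n + 0) u x - ratio a (n + 0) u y \<le> \<omega>' 1" by (rule ratio_osc_mono)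
      also have "\<dots> \<le> B * rate (N + j0)" by (rule B)
      also have "\<dots> \<le> B * rate n"
        using B(3) True \<gamma>_pos by (intro mult_left_mono powr_mono2') auto
      finally show ?thesis by simp
    next
      case False
      define j where "j = n - N"
      have n: "n = N + j" "j \<ge> j0" "j < n" "j div 2 < n" using False N(1) by (auto simp: j_def)
      obtain i1 where i1: "(T ^^ N) i1 = x" "dist i1 x < \<epsilon>" using N(2) by blast
      obtain i2 where i2: "(T ^^ N) i2 = y" "dist i2 x < \<epsilon>" using N(2) by blast
      have i12: "dist i1 i2 < 2 * \<epsilon>"
        using dist_triangle[of i1 i2 x] i1(2) i2(2) by (simp add: dist_commute)
      define E where "E = C * (\<eta> * (B * rate (j div 2)) + rate j)"
      have "ratio a j u i1 - ratio a j u i2 \<le> C0 * (\<omega>' (dist i1 i2) * (B * rate (j div 2)) + rate j)"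
        by (rule C0(2)[OF a u]) (use i12 less.IH[OF n(4)] in \<open>auto simp: \<epsilon>_def\<close>)
      also have "\<dots> \<le> C * (\<eta> * (B * rate (j div 2)) + rate j)"
        using C0(1) B(3) i12 \<epsilon>0(2)[of "dist i1 i2"] dist_le_1 \<eta>(1)
        by (intro mult_mono add_mono mult_right_mono) (auto simp: C_def \<epsilon>_def intro!:
          add_nonneg_nonneg)
      finally have E: "ratio a j u i1 - ratio a j u i2 \<le> E" by (simp add: E_def)
      have "ratio a n u x - ratio a n u y \<le> (1 - \<delta>\<^sup>2) * (B * rate j) + \<delta>\<^sup>2 * E"
        unfolding n(1) ratio_weights
        by (rule weighted_diff_le[where ?i0.0 = i1 and ?j0.0 = i2])
           (use i1 i2 \<delta> E a less.IH[OF n(3)] weights_sum in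
             \<open>auto simp: finite_fibre weight_nonneg\<close>)
      also have "\<dots> \<le> (1 - d) * (B * rate j) + d * (B / 2 * rate j)"
      proof -
        have "C * \<eta> * B * rate (j div 2) \<le> C * \<eta> * B * (2 powr \<gamma> * rate j)"
          using C1 \<eta>(1) B(3) by (intro mult_left_mono rate_halve) auto
        also have "\<dots> = (C * \<eta> * 2 powr \<gamma>) * (B * rate j)" by simp
        also have "\<dots> = B / 4 * rate j" by (simp add: \<eta>(2))
        finally have "E \<le> B / 4 * rate j + C * rate j" by (simp add: E_def algebra_simps)
        also have "\<dots> \<le> B / 4 * rate j + B / 4 * rate j"
          using B(1) by (intro add_left_mono mult_right_mono) auto
        finally show ?thesis using d by (simp add: d_def mult_left_mono)
      qed
      also have "\<dots> = B * ((1 - d / 2) * rate j)" by (simp add: algebra_simps)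
      also have "\<dots> \<le> B * (((1 + real j) / (1 + real N + real j)) powr \<gamma> * rate j)"
        using j0[OF n(2)] B(3) by (intro mult_left_mono mult_right_mono) auto
      also have "((1 + real j) / (1 + real N + real j)) powr \<gamma> * rate j = rate n"
        unfolding n(1) by (subst powr_divide) (auto simp: powr_minus field_simps)
      finally show ?thesis .
    qed
  qed
  have "\<bar>ratio a n u x - ratio a n u y\<bar> \<le> B * rate n" if "pot a" "lip u" for a u n x y
    using main[OF that, of n x y] main[OF that, of n y x] by (simp add: abs_le_iff)
  then show thesis using B(3) by (rule that[rotated])
qed

end

text \<open>Fixes the three constants before any potential is chosen;
  \<open>uniform_decay_exists\<close> supplies them.\<close>

locale uniform_decay = paired_branches +
  fixes R C B :: real
  assumes R_ge_1: "R \<ge> 1" and C_nonneg: "C \<ge> 0" and B_pos: "B > 0"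
    and G_le: "pot a \<Longrightarrow> G a n x \<le> R * G a n y"
    and G_modulus: "pot a \<Longrightarrow> \<bar>G a n x - G a n y\<bar> \<le> C * \<omega>' (dist x y) * G a n x"
    and decay: "pot a \<Longrightarrow> lip u \<Longrightarrow> \<bar>ratio a n u x - ratio a n u y\<bar> \<le> B * rate n"

lemma (in paired_branches) uniform_decay_exists:
  "\<exists>R C B. uniform_decay T r K0 K1 K2 K3 K4 W H \<gamma> e \<omega> \<omega>' R C B"
proof -
  obtain R where R: "R \<ge> 1" "\<And>a n x y. pot a \<Longrightarrow> G a n x \<le> R * G a n y" using G_comparable by blast
  obtain C where C: "C \<ge> 0" "\<And>a n x y. pot a \<Longrightarrow> \<bar>G a n x - G a n y\<bar> \<le> C * \<omega>' (dist x y) * G a n x"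
    using G_lip by blast
  obtain B where B: "B > 0"
    "\<And>a u n x y. pot a \<Longrightarrow> lip u \<Longrightarrow> \<bar>ratio a n u x - ratio a n u y\<bar> \<le> B * rate n"
    using ratio_decay by blast
  have "uniform_decay T r K0 K1 K2 K3 K4 W H \<gamma> e \<omega> \<omega>' R C B"
    by unfold_locales (use R C B in auto)
  then show ?thesis by blast
qed

section \<open>Eigenfunctions and eigenmeasures\<close>

text \<open>Turns comparisons of \<open>n\<close>-th powers up to a constant factor into comparisons
  of eigenvalues.\<close>

lemma le_1_of_powers_bounded:
  fixes x :: real
  assumes "\<And>n. x ^ n \<le> C" shows "x \<le> 1"
proof (rule ccontr)
  assume "\<not> x \<le> 1"
  then obtain n where "C < x ^ n" using real_arch_pow[of x C] by auto
  with assms[of n] show False by simp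
qed

lemma continuous_modulus:
  fixes u :: "'a::metric_space \<Rightarrow> real"
  assumes lim: "\<And>\<epsilon>. \<epsilon> > 0 \<Longrightarrow> \<exists>\<eta>>0. \<forall>t. 0 \<le> t \<and> t \<le> 1 \<and> t < \<eta> \<longrightarrow> \<omega> t < \<epsilon>"
    and le: "\<And>x y :: 'a. dist x y \<le> 1"
    and u: "\<And>x y. \<bar>u x - u y\<bar> \<le> C * \<omega> (dist x y)" and C: "C \<ge> 0"
  shows "continuous_on UNIV u"
  unfolding continuous_on_iff
proof (intro ballI allI impI)
  fix x and \<epsilon> :: real assume \<epsilon>: "\<epsilon> > 0"
  then obtain \<eta> where \<eta>: "\<eta> > 0" "\<And>t. 0 \<le> t \<Longrightarrow> t \<le> 1 \<Longrightarrow> t < \<eta> \<Longrightarrow> \<omega> t < \<epsilon> / (C + 1)"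
    using lim[of "\<epsilon> / (C + 1)"] C by auto
  show "\<exists>d>0. \<forall>x'\<in>UNIV. dist x' x < d \<longrightarrow> dist (u x') (u x) < \<epsilon>"
  proof (intro exI[of _ \<eta>] conjI ballI impI)
    fix y assume "dist y x < \<eta>"
    then have w: "\<omega> (dist y x) < \<epsilon> / (C + 1)" by (intro \<eta> le) auto
    have "\<bar>u y - u x\<bar> \<le> C * \<omega> (dist y x)" by (rule u)
    also have "\<dots> \<le> C * (\<epsilon> / (C + 1))" using w C by (intro mult_left_mono) auto
    also have "\<dots> < \<epsilon>" using \<epsilon> C by (simp add: field_simps)
    finally show "dist (u y) (u x) < \<epsilon>" by (simp add: dist_real_def)
  qed (rule \<eta>)
qed

text \<open>For \<open>t\<close> up to \<open>1 / 2\<close> the exponential is linearised with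
  \<open>exp (2 * t) \<le> 3\<close>; beyond that the trivial bound \<open>c\<close> is already
  smaller than the right side. The result is linear in \<open>t\<close> with no smallness
  condition.\<close>

lemma exp_gap_le:
  fixes s t c :: real
  assumes "x \<le> exp (2 * t) * y" "0 \<le> y" "y \<le> c" "x \<le> c" "0 \<le> t"
  shows "x - y \<le> 6 * t * c"
proof (cases "t \<le> 1 / 2")
  case True
  have "exp (2 * t) - 1 \<le> (2 * t) * exp (2 * t)"
    using abs_exp_minus_one_le[of "2 * t"] assms(5) by simp
  also have "\<dots> \<le> (2 * t) * 3"
    using True assms(5) exp_le by (intro mult_left_mono) (auto intro: order_trans[OF _ exp_le])
  finally have "(exp (2 * t) - 1) * y \<le> (6 * t) * c"
    using assms by (intro mult_mono) auto
  then show ?thesis using assms(1) by (simp add: algebra_simps)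
next
  case False
  then have "1 * c \<le> 6 * t * c" using assms by (intro mult_right_mono) auto
  then show ?thesis using assms by simp
qed

text \<open>For \<open>\<epsilon> = 0\<close> let \<open>n\<close> tend to infinity; this agrees
  with the convention that \<open>0 powr\<close> anything is 0.\<close>

lemma optimise_rate:
  fixes \<gamma> C X \<epsilon> :: real
  assumes \<gamma>: "\<gamma> > 0" and \<epsilon>: "\<epsilon> \<ge> 0" and C: "C \<ge> 0"
    and X: "\<And>n. X \<le> C * ((1 + real n) powr - \<gamma> + real n * \<epsilon>)"
  shows "X \<le> 2 * C * \<epsilon> powr (\<gamma> / (\<gamma> + 1))"
proof (cases "\<epsilon> = 0")
  case True
  have "(\<lambda>n::nat. C * (1 + real n) powr - \<gamma>) \<longlonglongrightarrow> 0" using \<gamma> by real_asymp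
  then have "X \<le> 0" by (rule LIMSEQ_le_const) (use X True in auto)
  then show ?thesis using True by simp
next
  case False
  with \<epsilon> have \<epsilon>: "\<epsilon> > 0" by simp
  \<comment> \<open>At \<open>n = s\<close> the terms \<open>n powr - \<gamma>\<close> and
    \<open>n * \<epsilon>\<close> coincide. Rounding down is harmless: one estimate uses
    \<open>s \<le> 1 + n\<close>, the other \<open>n \<le> s\<close>.\<close>
  define s where "s = \<epsilon> powr (- 1 / (\<gamma> + 1))"
  define n where "n = nat \<lfloor>s\<rfloor>"
  have s: "s > 0" using \<epsilon> by (simp add: s_def)
  have n: "real n \<le> s" "s \<le> 1 + real n" using s unfolding n_def by linarith+
  have "(1 + real n) powr - \<gamma> \<le> s powr - \<gamma>" using n s \<gamma> by (intro powr_mono2') auto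
  also have "s powr - \<gamma> = \<epsilon> powr (\<gamma> / (\<gamma> + 1))" by (simp add: s_def powr_powr)
  finally have 1: "(1 + real n) powr - \<gamma> \<le> \<epsilon> powr (\<gamma> / (\<gamma> + 1))" .
  have "real n * \<epsilon> \<le> s * \<epsilon> powr 1" using n \<epsilon> by simp
  also have "\<dots> = \<epsilon> powr (- 1 / (\<gamma> + 1) + 1)" unfolding s_def by (rule powr_add[symmetric])
  also have "- 1 / (\<gamma> + 1) + 1 = \<gamma> / (\<gamma> + 1)" using \<gamma> by (simp add: field_simps)
  finally have "(1 + real n) powr - \<gamma> + real n * \<epsilon> \<le> 2 * \<epsilon> powr (\<gamma> / (\<gamma> + 1))" using 1 by simp
  from mult_left_mono[OF this C] X[of n] show ?thesis by simp
qed

context paired_branches begin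

lemma rate_lim: "rate \<longlonglongrightarrow> 0"
  using \<gamma>_pos by real_asymp

lemma pot_continuous: "pot a \<Longrightarrow> continuous_on UNIV a"
  by (rule continuous_modulus[OF \<omega>_lim dist_le_1 _ H_nonneg]) (auto simp: pot_def)

lemma lip_continuous: "\<lbrakk>\<And>x y. \<bar>u x - u y\<bar> \<le> C * \<omega>' (dist x y); C \<ge> 0\<rbrakk> \<Longrightarrow> continuous_on UNIV u"
  for u :: "'a \<Rightarrow> real"
  by (rule continuous_modulus[OF \<omega>'_lim dist_le_1])

lemma \<omega>'_triangle: "\<omega>' (dist x z) \<le> \<omega>' (dist x y) + \<omega>' (dist y z)" for x y z :: 'a
  by (rule \<omega>'_subadd) (auto simp: dist_le_1 dist_triangle)

lemma \<omega>'_dist_continuous: "continuous_on UNIV (\<lambda>p :: 'a \<times> 'a. \<omega>' (dist (fst p) (snd p)))"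
  unfolding continuous_on_iff
proof (intro ballI allI impI)
  fix p :: "'a \<times> 'a" and \<epsilon> :: real assume "\<epsilon> > 0"
  then obtain \<eta> where \<eta>: "\<eta> > 0" "\<And>t. 0 \<le> t \<Longrightarrow> t \<le> 1 \<Longrightarrow> t < \<eta> \<Longrightarrow> \<omega>' t < \<epsilon> / 2"
    using \<omega>'_lim[of "\<epsilon> / 2"] by auto
  show "\<exists>d>0. \<forall>q\<in>UNIV. dist q p < d \<longrightarrow> dist (\<omega>' (dist (fst q) (snd q))) (\<omega>' (dist (fst p) (snd p))) <
    \<epsilon>"
  proof (intro exI[of _ \<eta>] conjI ballI impI)
    fix q assume q: "dist q p < \<eta>"
    have 1: "\<omega>' (dist (fst q) (fst p)) < \<epsilon> / 2" "\<omega>' (dist (snd q) (snd p)) < \<epsilon> / 2"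
      using q dist_fst_le[of q p] dist_snd_le[of q p]
      by (intro \<eta>(2) dist_le_1 zero_le_dist; linarith)+
    have "\<omega>' (dist (fst q) (snd q)) \<le> \<omega>' (dist (fst q) (fst p)) + (\<omega>' (dist (fst p) (snd p)) +
      \<omega>' (dist (snd p) (snd q)))"
      by (rule order_trans[OF \<omega>'_triangle add_left_mono[OF \<omega>'_triangle]])
    moreover have "\<omega>' (dist (fst p) (snd p)) \<le> \<omega>' (dist (fst p) (fst q)) +
      (\<omega>' (dist (fst q) (snd q)) + \<omega>' (dist (snd q) (snd p)))"
      by (rule order_trans[OF \<omega>'_triangle add_left_mono[OF \<omega>'_triangle]])
    ultimately show "dist (\<omega>' (dist (fst q) (snd q))) (\<omega>' (dist (fst p) (snd p))) < \<epsilon>"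
      using 1 by (simp add: dist_real_def dist_commute abs_less_iff)
  qed (rule \<eta>)
qed

text \<open>A merely continuous \<open>u\<close> has no modulus at hand, so uniform continuity is
  combined with the bound \<open>K0 * dist y x\<close> on paired preimages and the bound on their
  number.\<close>

lemma ruelle_op_continuous:
  assumes a: "continuous_on UNIV a" and u: "continuous_on UNIV u"
  shows "continuous_on UNIV (ruelle_op T a u)"
  unfolding continuous_on_iff
proof (intro ballI allI impI)
  fix x and \<epsilon> :: real assume \<epsilon>: "\<epsilon> > 0"
  obtain D where D: "D \<ge> 1" "\<And>x. real (card {u. (T ^^ 1) u = x}) \<le> D" using card_fibre_bounded
    by blast
  define v where "v z = exp (a z) * u z" for z
  have "uniformly_continuous_on UNIV v"
    unfolding v_def by (intro compact_uniformly_continuous compact_space continuous_intros a u)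
  moreover have "\<epsilon> / (2 * D) > 0" using \<epsilon> D(1) by simp
  ultimately obtain \<eta> where \<eta>: "\<eta> > 0" "\<And>z z'. dist z' z < \<eta> \<Longrightarrow> dist (v z') (v z) < \<epsilon> / (2 * D)"
    unfolding uniformly_continuous_on_def by (metis UNIV_I)
  define d where "d = min r (\<eta> / (K0 + 1))"
  show "\<exists>d>0. \<forall>x'\<in>UNIV. dist x' x < d \<longrightarrow> dist (ruelle_op T a u x') (ruelle_op T a u x) < \<epsilon>"
  proof (intro exI[of _ d] conjI ballI impI)
    show "d > 0" using r_pos \<eta>(1) K_nonneg by (simp add: d_def)
    fix y assume y: "dist y x < d"
    then have "dist y x < r" by (simp add: d_def)
    from pairing[OF this, of 1] obtain \<phi> where bij: "bij_betw \<phi> {u. (T ^^ 1) u = y} {u. (T ^^ 1) u =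
      x}"
      and \<phi>: "\<And>z. (T ^^ 1) z = y \<Longrightarrow> dist z (\<phi> z) \<le> K0 * dist y x" by blast
    have "ruelle_op T a u x = (\<Sum>z | (T ^^ 1) z = y. v (\<phi> z))"
      using sum.reindex_bij_betw[OF bij, of v] by (simp add: ruelle_op_def v_def)
    then have "dist (ruelle_op T a u y) (ruelle_op T a u x) = \<bar>\<Sum>z | (T ^^ 1) z = y. v z - v (\<phi> z)\<bar>"
      by (simp add: ruelle_op_def v_def dist_real_def sum_subtractf)
    also have "\<dots> \<le> (\<Sum>z | (T ^^ 1) z = y. \<bar>v z - v (\<phi> z)\<bar>)" by (rule sum_abs)
    also have "\<dots> \<le> (\<Sum>z | (T ^^ 1) z = y. \<epsilon> / (2 * D))"
    proof (rule sum_mono)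
      fix z assume "z \<in> {z. (T ^^ 1) z = y}"
      then have "dist z (\<phi> z) \<le> K0 * dist y x" using \<phi> by blast
      also have "\<dots> \<le> K0 * (\<eta> / (K0 + 1))" using y K_nonneg
        by (intro mult_left_mono) (auto simp: d_def)
      also have "\<dots> < \<eta>" using \<eta>(1) K_nonneg by (simp add: field_simps)
      finally show "\<bar>v z - v (\<phi> z)\<bar> \<le> \<epsilon> / (2 * D)" using \<eta>(2) by (fastforce simp: dist_real_def)
    qed
    also have "\<dots> = real (card {z. (T ^^ 1) z = y}) * (\<epsilon> / (2 * D))" by simp
    also have "\<dots> \<le> D * (\<epsilon> / (2 * D))" using D(2)[of y] D(1) \<epsilon> by (intro mult_right_mono) auto
    also have "\<dots> < \<epsilon>" using D(1) \<epsilon> by simp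
    finally show "dist (ruelle_op T a u y) (ruelle_op T a u x) < \<epsilon>" .
  qed
qed

lemma iter_continuous:
  "continuous_on UNIV a \<Longrightarrow> continuous_on UNIV u \<Longrightarrow> continuous_on UNIV (iter a n u)"
  by (induction n) (auto simp: iter_0 iter_Suc ruelle_op_continuous)

section \<open>Comparison of eigenfunctions and existence of eigenmeasures\<close>

lemma iter_eigen:
  assumes "eigenfunction T a h l" shows "iter a n h x = l ^ n * h x"
proof (induction n arbitrary: x)
  case (Suc n)
  have "iter a n h = (\<lambda>x. l ^ n * h x)" using Suc by blast
  then have "iter a (Suc n) h x = l ^ n * iter a 1 h x"
    unfolding iter_Suc iter_1[symmetric] by (simp only: iter_scale)
  then show ?case using assms by (simp only: iter_1) (simp add: eigenfunction_def)
qed (simp add: iter_0)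

text \<open>\<open>c\<close> is the minimum of \<open>h' / h\<close>. The touching point is the
  starting point of the uniqueness proof.\<close>

lemma eigenfunction_ge:
  assumes h: "eigenfunction T a h l" and h': "eigenfunction T a h' l'"
  obtains c x where "c > 0" "\<And>x. c * h x \<le> h' x" "h' x = c * h x"
proof -
  have pos: "h x > 0" "h' x > 0" for x using h h' by (auto simp: eigenfunction_def)
  have "continuous_on UNIV (\<lambda>x. h' x / h x)"
    using h h'
      by (intro continuous_on_divide) (auto simp: eigenfunction_def less_imp_neq[THEN not_sym])
  then obtain x0 where x0: "\<And>x. h' x0 / h x0 \<le> h' x / h x"
    using continuous_attains_inf[OF compact_space] by blast
  show thesis
  proof (rule that[of "h' x0 / h x0" x0])
    show "h' x0 / h x0 * h x \<le> h' x" for x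
      using x0[of x] pos(1)[of x] by (simp add: pos_le_divide_eq)
  qed (use pos[of x0] in auto)
qed

text \<open>Iterating \<open>c * h \<le> h'\<close> bounds the powers of
  \<open>l / l'\<close>.\<close>

lemma eigenvalue_le:
  assumes h: "eigenfunction T a h l" and h': "eigenfunction T a h' l'"
  shows "l \<le> l'"
proof -
  obtain c where c: "c > 0" "\<And>x. c * h x \<le> h' x" using eigenfunction_ge[OF h h'] by metis
  have l: "l > 0" "l' > 0" and pos: "h x > 0" for x using h h' by (auto simp: eigenfunction_def)
  fix x
  have "(l / l') ^ n \<le> h' x / (c * h x)" for n
  proof -
    have "c * (l ^ n * h x) \<le> l' ^ n * h' x"
      using iter_mono[of "\<lambda>x. c * h x" h' a n x] c(2)
      by (simp add: iter_scale iter_eigen[OF h] iter_eigen[OF h'])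
    then show ?thesis using c(1) l pos[of x] by (simp add: field_simps power_divide)
  qed
  then have "l / l' \<le> 1" by (rule le_1_of_powers_bounded)
  then show ?thesis using l by simp
qed

text \<open>The nonnegative eigenfunction \<open>h' - c h\<close> vanishes at a point, hence on all its preimages,
  which are dense.\<close>

lemma eigenfunction_unique:
  assumes h: "eigenfunction T a h l" and h': "eigenfunction T a h' l'"
  shows "\<exists>c>0. \<forall>x. h' x = c * h x"
proof -
  have l: "l' = l" using eigenvalue_le[OF h h'] eigenvalue_le[OF h' h] by simp
  obtain c x0 where c: "c > 0" "\<And>x. c * h x \<le> h' x" "h' x0 = c * h x0"
    using eigenfunction_ge[OF h h'] by metis
  define v where "v x = h' x - c * h x" for x
  have v_cont: "continuous_on UNIV v"
    unfolding v_def using h h' by (intro continuous_intros) (auto simp: eigenfunction_def)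
  have v_nonneg: "0 \<le> v x" for x using c(2) by (simp add: v_def)
  have v_pre: "v z = 0" if z: "(T ^^ n) z = x0" for z n
  proof -
    have "exp (birkhoff T a n z) * v z \<le> iter a n v x0"
      by (rule iter_ge_term[OF v_nonneg z])
    also have "iter a n v x0 = l ^ n * v x0"
      unfolding v_def
        by (simp add: iter_diff iter_scale iter_eigen[OF h] iter_eigen[OF h'] l algebra_simps)
    also have "\<dots> = 0" using c(3) by (simp add: v_def)
    finally show ?thesis using v_nonneg[of z] by (simp add: mult_le_0_iff)
  qed
  have "v x = 0" for x
  proof (rule ccontr)
    assume "v x \<noteq> 0"
    then have "v x > 0" using v_nonneg[of x] by simp
    then obtain d where d: "d > 0" "\<And>y. dist y x < d \<Longrightarrow> dist (v y) (v x) < v x"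
      using v_cont unfolding continuous_on_iff by blast
    obtain N where "\<And>x z. \<exists>u. (T ^^ N) u = x \<and> dist u z < d" using exact[OF d(1)] by blast
    then obtain u where "(T ^^ N) u = x0" "dist u x < d" by blast
    with d(2)[of u] v_pre[of N u] show False by (simp add: dist_real_def)
  qed
  then show ?thesis using c(1) by (auto simp: v_def)
qed

text \<open>The cone consists of the functions \<open>u - L u / l\<close>. At a maximum point of
  \<open>u / h\<close>, comparing \<open>u\<close> with the corresponding multiple of
  \<open>h\<close> shows that such a function is nonnegative there.\<close>

lemma eigenmeasure_exists:
  assumes a: "continuous_on UNIV a" and h: "eigenfunction T a h l"
  obtains m where "eigenmeasure T a m l"
proof -
  have l: "l > 0" and h_pos: "\<And>x. h x > 0" and h_cont: "continuous_on UNIV h"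
    using h by (auto simp: eigenfunction_def)
  define k where "k u = (\<lambda>x. u x - (1 / l) * iter a 1 u x)" for u
  define K where "K = {k u | u. continuous_on UNIV u}"
  have k_cont: "continuous_on UNIV (k u)" if "continuous_on UNIV u" for u
    unfolding k_def by (intro continuous_intros iter_continuous a that)
  have "\<exists>x. 0 \<le> k u x" if u: "continuous_on UNIV u" for u
  proof -
    have "continuous_on UNIV (\<lambda>x. u x / h x)"
      using h_pos by (intro continuous_on_divide u h_cont) (auto simp: less_imp_neq[THEN not_sym])
    then obtain x0 where x0: "\<And>x. u x / h x \<le> u x0 / h x0"
      using continuous_attains_sup[OF compact_space] by blast
    have "u x \<le> (u x0 / h x0) * h x" for x
      using x0[of x] h_pos[of x] by (simp add: pos_divide_le_eq)
    then have "iter a 1 u x0 \<le> iter a 1 (\<lambda>x. (u x0 / h x0) * h x) x0" by (rule iter_mono)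
    also have "\<dots> = u x0 * l"
      unfolding iter_scale iter_eigen[OF h] using h_pos[of x0] by simp
    finally show ?thesis using l by (intro exI[of _ x0]) (simp add: k_def field_simps)
  qed
  note nonneg = this
  obtain m where m: "borel_prob m" "\<And>f. f \<in> K \<Longrightarrow> 0 \<le> (LINT x|m. f x)"
  proof (rule exists_measure_nonneg_on_cone[OF compact_space, of K])
    have "k (\<lambda>x. 0) = (\<lambda>x. 0)" using iter_scale[of a 1 0 "\<lambda>x. 0"] by (simp add: k_def fun_eq_iff)
    then show "(\<lambda>x. 0) \<in> K" unfolding K_def by (intro CollectI exI[of _ "\<lambda>x. 0"]) simp
  next
    fix f f' assume "f \<in> K" "f' \<in> K"
    then obtain u u' where *: "f = k u" "f' = k u'" "continuous_on UNIV u" "continuous_on UNIV u'"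
      by (auto simp: K_def)
    have "(\<lambda>x. f x + f' x) = k (\<lambda>x. u x + u' x)"
      unfolding *(1,2) k_def iter_plus by (simp add: algebra_simps)
    then show "(\<lambda>x. f x + f' x) \<in> K" unfolding K_def using *(3,4)
      by (auto intro!: exI continuous_intros)
  next
    fix c f assume "(c::real) > 0" "f \<in> K"
    then obtain u where *: "f = k u" "continuous_on UNIV u" by (auto simp: K_def)
    have "(\<lambda>x. c * f x) = k (\<lambda>x. c * u x)"
      unfolding *(1) k_def iter_scale by (simp add: algebra_simps)
    then show "(\<lambda>x. c * f x) \<in> K" unfolding K_def using *(2) by (auto intro!: exI continuous_intros)
  qed (use nonneg k_cont in \<open>auto simp: K_def\<close>)
  have "(LINT x|m. ruelle_op T a f x) = l * (LINT x|m. f x)" if f: "continuous_on UNIV f" for f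
  proof -
    note int = integrable_continuous_compact[OF compact_space m(1)]
    have int_k: "(LINT x|m. k f x) = (LINT x|m. f x) - (1 / l) * (LINT x|m. ruelle_op T a f x)"
      if "continuous_on UNIV f" for f
      unfolding k_def iter_1 using int[OF that] int[OF ruelle_op_continuous[OF a that]] by simp
    have "0 \<le> (LINT x|m. k f x)" using m(2)[of "k f"] f by (auto simp: K_def)
    \<comment> \<open>The cone is a linear space, so nonnegativity for \<open>f\<close> and for its
      negative gives an equation.\<close>
    moreover have "0 \<le> (LINT x|m. k (\<lambda>x. (-1) * f x) x)"
      using m(2)[of "k (\<lambda>x. (-1) * f x)"] f by (auto simp: K_def intro!: exI continuous_intros)
    moreover have "k (\<lambda>x. (-1) * f x) = (\<lambda>x. - k f x)"
      unfolding k_def iter_scale by (simp add: algebra_simps)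
    ultimately have "(LINT x|m. k f x) = 0" by simp
    then show ?thesis using int_k[OF f] l by (simp add: field_simps)
  qed
  then have "eigenmeasure T a m l" using l m(1) by (simp add: eigenmeasure_def)
  then show thesis by (rule that)
qed

lemma integral_iter:
  assumes a: "continuous_on UNIV a" and m: "eigenmeasure T a m l" and u: "continuous_on UNIV u"
  shows "(LINT x|m. iter a n u x) = l ^ n * (LINT x|m. u x)"
proof (induction n)
  case (Suc n)
  have "(LINT x|m. iter a (Suc n) u x) = l * (LINT x|m. iter a n u x)"
    unfolding iter_Suc using m iter_continuous[OF a u, of n] by (simp add: eigenmeasure_def)
  then show ?case using Suc by simp
qed (simp add: iter_0)

text \<open>Test the eigenmeasure on \<open>h\<close>, whose integral is positive because
  \<open>h\<close> is bounded away from 0.\<close>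

lemma eigenvalues_agree:
  assumes h: "eigenfunction T a h l" and m: "eigenmeasure T a m l'"
  shows "l = l'"
proof -
  interpret prob_space m using m by (simp add: eigenmeasure_def borel_prob_def)
  have h_cont: "continuous_on UNIV h" using h by (simp add: eigenfunction_def)
  have "(LINT x|m. ruelle_op T a h x) = l' * (LINT x|m. h x)"
    using m h_cont by (simp add: eigenmeasure_def)
  moreover have "(LINT x|m. ruelle_op T a h x) = l * (LINT x|m. h x)"
    using h by (simp add: eigenfunction_def)
  moreover have "(LINT x|m. h x) > 0"
  proof -
    obtain x0 where x0: "\<And>x. h x0 \<le> h x" using continuous_attains_inf[OF compact_space _ h_cont]
      by blast
    have "h x0 = (LINT x|m. h x0)" by (simp add: prob_space)
    also have "\<dots> \<le> (LINT x|m. h x)"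
      using m by (intro integral_mono integrable_continuous_compact[OF compact_space] h_cont x0
        continuous_on_const)
        (auto simp: eigenmeasure_def)
    finally show ?thesis using h by (smt (verit) eigenfunction_def)
  qed
  ultimately show ?thesis by simp
qed

end

context uniform_decay begin

text \<open>Let \<open>g k\<close> be \<open>G a k\<close> normalised at \<open>x0\<close>. The
  functions \<open>g m\<close> have a common modulus, so decay makes the time-\<open>k\<close>
  quotient \<open>q\<close> of \<open>g m\<close> nearly constant, uniformly in \<open>m\<close>.
  Since \<open>g (k + m) / g k\<close> equals \<open>q / q x0\<close>, the sequence is Cauchy; the
  Harnack and modulus bounds pass to the limit.\<close>

lemma eigenfunction_exists:
  assumes a: "pot a"
  shows "\<exists>h l. eigenfunction T a h l \<and> (\<forall>x y. h x \<le> R * h y) \<and>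
    (\<forall>x y. \<bar>h x - h y\<bar> \<le> C * \<omega>' (dist x y) * h x)"
proof -
  fix x0 :: 'a
  define g where "g k x = G a k x / G a k x0" for k x
  have g_pos: "0 < g k x" for k x by (simp add: g_def G_pos)
  have g_R: "g k x \<le> R * g k y" for k x y
    using G_le[OF a, of k x y] G_pos[of a k x0] by (simp add: g_def divide_right_mono)
  have g_x0: "g k x0 = 1" for k by (simp add: g_def)
  have g_lip: "\<bar>g k x - g k y\<bar> \<le> C * \<omega>' (dist x y) * g k x" for k x y
    using G_modulus[OF a, of k x y] G_pos[of a k x0]
    by (simp add: g_def abs_mult divide_right_mono flip: diff_divide_distrib)
  have iter_g: "iter a k (g m) x = (1 / G a m x0) * G a (k + m) x" for k m x
  proof -
    have g: "g m = (\<lambda>x. (1 / G a m x0) * G a m x)" by (simp add: g_def fun_eq_iff)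
    show ?thesis unfolding g iter_scale iter_add ..
  qed
  \<comment> \<open>\<open>C * R\<close> is a modulus constant for every \<open>g m\<close>; the 1
    keeps the divisor positive.\<close>
  define D where "D = C * R + 1"
  have D: "D > 0" using C_nonneg R_ge_1 by (simp add: D_def add_nonneg_pos)
  have cauchy: "\<bar>g (k + m) x - g k x\<bar> \<le> R * (D * (B * rate k) * R)" for k m x
  proof -
    define q where "q x = iter a k (g m) x / G a k x" for x
    have "lip (\<lambda>x. (1 / D) * g m x)"
      unfolding lip_def
    proof (intro allI)
      fix x y
      have "\<bar>g m x - g m y\<bar> \<le> C * \<omega>' (dist x y) * g m x" by (rule g_lip)
      also have "\<dots> \<le> C * \<omega>' (dist x y) * R"
        using g_R[of m x x0] C_nonneg by (intro mult_left_mono) (auto simp: g_x0)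
      also have "\<dots> \<le> D * \<omega>' (dist x y)" by (simp add: D_def algebra_simps)
      finally show "\<bar>1 / D * g m x - 1 / D * g m y\<bar> \<le> \<omega>' (dist x y)"
        using D by (simp add: field_simps flip: diff_divide_distrib)
    qed
    then have "\<bar>(1 / D) * q x - (1 / D) * q x0\<bar> \<le> B * rate k"
      using decay[OF a, of "\<lambda>x. (1 / D) * g m x" k x x0] unfolding ratio_def iter_scale q_def by simp
    then have q_diff: "\<bar>q x - q x0\<bar> \<le> D * (B * rate k)"
      using D by (simp add: field_simps flip: diff_divide_distrib)
    have "1 / R \<le> g m x" for x using g_R[of m x0 x] R_ge_1 by (simp add: g_x0 field_simps)
    then have "iter a k (\<lambda>x. 1 / R * 1) x0 \<le> iter a k (g m) x0" by (intro iter_mono) simp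
    then have q_x0: "1 / R \<le> q x0"
      unfolding iter_scale q_def using G_pos[of a k x0] by (simp add: field_simps)
    then have q_x0_pos: "q x0 > 0" using R_ge_1 by (smt (verit) divide_pos_pos)
    have q_eq: "q x = G a (k + m) x / (G a m x0 * G a k x)" for x
      by (simp add: q_def iter_g)
    \<comment> \<open>The normaliser \<open>G a m x0\<close> cancels, so this holds exactly.\<close>
    have "g (k + m) x = g k x * q x / q x0"
      unfolding q_eq by (simp add: g_def)
    then have "g (k + m) x - g k x = g k x * ((q x - q x0) / q x0)"
      using q_x0_pos by (simp add: field_simps)
    then have "\<bar>g (k + m) x - g k x\<bar> = g k x * (\<bar>q x - q x0\<bar> / q x0)"
      using g_pos[of k x] q_x0_pos by (simp add: abs_mult)
    also have "\<dots> \<le> R * (D * (B * rate k) * R)"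
    proof (rule mult_mono)
      show "g k x \<le> R" using g_R[of k x x0] by (simp add: g_x0)
      have "\<bar>q x - q x0\<bar> / q x0 \<le> D * (B * rate k) / (1 / R)"
        using q_diff q_x0 R_ge_1 by (intro frac_le) auto
      then show "\<bar>q x - q x0\<bar> / q x0 \<le> D * (B * rate k) * R" by simp
    qed (use R_ge_1 q_x0_pos in auto)
    finally show ?thesis .
  qed
  have "Cauchy (\<lambda>k. g k x)" for x
  proof (rule metric_CauchyI)
    fix \<epsilon> :: real assume \<epsilon>: "\<epsilon> > 0"
    have "(\<lambda>k. R * (D * (B * rate k) * R)) \<longlonglongrightarrow> R * (D * (B * 0) * R)"
      by (intro tendsto_intros rate_lim)
    then obtain N where N: "R * (D * (B * rate N) * R) < \<epsilon> / 2"
      using order_tendstoD(2)[of "\<lambda>k. R * (D * (B * rate k) * R)" 0 sequentially "\<epsilon> / 2"] \<epsilon>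
      by (auto simp: eventually_sequentially)
    have "\<bar>g n x - g N x\<bar> < \<epsilon> / 2" if "n \<ge> N" for n
      using cauchy[of N "n - N" x] N that by simp
    then have "dist (g m x) (g n x) < \<epsilon>" if "m \<ge> N" "n \<ge> N" for m n
      using that by (smt (verit) dist_real_def field_sum_of_halves)
    then show "\<exists>N. \<forall>m\<ge>N. \<forall>n\<ge>N. dist (g m x) (g n x) < \<epsilon>" by blast
  qed
  then have "\<exists>y. (\<lambda>k. g k x) \<longlonglongrightarrow> y" for x by (simp add: Cauchy_convergent_iff convergent_def)
  then obtain h where h: "\<And>x. (\<lambda>k. g k x) \<longlonglongrightarrow> h x" by metis
  have h_R: "h x \<le> R * h y" for x y
    by (rule LIMSEQ_le[OF h tendsto_mult_left[OF h]]) (use g_R in blast)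
  have h_x0: "h x0 = 1" using h[of x0] by (simp add: g_x0 LIMSEQ_const_iff)
  have h_pos: "h x > 0" for x using h_R[of x0 x] R_ge_1
    by (simp add: h_x0) (smt (verit) mult_nonneg_nonpos)
  have h_lip: "\<bar>h x - h y\<bar> \<le> C * \<omega>' (dist x y) * h x" for x y
    by (rule LIMSEQ_le[OF tendsto_rabs[OF tendsto_diff[OF h h]] tendsto_mult_left[OF h]])
       (use g_lip in blast)
  have h_cont: "continuous_on UNIV h"
  proof (rule lip_continuous)
    fix x y
    have "C * \<omega>' (dist x y) * h x \<le> C * \<omega>' (dist x y) * R"
      using h_R[of x x0] C_nonneg by (intro mult_left_mono) (auto simp: h_x0)
    with h_lip[of x y] show "\<bar>h x - h y\<bar> \<le> (C * R) * \<omega>' (dist x y)" by (simp add: algebra_simps)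
  qed (use C_nonneg R_ge_1 in simp)
  have op_lim: "(\<lambda>k. ruelle_op T a (g k) x) \<longlonglongrightarrow> ruelle_op T a h x" for x
    unfolding ruelle_op_def by (intro tendsto_intros h)
  have op_g: "ruelle_op T a (g k) x = g (Suc k) x * (G a (Suc k) x0 / G a k x0)" for k x
    using iter_g[of 1 k x] unfolding iter_1 plus_1_eq_Suc by (simp add: g_def)
  \<comment> \<open>As \<open>h x0 = 1\<close>, no other eigenvalue is possible; it is also the
    limit of the growth factors of \<open>G a k x0\<close>.\<close>
  define l where "l = ruelle_op T a h x0"
  have l_lim: "(\<lambda>k. G a (Suc k) x0 / G a k x0) \<longlonglongrightarrow> l"
    using op_lim[of x0] by (simp add: op_g g_x0 l_def)
  have "ruelle_op T a h x = l * h x" for x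
  proof -
    have "(\<lambda>k. ruelle_op T a (g k) x) \<longlonglongrightarrow> h x * l"
      unfolding op_g by (intro tendsto_mult l_lim LIMSEQ_Suc h)
    then show ?thesis using LIMSEQ_unique[OF op_lim] by (simp add: mult.commute)
  qed
  moreover have "l > 0"
    unfolding l_def using iter_pos[of h a 1 x0] h_pos by (simp add: iter_1 del: One_nat_def)
  ultimately have "eigenfunction T a h l" using h_cont h_pos by (simp add: eigenfunction_def)
  then show ?thesis using h_R h_lip by blast
qed

text \<open>Any eigenfunction is a positive multiple of the constructed one, and both bounds are
  homogeneous.\<close>

lemma eigenfunction_le:
  assumes a: "pot a" and h: "eigenfunction T a h l"
  shows "h x \<le> R * h y" and "\<bar>h x - h y\<bar> \<le> C * \<omega>' (dist x y) * h x"
proof -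
  obtain h0 l0 where h0: "eigenfunction T a h0 l0" "\<And>x y. h0 x \<le> R * h0 y"
    "\<And>x y. \<bar>h0 x - h0 y\<bar> \<le> C * \<omega>' (dist x y) * h0 x"
    using eigenfunction_exists[OF a] by blast
  obtain c where c: "c > 0" "\<And>x. h x = c * h0 x" using eigenfunction_unique[OF h0(1) h] by blast
  have "c * h0 x \<le> c * (R * h0 y)" "c * \<bar>h0 x - h0 y\<bar> \<le> c * (C * \<omega>' (dist x y) * h0 x)"
    by (intro mult_left_mono h0(2,3) less_imp_le[OF c(1)])+
  moreover have "\<bar>c * h0 x - c * h0 y\<bar> = c * \<bar>h0 x - h0 y\<bar>"
    using c(1) by (simp add: abs_mult flip: right_diff_distrib)
  ultimately show "h x \<le> R * h y" "\<bar>h x - h y\<bar> \<le> C * \<omega>' (dist x y) * h x"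
    unfolding c(2) by (simp_all add: mult_ac)
qed

end

section \<open>Uniqueness of the eigenmeasure and stability\<close>

context uniform_decay begin

text \<open>By decay \<open>iter a n u\<close> lies between the multiples
  \<open>ratio a n u x \<plusminus> B * rate n\<close> of \<open>G a n\<close>. Integrating against
  \<open>m\<close> turns both sides into multiples of \<open>l ^ n\<close>, which cancels.\<close>

lemma ratio_integral:
  assumes a: "pot a" and m: "eigenmeasure T a m l" and u: "lip u"
  shows "\<bar>(LINT z|m. u z) - ratio a n u x\<bar> \<le> B * rate n"
proof -
  interpret prob_space m using m by (simp add: eigenmeasure_def borel_prob_def)
  have l: "l > 0" and bm: "borel_prob m" using m by (auto simp: eigenmeasure_def)
  note int = integrable_continuous_compact[OF compact_space bm]
  have u_cont: "continuous_on UNIV u" by (rule lip_continuous[of u 1]) (use u in \<open>auto simp: lip_def\<close>)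
  have cont: "continuous_on UNIV (iter a n u)" "continuous_on UNIV (G a n)"
    by (intro iter_continuous pot_continuous a u_cont continuous_on_const)+
  have G_int: "(LINT z|m. c * G a n z) = c * l ^ n" for c
    using integral_iter[OF pot_continuous[OF a] m continuous_on_const, of n 1]
      by (simp add: prob_space)
  have u_int: "(LINT z|m. iter a n u z) = l ^ n * (LINT z|m. u z)"
    by (rule integral_iter[OF pot_continuous[OF a] m u_cont])
  have near: "(ratio a n u x - B * rate n) * G a n z \<le> iter a n u z"
    "iter a n u z \<le> (ratio a n u x + B * rate n) * G a n z" for z
    using decay[OF a u, of n x z] G_pos[of a n z] unfolding iter_eq_ratio[of a n u z]
    by (auto intro!: mult_right_mono simp: abs_le_iff)
  have "(LINT z|m. (ratio a n u x - B * rate n) * G a n z) \<le> (LINT z|m. iter a n u z)"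
    "(LINT z|m. iter a n u z) \<le> (LINT z|m. (ratio a n u x + B * rate n) * G a n z)"
    by (intro integral_mono int cont near continuous_on_mult continuous_on_const)+
  then have "l ^ n * (ratio a n u x - B * rate n) \<le> l ^ n * (LINT z|m. u z)"
    "l ^ n * (LINT z|m. u z) \<le> l ^ n * (ratio a n u x + B * rate n)"
    unfolding G_int u_int by (simp_all add: mult.commute)
  then show ?thesis using l by (simp add: abs_le_iff)
qed

text \<open>\<open>ratio_integral\<close> determines the integral of every \<open>lip\<close>
  function as a limit free of \<open>m\<close>. By \<open>\<omega>'_linear\<close> a Lipschitz
  function is \<open>lip\<close> after scaling, and these functions separate measures.\<close>

lemma eigenmeasure_unique:
  assumes a: "pot a" and m: "eigenmeasure T a m l" "eigenmeasure T a m' l'"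
  shows "m = m'"
proof (rule borel_prob_eqI)
  show "borel_prob m" "borel_prob m'" using m by (auto simp: eigenmeasure_def)
  fix f :: "'a \<Rightarrow> real" and Q assume f: "\<And>x y. \<bar>f x - f y\<bar> \<le> Q * dist x y"
  define D where "D = \<bar>Q\<bar> * K4 + 1"
  have D: "D > 0" using K_nonneg by (simp add: D_def add_nonneg_pos)
  define u where "u x = f x / D" for x
  have u: "lip u"
    unfolding lip_def
  proof (intro allI)
    fix x y
    have "\<bar>f x - f y\<bar> \<le> Q * dist x y" by (rule f)
    also have "\<dots> \<le> \<bar>Q\<bar> * dist x y" by (intro mult_right_mono) auto
    also have "\<dots> \<le> \<bar>Q\<bar> * (K4 * \<omega>' (dist x y))" by (intro mult_left_mono \<omega>'_linear dist_le_1) auto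
    also have "\<dots> \<le> D * \<omega>' (dist x y)" by (simp add: D_def algebra_simps)
    finally show "\<bar>u x - u y\<bar> \<le> \<omega>' (dist x y)"
      using D by (simp add: u_def field_simps flip: diff_divide_distrib)
  qed
  fix x0 :: 'a
  have "\<bar>(LINT z|m. u z) - (LINT z|m'. u z)\<bar> \<le> 2 * B * rate n" for n
    using ratio_integral[OF a m(1) u, of n x0] ratio_integral[OF a m(2) u, of n x0] by linarith
  moreover have "(\<lambda>n. 2 * B * rate n) \<longlonglongrightarrow> 2 * B * 0" by (intro tendsto_intros rate_lim)
  ultimately have "\<bar>(LINT z|m. u z) - (LINT z|m'. u z)\<bar> \<le> 2 * B * 0"
    by (intro LIMSEQ_le_const[where X = "\<lambda>n. 2 * B * rate n"]) auto
  then show "(LINT x|m. f x) = (LINT x|m'. f x)" using D by (simp add: u_def)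
qed

text \<open>\<open>l ^ n\<close> is the integral of \<open>G a n\<close>, whose values are
  comparable up to the factor \<open>R\<close>.\<close>

lemma eigenvalue_bounds:
  assumes a: "pot a" and m: "eigenmeasure T a m l"
  shows "l ^ n \<le> R * G a n x" and "G a n x \<le> R * l ^ n"
proof -
  interpret prob_space m using m by (simp add: eigenmeasure_def borel_prob_def)
  have bm: "borel_prob m" using m by (auto simp: eigenmeasure_def)
  note int = integrable_continuous_compact[OF compact_space bm]
  have cont: "continuous_on UNIV (G a n)"
    by (intro iter_continuous pot_continuous a continuous_on_const)
  have G_int: "(LINT z|m. c * G a n z) = c * l ^ n" for c
    using integral_iter[OF pot_continuous[OF a] m continuous_on_const, of n 1]
      by (simp add: prob_space)
  have "(LINT z|m. 1 * G a n z) \<le> (LINT z|m. R * G a n x)"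
    by (intro integral_mono int cont continuous_on_mult continuous_on_const) (simp add: G_le[OF a])
  moreover have "(LINT z|m. G a n x) \<le> (LINT z|m. R * G a n z)"
    by (intro integral_mono int cont continuous_on_mult continuous_on_const G_le[OF a])
  ultimately show "l ^ n \<le> R * G a n x" "G a n x \<le> R * l ^ n"
    unfolding G_int by (simp_all add: prob_space)
qed

text \<open>The \<open>n\<close>-th powers compare up to the factor \<open>R * R\<close>, which is
  lost on taking \<open>n\<close>-th roots.\<close>

lemma eigenvalue_ratio_le:
  assumes a: "pot a" "eigenmeasure T a ma la" and b: "pot b" "eigenmeasure T b mb lb"
    and \<epsilon>: "\<And>x. \<bar>a x - b x\<bar> \<le> \<epsilon>"
  shows "la \<le> exp \<epsilon> * lb"
proof -
  have l: "la > 0" "lb > 0" using a b by (auto simp: eigenmeasure_def)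
  fix x0 :: 'a
  have "(la / (exp \<epsilon> * lb)) ^ n \<le> R * R" for n
  proof -
    have "la ^ n \<le> R * G a n x0" by (rule eigenvalue_bounds[OF a])
    also have "\<dots> \<le> R * (exp (real n * \<epsilon>) * G b n x0)"
      using R_ge_1 \<epsilon> by (intro mult_left_mono iter_le_exp) auto
    also have "\<dots> \<le> R * (exp (real n * \<epsilon>) * (R * lb ^ n))"
      using R_ge_1 eigenvalue_bounds(2)[OF b, of n x0] by (intro mult_left_mono) auto
    also have "\<dots> = R * R * (exp \<epsilon> * lb) ^ n" by (simp add: power_mult_distrib exp_of_nat_mult)
    finally show ?thesis using l by (simp add: power_divide pos_divide_le_eq)
  qed
  then have "la / (exp \<epsilon> * lb) \<le> 1" by (rule le_1_of_powers_bounded)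
  then show ?thesis using l by (simp add: pos_divide_le_eq)
qed

text \<open>Adding \<open>c\<close> makes the function nonnegative with values up to
  \<open>2 * c\<close>. Numerator and denominator of its quotient then each change by a factor of at
  most \<open>exp (n * \<epsilon>)\<close>, and \<open>exp_gap_le\<close> applies.\<close>

lemma ratio_stable:
  assumes ab: "\<And>x. \<bar>a x - b x\<bar> \<le> \<epsilon>" and u: "\<And>x. \<bar>u x\<bar> \<le> c"
  shows "ratio a n u x - ratio b n u x \<le> 12 * c * (real n * \<epsilon>)"
proof -
  have \<epsilon>: "\<epsilon> \<ge> 0" using ab[of x] by simp
  define v where "v x = u x + c * 1" for x
  have v: "0 \<le> v x" "v x \<le> 2 * c" for x using u[of x] by (auto simp: v_def abs_le_iff)
  have v_ratio: "ratio a n v x = ratio a n u x + c" for a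
    unfolding ratio_def v_def iter_plus iter_scale by (simp add: add_divide_distrib)
  have bounds: "0 \<le> ratio a n v x" "ratio a n v x \<le> 2 * c" for a
    using ratio_ge[of 0 a 0 v n x] ratio_le[of a 0 v "2 * c" n x] v by simp_all
  have 1: "iter a n v x \<le> exp (real n * \<epsilon>) * iter b n v x" by (rule iter_le_exp[OF ab v(1)])
  have 2: "G b n x \<le> exp (real n * \<epsilon>) * G a n x"
    by (rule iter_le_exp) (use ab in \<open>auto simp: abs_minus_commute\<close>)
  have "ratio a n v x \<le> (exp (real n * \<epsilon>) * iter b n v x) / (G b n x / exp (real n * \<epsilon>))"
    unfolding ratio_def using 1 2 G_pos[of a n x] G_pos[of b n x] iter_nonneg[OF v(1)]
    by (intro frac_le) (auto simp: field_simps)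
  also have "\<dots> = exp (2 * (real n * \<epsilon>)) * ratio b n v x"
    by (simp add: ratio_def exp_add[symmetric] flip: mult.assoc)
  finally have "ratio a n v x - ratio b n v x \<le> 6 * (real n * \<epsilon>) * (2 * c)"
    using bounds \<epsilon> by (intro exp_gap_le) auto
  then show ?thesis by (simp add: v_ratio algebra_simps)
qed

text \<open>By duality only integrals of test functions matter. Both are replaced by quotients at
  the same point and time \<open>n\<close>, at cost \<open>B * rate n\<close> each; the two
  quotients differ by order \<open>n * \<epsilon>\<close>.\<close>

theorem eigenmeasure_stable:
  obtains Q where "Q \<ge> 0"
    "\<And>a b ma mb la lb \<epsilon>. pot a \<Longrightarrow> pot b \<Longrightarrow> eigenmeasure T a ma la \<Longrightarrow> eigenmeasure T b mb lb \<Longrightarrow>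
      (\<And>x. \<bar>a x - b x\<bar> \<le> \<epsilon>) \<Longrightarrow> wasserstein \<omega>' ma mb \<le> Q * \<epsilon> powr (\<gamma> / (\<gamma> + 1))"
proof -
  define Q where "Q = 2 * B + 12 * \<omega>' 1"
  have Q: "Q \<ge> 0" using B_pos \<omega>'_1_pos by (simp add: Q_def)
  have "wasserstein \<omega>' ma mb \<le> 2 * Q * \<epsilon> powr (\<gamma> / (\<gamma> + 1))"
    if a: "pot a" "eigenmeasure T a ma la" and b: "pot b" "eigenmeasure T b mb lb"
      and ab: "\<And>x. \<bar>a x - b x\<bar> \<le> \<epsilon>" for a b ma mb la lb \<epsilon>
  proof -
    have m: "borel_prob ma" "borel_prob mb" using a b by (auto simp: eigenmeasure_def)
    interpret ma: prob_space ma using m by (simp add: borel_prob_def)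
    interpret mb: prob_space mb using m by (simp add: borel_prob_def)
    fix x0 :: 'a
    have \<epsilon>: "\<epsilon> \<ge> 0" using ab[of x0] by simp
    show ?thesis
    proof (rule optimise_rate[OF \<gamma>_pos \<epsilon> Q])
      fix n
      show "wasserstein \<omega>' ma mb \<le> Q * (rate n + real n * \<epsilon>)"
      proof (rule wasserstein_le[OF compact_space m \<omega>'_dist_continuous \<omega>'_zero \<omega>'_dist_nonneg
        \<omega>'_triangle])
        fix f :: "'a \<Rightarrow> real" assume f_cont: "continuous_on UNIV f"
          and f: "\<And>x y. \<bar>f x - f y\<bar> \<le> \<omega>' (dist x y)"
        \<comment> \<open>Centring keeps the difference of the two integrals and supplies the
          uniform bound \<open>\<omega>' 1\<close> that \<open>ratio_stable\<close> asks
          for.\<close>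
        define u where "u x = f x - f x0" for x
        have u: "lip u" "\<And>x. \<bar>u x\<bar> \<le> \<omega>' 1"
          using f order_trans[OF f \<omega>'_dist_le] by (auto simp: lip_def u_def)
        have "(LINT x|ma. u x) = (LINT x|ma. f x) - f x0" "(LINT x|mb. u x) = (LINT x|mb. f x) - f x0"
          unfolding u_def using integrable_continuous_compact[OF compact_space _ f_cont] m
          by (simp_all add: ma.prob_space mb.prob_space)
        then have "(LINT x|ma. f x) - (LINT x|mb. f x) = (LINT x|ma. u x) - (LINT x|mb. u x)" by simp
        also have "\<dots> \<le> B * rate n + 12 * \<omega>' 1 * (real n * \<epsilon>) + B * rate n"
          using ratio_integral[OF a u(1), of n x0] ratio_integral[OF b u(1), of n x0]
            ratio_stable[where a = a and b = b and u = u and n = n and x = x0, OF ab u(2)] by linarith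
        also have "\<dots> \<le> Q * (rate n + real n * \<epsilon>)"
          using B_pos \<omega>'_1_pos \<epsilon> by (simp add: Q_def algebra_simps)
        finally show "(LINT x|ma. f x) - (LINT x|mb. f x) \<le> Q * (rate n + real n * \<epsilon>)" .
      qed
    qed
  qed
  then show thesis using Q by (intro that[of "2 * Q"]) auto
qed

text \<open>The quotient of \<open>h\<close> at time \<open>n\<close> is
  \<open>l ^ n * h / G a n\<close>, and by normalisation its limit is 1. So
  \<open>ratio_integral\<close> applied to \<open>h\<close> says that \<open>G a n / l ^ n\<close>
  approximates \<open>h\<close> with error of order \<open>rate n\<close>, and this approximant
  depends on the potential by order \<open>n * \<epsilon>\<close>.\<close>

theorem eigenfunction_stable:
  obtains Q where "Q \<ge> 0"
    "\<And>a b ha hb ma mb la lb \<epsilon> x. pot a \<Longrightarrow> pot b \<Longrightarrow>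
      eigenfunction T a ha la \<Longrightarrow> eigenmeasure T a ma la \<Longrightarrow> (LINT x|ma. ha x) = 1 \<Longrightarrow>
      eigenfunction T b hb lb \<Longrightarrow> eigenmeasure T b mb lb \<Longrightarrow> (LINT x|mb. hb x) = 1 \<Longrightarrow>
      (\<And>x. \<bar>a x - b x\<bar> \<le> \<epsilon>) \<Longrightarrow> \<bar>ha x - hb x\<bar> \<le> Q * \<epsilon> powr (\<gamma> / (\<gamma> + 1))"
proof -
  define D where "D = C * R + 1"
  have D: "D > 0" using C_nonneg R_ge_1 by (simp add: D_def add_nonneg_pos)
  have approx: "\<bar>h x - G a n x / l ^ n\<bar> \<le> R * D * B * rate n"
    if a: "pot a" and h: "eigenfunction T a h l" and m: "eigenmeasure T a m l"
      and hm: "(LINT x|m. h x) = 1"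
    for a h l m n x
  proof -
    interpret prob_space m using m by (simp add: eigenmeasure_def borel_prob_def)
    have bm: "borel_prob m" and l: "l > 0" using m by (auto simp: eigenmeasure_def)
    have h_cont: "continuous_on UNIV h" using h by (simp add: eigenfunction_def)
    have h_le: "h x \<le> R" for x
    proof -
      have "(LINT z|m. h x) \<le> (LINT z|m. R * h z)"
        by (intro integral_mono integrable_continuous_compact[OF compact_space bm] continuous_on_mult
            continuous_on_const h_cont eigenfunction_le(1)[OF a h])
      then show ?thesis using hm by (simp add: prob_space)
    qed
    have "lip (\<lambda>z. (1 / D) * h z)"
      unfolding lip_def
    proof (intro allI)
      fix y z
      have "\<bar>h y - h z\<bar> \<le> C * \<omega>' (dist y z) * h y" by (rule eigenfunction_le(2)[OF a h])
      also have "\<dots> \<le> C * \<omega>' (dist y z) * R" using h_le C_nonneg by (intro mult_left_mono) auto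
      also have "\<dots> \<le> D * \<omega>' (dist y z)" by (simp add: D_def algebra_simps)
      finally show "\<bar>1 / D * h y - 1 / D * h z\<bar> \<le> \<omega>' (dist y z)"
        using D by (simp add: field_simps flip: diff_divide_distrib)
    qed
    from ratio_integral[OF a m this, of n x]
    have "\<bar>(1 / D) * 1 - (1 / D) * (l ^ n * h x / G a n x)\<bar> \<le> B * rate n"
      unfolding ratio_def iter_scale iter_eigen[OF h] using hm by simp
    moreover have "(1 / D) * 1 - (1 / D) * X = (1 - X) / D" for X by (simp add: diff_divide_distrib)
    ultimately have "\<bar>(1 - l ^ n * h x / G a n x) / D\<bar> \<le> B * rate n" by metis
    then have "\<bar>1 - l ^ n * h x / G a n x\<bar> \<le> D * (B * rate n)"
      using D by (simp only: abs_divide abs_of_pos pos_divide_le_eq mult.commute[of D])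
    then have "(G a n x / l ^ n) * \<bar>1 - l ^ n * h x / G a n x\<bar> \<le> R * (D * (B * rate n))"
      using eigenvalue_bounds(2)[OF a m, of n x] R_ge_1 l G_pos[of a n x]
      by (intro mult_mono) (auto simp: pos_divide_le_eq)
    moreover have "(G a n x / l ^ n) * \<bar>1 - l ^ n * h x / G a n x\<bar> = \<bar>G a n x / l ^ n - h x\<bar>"
    proof -
      have "(G a n x / l ^ n) * (1 - l ^ n * h x / G a n x) = G a n x / l ^ n - h x"
        using l by (simp add: right_diff_distrib)
      moreover have "0 \<le> G a n x / l ^ n" using l G_pos[of a n x] by simp
      ultimately show ?thesis by (metis abs_mult abs_of_nonneg)
    qed
    ultimately show ?thesis by (simp add: abs_minus_commute mult.assoc)
  qed
  have stable: "G a n x / la ^ n - G b n x / lb ^ n \<le> 6 * R * (real n * \<epsilon>)"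
    if a: "pot a" "eigenmeasure T a ma la" and b: "pot b" "eigenmeasure T b mb lb"
      and ab: "\<And>x. \<bar>a x - b x\<bar> \<le> \<epsilon>" for a b la lb ma mb \<epsilon> n x
  proof -
    have l: "la > 0" "lb > 0" using a b by (auto simp: eigenmeasure_def)
    have \<epsilon>: "\<epsilon> \<ge> 0" using ab[of x] by simp
    have "lb \<le> exp \<epsilon> * la"
      by (rule eigenvalue_ratio_le[OF b a]) (use ab in \<open>simp add: abs_minus_commute\<close>)
    then have "lb ^ n \<le> (exp \<epsilon> * la) ^ n" using l by (intro power_mono) auto
    then have l_le: "lb ^ n / exp (real n * \<epsilon>) \<le> la ^ n"
      unfolding power_mult_distrib exp_of_nat_mult
        by (simp add: pos_divide_le_eq) (simp add: mult.commute)
    have "G a n x / la ^ n \<le> (exp (real n * \<epsilon>) * G b n x) / (lb ^ n / exp (real n * \<epsilon>))"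
      using l l_le G_pos[of b n x] by (intro frac_le iter_le_exp ab) auto
    also have "\<dots> = exp (2 * (real n * \<epsilon>)) * (G b n x / lb ^ n)"
      unfolding mult_2 exp_add by simp
    finally have "G a n x / la ^ n - G b n x / lb ^ n \<le> 6 * (real n * \<epsilon>) * R"
      using eigenvalue_bounds(2)[OF a, of n x] eigenvalue_bounds(2)[OF b, of n x] l \<epsilon> G_pos[of b n x]
      by (intro exp_gap_le) (auto simp: pos_divide_le_eq)
    then show ?thesis by (simp add: mult_ac)
  qed
  define Q where "Q = 2 * (R * D * B) + 6 * R"
  have Q: "Q \<ge> 0" using B_pos D R_ge_1 by (simp add: Q_def)
  have "\<bar>ha x - hb x\<bar> \<le> 2 * Q * \<epsilon> powr (\<gamma> / (\<gamma> + 1))"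
    if a: "pot a" and b: "pot b"
      and ha: "eigenfunction T a ha la" "eigenmeasure T a ma la" "(LINT x|ma. ha x) = 1"
      and hb: "eigenfunction T b hb lb" "eigenmeasure T b mb lb" "(LINT x|mb. hb x) = 1"
      and ab: "\<And>x. \<bar>a x - b x\<bar> \<le> \<epsilon>" for a b ha hb ma mb la lb \<epsilon> x
  proof (rule optimise_rate[OF \<gamma>_pos _ Q])
    show \<epsilon>: "\<epsilon> \<ge> 0" using ab[of x] by simp
    fix n
    have ba: "\<bar>b x - a x\<bar> \<le> \<epsilon>" for x using ab[of x] by (simp add: abs_minus_commute)
    have "\<bar>ha x - hb x\<bar> \<le> 2 * (R * D * B * rate n) + 6 * R * (real n * \<epsilon>)"
      using approx[OF a ha, of x n] approx[OF b hb, of x n]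
        stable[OF a ha(2) b hb(2) ab, of n x] stable[OF b hb(2) a ha(2) ba, of n x] by linarith
    also have "\<dots> \<le> Q * (rate n + real n * \<epsilon>)"
    proof -
      have "0 \<le> 2 * (R * D * B) * (real n * \<epsilon>)" "0 \<le> 6 * R * rate n"
        using B_pos D R_ge_1 \<epsilon> by auto
      then show ?thesis by (simp add: Q_def algebra_simps)
    qed
    finally show "\<bar>ha x - hb x\<bar> \<le> Q * (rate n + real n * \<epsilon>)" .
  qed
  then show thesis using Q by (intro that[of "2 * Q"]) auto
qed

text \<open>The eigenvalue is even Lipschitz in the potential, by
  \<open>la \<le> exp \<epsilon> * lb\<close>. The bound \<open>M\<close> on the potentials bounds
  the eigenvalues themselves, and \<open>\<epsilon> \<le> 2 * M\<close> lets the surplus power of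
  \<open>\<epsilon>\<close> pass into the constant.\<close>

theorem eigenvalue_stable:
  obtains Q where "Q \<ge> 0"
    "\<And>a b ma mb la lb \<epsilon>. pot a \<Longrightarrow> pot b \<Longrightarrow> eigenmeasure T a ma la \<Longrightarrow> eigenmeasure T b mb lb \<Longrightarrow>
      (\<And>x. a x \<le> M) \<Longrightarrow> (\<And>x. b x \<le> M) \<Longrightarrow> (\<And>x. \<bar>a x - b x\<bar> \<le> \<epsilon>) \<Longrightarrow> \<epsilon> \<le> 2 * M \<Longrightarrow>
      \<bar>la - lb\<bar> \<le> Q * \<epsilon> powr (\<gamma> / (\<gamma> + 1))"
proof -
  obtain D where D: "D \<ge> 1" "\<And>x. real (card {u. (T ^^ 1) u = x}) \<le> D" using card_fibre_bounded
    by blast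
  define L where "L = R * (D * exp M)"
  have L: "L \<ge> 0" using R_ge_1 D(1) by (simp add: L_def)
  have l_le: "l \<le> L" if a: "pot a" "eigenmeasure T a m l" and M: "\<And>x. a x \<le> M" for a m l
  proof -
    fix x0 :: 'a
    have "l \<le> R * G a 1 x0" using eigenvalue_bounds(1)[OF a, of 1 x0] by simp
    also have "G a 1 x0 \<le> (\<Sum>y | (T ^^ 1) y = x0. exp M)"
      unfolding ruelle_iter_def using M by (intro sum_mono) (simp add: birkhoff_def)
    also have "\<dots> = real (card {u. (T ^^ 1) u = x0}) * exp M" by simp
    also have "\<dots> \<le> D * exp M" by (intro mult_right_mono D(2)) simp
    finally show ?thesis using R_ge_1 by (simp add: L_def)
  qed
  define Q where "Q = exp (2 * M) * L * (2 * M) powr (1 / (\<gamma> + 1))"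
  have one: "la - lb \<le> Q * \<epsilon> powr (\<gamma> / (\<gamma> + 1))"
    if a: "pot a" "eigenmeasure T a ma la" and b: "pot b" "eigenmeasure T b mb lb"
      and M: "\<And>x. b x \<le> M" and ab: "\<And>x. \<bar>a x - b x\<bar> \<le> \<epsilon>" and \<epsilon>M: "\<epsilon> \<le> 2 * M" for a b ma mb la lb \<epsilon>
  proof -
    fix x0 :: 'a
    have \<epsilon>: "\<epsilon> \<ge> 0" using ab[of x0] by simp
    have lb: "0 < lb" "lb \<le> L" using b l_le[OF b M] by (auto simp: eigenmeasure_def)
    have "la \<le> exp \<epsilon> * lb" by (rule eigenvalue_ratio_le[OF a b ab])
    then have "la - lb \<le> (exp \<epsilon> - 1) * lb" by (simp add: algebra_simps)
    also have "\<dots> \<le> (\<epsilon> * exp (2 * M)) * L"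
    proof (intro mult_mono)
      have "exp \<epsilon> - 1 \<le> \<epsilon> * exp \<epsilon>" using abs_exp_minus_one_le[of \<epsilon>] \<epsilon> by simp
      also have "\<dots> \<le> \<epsilon> * exp (2 * M)" using \<epsilon> \<epsilon>M by (intro mult_left_mono) auto
      finally show "exp \<epsilon> - 1 \<le> \<epsilon> * exp (2 * M)" .
    qed (use lb \<epsilon> in auto)
    also have "\<epsilon> = \<epsilon> powr (1 / (\<gamma> + 1)) * \<epsilon> powr (\<gamma> / (\<gamma> + 1))"
    proof -
      have "1 / (\<gamma> + 1) + \<gamma> / (\<gamma> + 1) = 1" using \<gamma>_pos by (simp flip: add_divide_distrib)
      then show ?thesis using \<epsilon> by (simp flip: powr_add)
    qed
    also have "\<epsilon> powr (1 / (\<gamma> + 1)) * \<epsilon> powr (\<gamma> / (\<gamma> + 1)) * exp (2 * M) * L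
        \<le> (2 * M) powr (1 / (\<gamma> + 1)) * \<epsilon> powr (\<gamma> / (\<gamma> + 1)) * exp (2 * M) * L"
      using \<epsilon> \<epsilon>M \<gamma>_pos L by (intro mult_right_mono powr_mono2) auto
    finally show ?thesis by (simp add: Q_def mult_ac)
  qed
  have "\<bar>la - lb\<bar> \<le> Q * \<epsilon> powr (\<gamma> / (\<gamma> + 1))"
    if a: "pot a" "eigenmeasure T a ma la" and b: "pot b" "eigenmeasure T b mb lb"
      and M: "\<And>x. a x \<le> M" "\<And>x. b x \<le> M" and ab: "\<And>x. \<bar>a x - b x\<bar> \<le> \<epsilon>" and \<epsilon>M: "\<epsilon> \<le> 2 * M"
    for a b ma mb la lb \<epsilon>
  proof -
    have ba: "\<bar>b x - a x\<bar> \<le> \<epsilon>" for x using ab[of x] by (simp add: abs_minus_commute)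
    show ?thesis using one[OF a b M(2) ab \<epsilon>M] one[OF b a M(1) ba \<epsilon>M] by (simp add: abs_le_iff)
  qed
  then show thesis using L by (intro that[of Q]) (auto simp: Q_def)
qed

end

section \<open>Inverse branches and moduli\<close>

text \<open>An infinite fibre would accumulate at a point near which \<open>f\<close> is
  injective.\<close>

lemma finite_fibre_local_homeomorphism:
  fixes f :: "'a::metric_space \<Rightarrow> 'b::topological_space"
  assumes compact: "compact (UNIV :: 'a set)" and f: "local_homeomorphism f"
  shows "finite {y. f y = x}"
proof (rule ccontr)
  assume "infinite {y. f y = x}"
  then obtain z where z: "z islimpt {y. f y = x}"
    using compact unfolding compact_eq_Bolzano_Weierstrass by blast
  obtain U V g where U: "open U" "z \<in> U" "homeomorphism U V f g"
    using f unfolding local_homeomorphism_def by blast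
  obtain y where y: "f y = x" "y \<in> U" "y \<noteq> z" using z U(1,2) by (auto simp: islimpt_def)
  obtain y' where y': "f y' = x" "y' \<in> U" "y' \<noteq> y"
    using z U(1,2) y(3) unfolding islimpt_def
      by (metis (mono_tags, lifting) DiffD1 DiffD2 DiffI insertCI mem_Collect_eq open_delete
        singletonD)
  have "y = y'" using y y' U(3) by (metis homeomorphism_apply1)
  with y'(3) show False by simp
qed

text \<open>Iterating the one-step definition gives the form of Ruelle expansiveness with rate
  \<open>l ^ n * t\<close>. For uniqueness, the image under \<open>T\<close> of a competing branch
  satisfies the bounds of length \<open>n\<close> and is therefore \<open>w\<close>; the bound at
  time 0 then places the branch within \<open>l * r\<close>, where the one-step preimage is
  unique.\<close>

lemma expanding_inverse_branches:
  assumes "ruelle_expanding T"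
  shows "\<exists>l r. 0 < l \<and> l < 1 \<and> r > 0 \<and>
    (\<forall>n x y u. dist x y < r \<and> (T ^^ n) u = x \<longrightarrow>
      (\<exists>!v. (T ^^ n) v = y \<and> (\<forall>k\<le>n. dist ((T ^^ k) u) ((T ^^ k) v) \<le> l ^ (n - k) * dist x y)))"
proof -
  obtain l r where l: "0 < l" "l < 1" and r: "r > 0"
    and expand: "\<forall>x y x'. dist x y < r \<and> T x' = x \<longrightarrow>
        (\<exists>!y'. T y' = y \<and> dist x' y' < l * r) \<and>
        (\<forall>y'. T y' = y \<and> dist x' y' < l * r \<longrightarrow> dist x' y' \<le> l * dist x y)"
    using assms unfolding ruelle_expanding_def by (elim exE conjE) (rule that)
  have ex: "\<exists>!v. T v = y \<and> dist u v < l * r" if "dist x y < r" "T u = x" for x y u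
    using expand that by blast
  have le: "dist u v \<le> l * dist x y" if "dist x y < r" "T u = x" "T v = y" "dist u v < l * r"
    for x y u v
    using expand that by blast
  have branches: "\<exists>!v. (T ^^ n) v = y \<and> (\<forall>k\<le>n. dist ((T ^^ k) u) ((T ^^ k) v) \<le> l ^ (n - k) *
    dist x y)"
    if xy: "dist x y < r" and u: "(T ^^ n) u = x" for n x y u
    using u
  proof (induction n arbitrary: u)
    case 0
    then show ?case by auto
  next
    case (Suc n)
    let ?P = "\<lambda>v. (T ^^ Suc n) v = y \<and> (\<forall>k\<le>Suc n. dist ((T ^^ k) u) ((T ^^ k) v) \<le> l ^ (Suc n - k) *
      dist x y)"
    have Tu: "(T ^^ n) (T u) = x" using Suc.prems by (simp add: funpow_swap1)
    obtain w where w: "(T ^^ n) w = y" "\<And>k. k \<le> n \<Longrightarrow> dist ((T ^^ k) (T u)) ((T ^^ k) w) \<le> l ^ (n -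
      k) * dist x y"
      and w_unique: "\<And>w'. (T ^^ n) w' = y \<Longrightarrow> (\<And>k. k \<le> n \<Longrightarrow> dist ((T ^^ k) (T u)) ((T ^^ k) w') \<le>
        l ^ (n - k) * dist x y) \<Longrightarrow> w' = w"
      using Suc.IH[OF Tu] by metis
    have Tuw: "dist (T u) w \<le> l ^ n * dist x y" using w(2)[of 0] by simp
    also have "\<dots> \<le> 1 * dist x y" using l by (intro mult_right_mono power_le_one) auto
    finally have Tuw_r: "dist (T u) w < r" using xy by simp
    obtain v where v: "T v = w" "dist u v < l * r"
      and v_unique: "\<And>v'. T v' = w \<Longrightarrow> dist u v' < l * r \<Longrightarrow> v' = v"
      using ex[OF Tuw_r refl] by metis
    have "dist u v \<le> l * dist (T u) w" by (rule le[OF Tuw_r refl v])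
    also have "\<dots> \<le> l * (l ^ n * dist x y)" using l Tuw by (intro mult_left_mono) auto
    finally have uv: "dist u v \<le> l ^ Suc n * dist x y" by (simp add: mult.assoc)
    have "?P v"
    proof (intro conjI allI impI)
      show "(T ^^ Suc n) v = y" using w(1) v(1) by (simp add: funpow_swap1)
      fix k assume "k \<le> Suc n"
      then show "dist ((T ^^ k) u) ((T ^^ k) v) \<le> l ^ (Suc n - k) * dist x y"
        using uv w(2)[of "k - 1"] v(1) by (cases k) (auto simp: funpow_swap1)
    qed
    moreover have "v' = v" if v': "?P v'" for v'
    proof (rule v_unique)
      show "T v' = w"
      proof (rule w_unique)
        show "(T ^^ n) (T v') = y" using v' by (simp add: funpow_swap1)
        fix k assume "k \<le> n"
        then show "dist ((T ^^ k) (T u)) ((T ^^ k) (T v')) \<le> l ^ (n - k) * dist x y"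
          using v'[THEN conjunct2, rule_format, of "Suc k"] by (simp add: funpow_swap1)
      qed
      have "dist u v' \<le> l * (l ^ n * dist x y)"
        using v'[THEN conjunct2, rule_format, of 0] by (simp add: mult.assoc)
      also have "\<dots> \<le> l * (1 * dist x y)" using l
        by (intro mult_left_mono mult_right_mono power_le_one) auto
      also have "\<dots> < l * r" using l xy by simp
      finally show "dist u v' < l * r" .
    qed
    ultimately show ?case by (rule ex1I)
  qed
  show ?thesis
    by (intro exI[of _ l] exI[of _ r] conjI allI impI l r) (rule branches; simp)
qed

text \<open>The shadowing relation \<open>rel\<close> depends on \<open>x\<close> and
  \<open>y\<close> only through their distance and is symmetric. Branch selection from
  \<open>x\<close> to \<open>y\<close> and from \<open>y\<close> to \<open>x\<close> are thus
  mutually inverse by uniqueness.\<close>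

lemma inverse_branch_bijection:
  assumes branch: "\<And>x y u. dist x y < r \<Longrightarrow> (T ^^ n) u = x \<Longrightarrow>
      \<exists>!v. (T ^^ n) v = y \<and> (\<forall>k\<le>n. dist ((T ^^ k) u) ((T ^^ k) v) \<le> c (n - k) (dist x y))"
    and xy: "dist x y < r"
  obtains \<phi> where "bij_betw \<phi> {u. (T ^^ n) u = x} {u. (T ^^ n) u = y}"
    "\<And>u k. (T ^^ n) u = x \<Longrightarrow> k \<le> n \<Longrightarrow> dist ((T ^^ k) u) ((T ^^ k) (\<phi> u)) \<le> c (n - k) (dist x y)"
proof -
  define rel where "rel u v \<longleftrightarrow> (\<forall>k\<le>n. dist ((T ^^ k) u) ((T ^^ k) v) \<le> c (n - k) (dist x y))" for u v
  have yx: "dist y x < r" using xy by (simp add: dist_commute)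
  have "\<forall>u. \<exists>v. (T ^^ n) u = x \<longrightarrow> (T ^^ n) v = y \<and> rel u v" using branch[OF xy] unfolding rel_def
    by blast
  then obtain \<phi> where \<phi>: "\<And>u. (T ^^ n) u = x \<Longrightarrow> (T ^^ n) (\<phi> u) = y \<and> rel u (\<phi> u)" by metis
  have "\<forall>v. \<exists>u. (T ^^ n) v = y \<longrightarrow> (T ^^ n) u = x \<and> rel u v"
    using branch[OF yx] unfolding rel_def by (metis dist_commute)
  then obtain \<psi> where \<psi>: "\<And>v. (T ^^ n) v = y \<Longrightarrow> (T ^^ n) (\<psi> v) = x \<and> rel (\<psi> v) v" by metis
  have u1: "v = v'" if "(T ^^ n) u = x" "(T ^^ n) v = y" "(T ^^ n) v' = y" "rel u v" "rel u v'"
    for u v v'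
    using branch[OF xy that(1)] that unfolding rel_def by blast
  have u2: "u = u'" if "(T ^^ n) v = y" "(T ^^ n) u = x" "(T ^^ n) u' = x" "rel u v" "rel u' v"
    for u u' v
    using branch[OF yx that(1)] that unfolding rel_def by (metis dist_commute)
  have "bij_betw \<phi> {u. (T ^^ n) u = x} {u. (T ^^ n) u = y}"
    by (rule bij_betw_byWitness[where f' = \<psi>]) (use \<phi> \<psi> u1 u2 in blast)+
  moreover have "dist ((T ^^ k) u) ((T ^^ k) (\<phi> u)) \<le> c (n - k) (dist x y)"
    if "(T ^^ n) u = x" "k \<le> n" for u k
    using \<phi>[OF that(1)] that(2) unfolding rel_def by blast
  ultimately show thesis by (rule that)
qed

section \<open>Power sums, concave moduli and a common criterion for paired branches\<close>

lemma powr_increment_ge: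
  fixes s \<eta> \<gamma> :: real
  assumes "s > 0" "\<eta> > 0" "\<gamma> > 0"
  shows "\<gamma> * \<eta> * (s + \<eta>) powr (- \<gamma> - 1) \<le> s powr - \<gamma> - (s + \<eta>) powr - \<gamma>"
proof -
  have "\<exists>z>s. z < s + \<eta> \<and> (s + \<eta>) powr - \<gamma> - s powr - \<gamma> = (s + \<eta> - s) * (- \<gamma> * z powr (- \<gamma> - 1))"
    by (rule MVT2) (use assms in \<open>auto intro!: derivative_eq_intros\<close>)
  then obtain z where z: "s < z" "z < s + \<eta>"
    "s powr - \<gamma> - (s + \<eta>) powr - \<gamma> = \<gamma> * \<eta> * z powr (- \<gamma> - 1)" by (auto simp: algebra_simps)
  have "(s + \<eta>) powr (- \<gamma> - 1) \<le> z powr (- \<gamma> - 1)" using z assms by (intro powr_mono2') auto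
  then show ?thesis unfolding z(3) using assms by (intro mult_left_mono) auto
qed

text \<open>The integral test, in telescoping form: each term is at most the drop of the function
  \<open>powr - \<gamma>\<close> over its step, divided by \<open>\<gamma> * \<eta>\<close>.\<close>

lemma powr_sum_le:
  fixes s \<eta> \<gamma> :: real
  assumes "s > 0" "\<eta> > 0" "\<gamma> > 0"
  shows "(\<Sum>j<n. (s + \<eta> * real (Suc j)) powr (- \<gamma> - 1)) \<le> s powr - \<gamma> / (\<gamma> * \<eta>)"
proof -
  have "\<gamma> * \<eta> * (\<Sum>j<n. (s + \<eta> * real (Suc j)) powr (- \<gamma> - 1)) \<le> s powr - \<gamma> - (s + \<eta> * real n) powr -
    \<gamma>"
  proof (induction n)
    case (Suc n)
    have "s + \<eta> * real n > 0" using assms by (simp add: add_pos_nonneg)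
    from powr_increment_ge[OF this assms(2,3)] Suc show ?case by (simp add: algebra_simps)
  qed simp
  also have "\<dots> \<le> s powr - \<gamma>" by simp
  finally show ?thesis using assms by (simp add: pos_le_divide_eq mult.commute)
qed

lemma concave_scale:
  fixes f :: "real \<Rightarrow> real"
  assumes "concave_on {0..1} f" "f 0 = 0" "0 \<le> \<mu>" "\<mu> \<le> 1" "0 \<le> t" "t \<le> 1"
  shows "\<mu> * f t \<le> f (\<mu> * t)"
  using concave_onD[OF assms(1,3,4), of 0 t] assms by simp

text \<open>Cut \<open>u\<close> in the proportion \<open>s : t\<close>. The parts are at most
  \<open>s\<close> and \<open>t\<close>, and concavity through the origin gives each its share of
  \<open>f u\<close>.\<close>

lemma concave_subadditive:
  fixes f :: "real \<Rightarrow> real"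
  assumes f: "concave_on {0..1} f" "f 0 = 0"
    and mono: "\<And>s t. 0 \<le> s \<Longrightarrow> s \<le> t \<Longrightarrow> t \<le> 1 \<Longrightarrow> f s \<le> f t"
    and stu: "0 \<le> s" "s \<le> 1" "0 \<le> t" "t \<le> 1" "0 \<le> u" "u \<le> 1" "u \<le> s + t"
  shows "f u \<le> f s + f t"
proof (cases "s + t = 0")
  case True
  then have "u = 0" "s = 0" "t = 0" using stu by auto
  then show ?thesis by (simp add: f)
next
  case False
  then have st: "s + t > 0" using stu by auto
  have "s / (s + t) * f u \<le> f (s / (s + t) * u)" "t / (s + t) * f u \<le> f (t / (s + t) * u)"
    by (rule concave_scale[OF f]; use stu st in simp)+
  moreover have "f (s / (s + t) * u) \<le> f s" "f (t / (s + t) * u) \<le> f t"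
    using stu st mult_left_mono[OF stu(7,1)] mult_left_mono[OF stu(7,3)]
    by (auto intro!: mono simp: field_simps)
  moreover have "s / (s + t) * f u + t / (s + t) * f u = f u"
    using st by (simp flip: distrib_right add_divide_distrib)
  ultimately show ?thesis by linarith
qed

text \<open>A concave function vanishing at 0 has decreasing slope \<open>f t / t\<close>.\<close>

lemma concave_dilate:
  fixes f :: "real \<Rightarrow> real"
  assumes f: "concave_on {0..1} f" "f 0 = 0"
    and mono: "\<And>s t. 0 \<le> s \<Longrightarrow> s \<le> t \<Longrightarrow> t \<le> 1 \<Longrightarrow> f s \<le> f t"
    and "0 \<le> d" "d \<le> 1" "0 \<le> t" "t \<le> 1" "d \<le> K * t" "1 \<le> K"
  shows "f d \<le> K * f t"
proof (cases "d \<le> t")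
  case True
  have "0 \<le> f t" using mono[of 0 t] assms by simp
  then have "1 * f t \<le> K * f t" using assms by (intro mult_right_mono) auto
  with mono[of d t] True assms show ?thesis by linarith
next
  case False
  then have d: "d > 0" "t < d" using assms by auto
  have "t / d * f d \<le> f (t / d * d)" by (rule concave_scale[OF f]) (use assms d in auto)
  then have "t * f d \<le> d * f t" using d by (simp add: field_simps)
  also have "d * f t \<le> (K * t) * f t" using mono[of 0 t] assms by (intro mult_right_mono) auto
  finally have "t * f d \<le> t * (K * f t)" by (simp add: algebra_simps)
  moreover have "t > 0" using assms d by (cases "t = 0") auto
  ultimately show ?thesis by simp
qed

text \<open>The function \<open>s\<close> linearises the contraction: at depth \<open>j\<close> it
  has grown by \<open>\<eta> * j\<close>, and \<open>\<omega>\<close> of the distance is at most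
  \<open>A\<close> times the power \<open>- \<gamma> - 1\<close> of the result. Summing along a
  branch leaves \<open>s t powr - \<gamma>\<close>, which \<open>s_\<omega>'\<close> converts into
  \<open>\<omega>' t\<close>.\<close>

lemma paired_branchesI:
  fixes T :: "'a::metric_space \<Rightarrow> 'a" and \<omega> \<omega>' s :: "real \<Rightarrow> real" and c :: "nat \<Rightarrow> real \<Rightarrow> real"
  assumes compact: "compact (UNIV :: 'a set)" and dist1: "\<And>x y :: 'a. dist x y \<le> 1"
    and mixing: "topologically_mixing T" and fibre: "\<And>n x. finite {y. (T ^^ n) y = x}"
    and pos: "r > 0" "\<gamma> > 0" "H \<ge> 0" "\<eta> > 0" "A \<ge> 0" "A' \<ge> 0" "K0 \<ge> 1" "K3 \<ge> 0"
    and branch: "\<And>n x y u. n \<ge> 1 \<Longrightarrow> dist x y < r \<Longrightarrow> (T ^^ n) u = x \<Longrightarrow>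
      \<exists>!v. (T ^^ n) v = y \<and> (\<forall>k\<le>n. dist ((T ^^ k) u) ((T ^^ k) v) \<le> c (n - k) (dist x y))"
    and c0: "\<And>j. c j 0 = 0"
    and e: "e \<longlonglongrightarrow> 0" "e 0 \<ge> 1"
    and \<omega>0: "\<omega> 0 = 0" and \<omega>_mono: "\<And>s t. 0 \<le> s \<Longrightarrow> s \<le> t \<Longrightarrow> t \<le> 1 \<Longrightarrow> \<omega> s \<le> \<omega> t"
    and \<omega>_lim: "\<And>\<epsilon>. \<epsilon> > 0 \<Longrightarrow> \<exists>\<eta>>0. \<forall>t. 0 \<le> t \<and> t \<le> 1 \<and> t < \<eta> \<longrightarrow> \<omega> t < \<epsilon>"
    and \<omega>'_concave: "concave_on {0..1} \<omega>'" and \<omega>'0: "\<omega>' 0 = 0"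
    and \<omega>'_pos: "\<And>t. 0 < t \<Longrightarrow> t \<le> 1 \<Longrightarrow> 0 < \<omega>' t"
    and \<omega>'_mono: "\<And>s t. 0 \<le> s \<Longrightarrow> s \<le> t \<Longrightarrow> t \<le> 1 \<Longrightarrow> \<omega>' s \<le> \<omega>' t"
    and \<omega>'_lim: "\<And>\<epsilon>. \<epsilon> > 0 \<Longrightarrow> \<exists>\<eta>>0. \<forall>t. 0 \<le> t \<and> t \<le> 1 \<and> t < \<eta> \<longrightarrow> \<omega>' t < \<epsilon>"
    and s_pos: "\<And>t. 0 < t \<Longrightarrow> t \<le> 1 \<Longrightarrow> s t > 0"
    and s_\<omega>': "\<And>t. 0 < t \<Longrightarrow> t \<le> 1 \<Longrightarrow> s t powr - \<gamma> \<le> A' * \<omega>' t"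
    and c_\<omega>: "\<And>j d t. 0 < t \<Longrightarrow> t \<le> 1 \<Longrightarrow> 0 \<le> d \<Longrightarrow> d \<le> 1 \<Longrightarrow> d \<le> c j t \<Longrightarrow>
      \<omega> d \<le> A * (s t + \<eta> * real j) powr (- \<gamma> - 1)"
    and c_le: "\<And>j t. 0 < t \<Longrightarrow> t \<le> 1 \<Longrightarrow> c j t \<le> K0 * t" "\<And>j t. 0 < t \<Longrightarrow> t \<le> 1 \<Longrightarrow> c j t \<le> e j"
    and c_\<omega>': "\<And>j d t. 0 < t \<Longrightarrow> t \<le> 1 \<Longrightarrow> 0 \<le> d \<Longrightarrow> d \<le> 1 \<Longrightarrow> d \<le> c j t \<Longrightarrow>
      \<omega>' d \<le> K3 * (1 + real j) powr - \<gamma>"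
    and e_nonneg: "\<And>j. 0 \<le> e j"
  shows "paired_branches T r K0 (A * A' / (\<gamma> * \<eta>)) K0 (max K3 (\<omega>' 1)) (1 / \<omega>' 1) (\<omega> 1) H \<gamma> e \<omega> \<omega>'"
proof
  let ?K1 = "A * A' / (\<gamma> * \<eta>)"
  have K1: "?K1 \<ge> 0" using pos by simp
  have \<omega>'1: "\<omega>' 1 > 0" by (rule \<omega>'_pos) auto
  have \<omega>'_nonneg: "0 \<le> \<omega>' t" if "0 \<le> t" "t \<le> 1" for t using \<omega>'_mono[of 0 t] that \<omega>'0 by simp
  fix x y :: 'a and n :: nat assume xy: "dist x y < r"
  show "\<exists>\<phi>. bij_betw \<phi> {u. (T ^^ n) u = x} {u. (T ^^ n) u = y} \<and>
      (\<forall>u. (T ^^ n) u = x \<longrightarrow>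
        (\<Sum>k<n. \<omega> (dist ((T ^^ k) u) ((T ^^ k) (\<phi> u)))) \<le> A * A' / (\<gamma> * \<eta>) * \<omega>' (dist x y) \<and>
        dist u (\<phi> u) \<le> K0 * dist x y \<and> dist u (\<phi> u) \<le> e n \<and>
        \<omega>' (dist u (\<phi> u)) \<le> K0 * \<omega>' (dist x y) \<and>
        \<omega>' (dist u (\<phi> u)) \<le> max K3 (\<omega>' 1) * (1 + real n) powr - \<gamma>)"
    (is ?goal)
  \<comment> \<open>\<open>branch\<close> covers \<open>n \<ge> 1\<close> only. For
    \<open>n = 0\<close> the fibres are singletons; this case is the origin of the premise
    \<open>e 0 \<ge> 1\<close> and of the maximum with \<open>\<omega>' 1\<close>.\<close>
  proof (cases "n = 0")
    case True
    have "bij_betw (\<lambda>_. y) {x} {y}" by (simp add: bij_betw_def)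
    moreover have "1 * dist x y \<le> K0 * dist x y" "1 * \<omega>' (dist x y) \<le> K0 * \<omega>' (dist x y)"
      by (intro mult_right_mono \<omega>'_nonneg; use pos dist1 in simp)+
    moreover have "\<omega>' (dist x y) \<le> max K3 (\<omega>' 1)"
      using \<omega>'_mono[of "dist x y" 1] dist1[of x y] by (simp add: max.coboundedI2)
    ultimately show ?goal
      using True e(2) dist1[of x y] mult_nonneg_nonneg[OF K1 \<omega>'_nonneg[OF zero_le_dist dist1], of x y]
      by (intro exI[of _ "\<lambda>_. y"]) auto
  next
    case False
    then have n: "n \<ge> 1" by simp
    obtain \<phi> where bij: "bij_betw \<phi> {u. (T ^^ n) u = x} {u. (T ^^ n) u = y}"
      and \<phi>: "\<And>u k. (T ^^ n) u = x \<Longrightarrow> k \<le> n \<Longrightarrow> dist ((T ^^ k) u) ((T ^^ k) (\<phi> u)) \<le> c (n -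
        k) (dist x y)"
      using inverse_branch_bijection[OF branch[OF n] xy] by blast
    have "(\<Sum>k<n. \<omega> (dist ((T ^^ k) u) ((T ^^ k) (\<phi> u)))) \<le> ?K1 * \<omega>' (dist x y) \<and>
        dist u (\<phi> u) \<le> K0 * dist x y \<and> dist u (\<phi> u) \<le> e n \<and>
        \<omega>' (dist u (\<phi> u)) \<le> K0 * \<omega>' (dist x y) \<and>
        \<omega>' (dist u (\<phi> u)) \<le> max K3 (\<omega>' 1) * (1 + real n) powr - \<gamma>"
      if u: "(T ^^ n) u = x" for u
    \<comment> \<open>The estimates through \<open>s\<close> are available for positive distances
      only.\<close>
    proof (cases "x = y")
      case True
      then have "dist ((T ^^ k) u) ((T ^^ k) (\<phi> u)) = 0" if "k \<le> n" for k
        using \<phi>[OF u that] by (simp add: c0)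
      from this[of 0] this show ?thesis using True e_nonneg \<omega>0 \<omega>'0 \<omega>'1 by simp
    next
      case False
      define t where "t = dist x y"
      have t: "0 < t" "t \<le> 1" using False dist1 by (auto simp: t_def)
      have d: "dist ((T ^^ k) u) ((T ^^ k) (\<phi> u)) \<le> c (n - k) t" if "k \<le> n" for k
        unfolding t_def by (rule \<phi>[OF u that])
      have d0: "dist u (\<phi> u) \<le> c n t" using d[of 0] by simp
      \<comment> \<open>The remaining depth \<open>n - k\<close> runs through 1 to \<open>n\<close>,
        never 0, which is the range summed in \<open>powr_sum_le\<close>.\<close>
      have "(\<Sum>k<n. \<omega> (dist ((T ^^ k) u) ((T ^^ k) (\<phi> u))))
          \<le> (\<Sum>k<n. A * (s t + \<eta> * real (Suc (n - Suc k))) powr (- \<gamma> - 1))"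
      proof (rule sum_mono)
        fix k assume "k \<in> {..<n}"
        then have k: "k \<le> n" "Suc (n - Suc k) = n - k" by auto
        show "\<omega> (dist ((T ^^ k) u) ((T ^^ k) (\<phi> u))) \<le> A * (s t + \<eta> * real (Suc (n -
          Suc k))) powr (- \<gamma> - 1)"
          unfolding k(2) by (rule c_\<omega>[OF t _ _ d[OF k(1)]]) (auto simp: dist1)
      qed
      also have "\<dots> = A * (\<Sum>j<n. (s t + \<eta> * real (Suc j)) powr (- \<gamma> - 1))"
        using sum.nat_diff_reindex[of "\<lambda>j. (s t + \<eta> * real (Suc j)) powr (- \<gamma> - 1)" n]
        by (simp only: sum_distrib_left[symmetric])
      also have "\<dots> \<le> A * (s t powr - \<gamma> / (\<gamma> * \<eta>))"
        using pos s_pos t by (intro mult_left_mono powr_sum_le) auto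
      also have "\<dots> \<le> A * ((A' * \<omega>' t) / (\<gamma> * \<eta>))"
        using pos s_\<omega>' t by (intro mult_left_mono divide_right_mono) auto
      finally have 1: "(\<Sum>k<n. \<omega> (dist ((T ^^ k) u) ((T ^^ k) (\<phi> u)))) \<le> ?K1 * \<omega>' t"
        by simp
      have 2: "dist u (\<phi> u) \<le> K0 * t" "dist u (\<phi> u) \<le> e n"
        using d0 c_le[of t n] t by auto
      have 3: "\<omega>' (dist u (\<phi> u)) \<le> K0 * \<omega>' t"
        by (rule concave_dilate[OF \<omega>'_concave \<omega>'0 \<omega>'_mono]) (use t 2 pos dist1 in auto)
      have "\<omega>' (dist u (\<phi> u)) \<le> K3 * (1 + real n) powr - \<gamma>"
        by (rule c_\<omega>'[OF t _ _ d0]) (auto simp: dist1)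
      also have "\<dots> \<le> max K3 (\<omega>' 1) * (1 + real n) powr - \<gamma>" by (intro mult_right_mono) auto
      finally show ?thesis using 1 2 3 by (simp add: t_def)
    qed
    then show ?goal
      using bij by blast
  qed
next
  fix t :: real assume "0 \<le> t" "t \<le> 1"
  then show "0 \<le> \<omega> t \<and> \<omega> t \<le> \<omega> 1" using \<omega>_mono[of 0 t] \<omega>_mono[of t 1] \<omega>0 by simp
next
  fix t :: real assume t: "0 \<le> t" "t \<le> 1"
  have "0 < \<omega>' 1" by (rule \<omega>'_pos) auto
  with concave_scale[OF \<omega>'_concave \<omega>'0 t, of 1] show "t \<le> 1 / \<omega>' 1 * \<omega>' t" by (simp add: field_simps)
next
  fix s t u :: real
  assume stu: "0 \<le> s" "s \<le> 1" "0 \<le> t" "t \<le> 1" "0 \<le> u" "u \<le> 1" "u \<le> s + t"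
  show "\<omega>' u \<le> \<omega>' s + \<omega>' t"
    by (rule concave_subadditive[OF \<omega>'_concave \<omega>'0 _ stu]) (rule \<omega>'_mono)
next
  have "0 < \<omega>' 1" by (rule \<omega>'_pos) auto
  then show "0 \<le> 1 / \<omega>' 1" "0 \<le> max K3 (\<omega>' 1)" by auto
qed (use assms in auto)

section \<open>The logarithmic and power moduli and the two cases of the theorem\<close>

lemma log_modulus_zero [simp]: "log_modulus \<alpha> \<beta> t0 0 = 0"
  by (simp add: log_modulus_def)

lemma log_modulus_log:
  "0 < t \<Longrightarrow> log_modulus 0 \<beta> t0 t = (ln t0 - ln t) powr - \<beta>"
  by (simp add: log_modulus_def)

lemma log_modulus_power:
  assumes "t0 > 1" "0 \<le> t" "t \<le> 1" shows "log_modulus \<alpha> 0 t0 t = t powr \<alpha>"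
proof (cases "t = 0")
  case False
  then have "ln t \<le> 0" "0 < ln t0" using assms by auto
  then show ?thesis using False by (simp add: log_modulus_def)
qed simp

lemma log_modulus_log_facts:
  assumes t0: "t0 > 1" and \<beta>: "\<beta> > 0"
  shows "0 < t \<Longrightarrow> t \<le> 1 \<Longrightarrow> 0 < log_modulus 0 \<beta> t0 t"
    and "0 \<le> s \<Longrightarrow> s \<le> t \<Longrightarrow> t \<le> 1 \<Longrightarrow> log_modulus 0 \<beta> t0 s \<le> log_modulus 0 \<beta> t0 t"
    and "\<epsilon> > 0 \<Longrightarrow> \<exists>\<eta>>0. \<forall>t. 0 \<le> t \<and> t \<le> 1 \<and> t < \<eta> \<longrightarrow> log_modulus 0 \<beta> t0 t < \<epsilon>"
proof -
  have base: "ln t0 - ln t > 0" if "0 < t" "t \<le> 1" for t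
    using that t0 by (smt (verit) ln_gt_zero ln_le_zero_iff)
  show pos: "0 < log_modulus 0 \<beta> t0 t" if "0 < t" "t \<le> 1" for t
    using base[OF that] that by (simp add: log_modulus_log)
  show "log_modulus 0 \<beta> t0 s \<le> log_modulus 0 \<beta> t0 t" if st: "0 \<le> s" "s \<le> t" "t \<le> 1"
  proof (cases "s = 0")
    case True
    then show ?thesis using pos[of t] st by (cases "t = 0") auto
  next
    case False
    then have "0 < s" "0 < t" using st by auto
    then show ?thesis
      using base[of t] st \<beta> by (auto simp: log_modulus_log intro!: powr_mono2')
  qed
  show "\<exists>\<eta>>0. \<forall>t. 0 \<le> t \<and> t \<le> 1 \<and> t < \<eta> \<longrightarrow> log_modulus 0 \<beta> t0 t < \<epsilon>" if \<epsilon>: "\<epsilon> > 0"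
  proof -
    have "((\<lambda>t. (ln t0 - ln t) powr - \<beta>) \<longlongrightarrow> 0) (at_right 0)" using \<beta> by real_asymp
    then have "\<forall>\<^sub>F t in at_right 0. (ln t0 - ln t) powr - \<beta> < \<epsilon>" using \<epsilon> by (rule order_tendstoD)
    then obtain b where b: "b > 0" "\<And>t. 0 < t \<Longrightarrow> t < b \<Longrightarrow> (ln t0 - ln t) powr - \<beta> < \<epsilon>"
      unfolding eventually_at_right_field by auto
    show ?thesis
    proof (intro exI[of _ b] conjI allI impI)
      fix t assume "0 \<le> t \<and> t \<le> 1 \<and> t < b"
      then show "log_modulus 0 \<beta> t0 t < \<epsilon>"
        using b(2)[of t] \<epsilon> by (cases "t = 0") (auto simp: log_modulus_log)
    qed (rule b)
  qed
qed

lemma log_modulus_power_facts: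
  assumes t0: "t0 > 1" and \<alpha>: "\<alpha> > 0"
  shows "0 < t \<Longrightarrow> t \<le> 1 \<Longrightarrow> 0 < log_modulus \<alpha> 0 t0 t"
    and "0 \<le> s \<Longrightarrow> s \<le> t \<Longrightarrow> t \<le> 1 \<Longrightarrow> log_modulus \<alpha> 0 t0 s \<le> log_modulus \<alpha> 0 t0 t"
    and "\<epsilon> > 0 \<Longrightarrow> \<exists>\<eta>>0. \<forall>t. 0 \<le> t \<and> t \<le> 1 \<and> t < \<eta> \<longrightarrow> log_modulus \<alpha> 0 t0 t < \<epsilon>"
proof -
  show "0 < log_modulus \<alpha> 0 t0 t" if "0 < t" "t \<le> 1"
    using that by (simp add: log_modulus_power[OF t0])
  show "log_modulus \<alpha> 0 t0 s \<le> log_modulus \<alpha> 0 t0 t" if "0 \<le> s" "s \<le> t" "t \<le> 1"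
    using that \<alpha> by (simp add: log_modulus_power[OF t0] powr_mono2)
  show "\<exists>\<eta>>0. \<forall>t. 0 \<le> t \<and> t \<le> 1 \<and> t < \<eta> \<longrightarrow> log_modulus \<alpha> 0 t0 t < \<epsilon>" if \<epsilon>: "\<epsilon> > 0"
  proof (intro exI[of _ "\<epsilon> powr (1 / \<alpha>)"] conjI allI impI)
    fix t :: real assume t: "0 \<le> t \<and> t \<le> 1 \<and> t < \<epsilon> powr (1 / \<alpha>)"
    then have "t powr \<alpha> < (\<epsilon> powr (1 / \<alpha>)) powr \<alpha>" using \<alpha> by (intro powr_less_mono2) auto
    also have "\<dots> = \<epsilon>" using \<alpha> \<epsilon> by (simp add: powr_powr)
    finally show "log_modulus \<alpha> 0 t0 t < \<epsilon>" using t by (simp add: log_modulus_power[OF t0])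
  qed (use \<epsilon> in simp)
qed

text \<open>A distance contracted by \<open>l ^ j\<close> has its logarithm lowered by
  \<open>\<eta> * j\<close>, so with \<open>s t = ln t0 - ln t\<close> the logarithmic modulus of
  exponent \<open>\<gamma> + 1\<close> is directly of the form required by
  \<open>paired_branchesI\<close>.\<close>

lemma paired_branches_expanding:
  fixes T :: "'a::metric_space \<Rightarrow> 'a"
  assumes compact: "compact (UNIV :: 'a set)" and dist1: "\<And>x y :: 'a. dist x y \<le> 1"
    and mixing: "topologically_mixing T" and fibre: "\<And>n x. finite {y. (T ^^ n) y = x}"
    and T: "ruelle_expanding T" and \<gamma>: "\<gamma> > 0"
    and t0: "t0 > 1" and t1: "admissible 0 \<gamma> t1"
  shows "\<exists>r K0 K1 K2 K3 K4 W e. \<forall>H\<ge>0. paired_branches T r K0 K1 K2 K3 K4 W H \<gamma> e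
    (log_modulus 0 (\<gamma> + 1) t0) (log_modulus 0 \<gamma> t1)"
proof -
  obtain l r where l: "0 < l" "l < 1" and r: "r > 0"
    and branches: "\<forall>n x y u. dist x y < r \<and> (T ^^ n) u = x \<longrightarrow>
      (\<exists>!v. (T ^^ n) v = y \<and> (\<forall>k\<le>n. dist ((T ^^ k) u) ((T ^^ k) v) \<le> l ^ (n - k) * dist x y))"
    using expanding_inverse_branches[OF T] by (elim exE conjE) (rule that)
  have branch: "\<exists>!v. (T ^^ n) v = y \<and> (\<forall>k\<le>n. dist ((T ^^ k) u) ((T ^^ k) v) \<le> l ^ (n - k) * dist x y)"
    if "dist x y < r" "(T ^^ n) u = x" for n x y u
    using branches[rule_format, OF conjI[OF that]] .
  have t1: "t1 > 1" "concave_on {0..1} (log_modulus 0 \<gamma> t1)" using t1 by (auto simp: admissible_def)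
  define \<eta> where "\<eta> = - ln l"
  have \<eta>: "\<eta> > 0" using l by (simp add: \<eta>_def)
  have ln_t: "ln t0 > 0" "ln t1 > 0" using t0 t1 by auto
  have ln_gap: "- ln t + \<eta> * real j \<le> - ln d" if "0 < d" "d \<le> l ^ j * t" "0 < t" for d t and j :: nat
  proof -
    have "ln d \<le> ln (l ^ j * t)" using that l by (intro ln_mono) auto
    also have "\<dots> = real j * ln l + ln t" using that l by (simp add: ln_mult ln_realpow)
    finally show ?thesis by (simp add: \<eta>_def algebra_simps)
  qed
  \<comment> \<open>The two moduli carry different constants \<open>t0\<close> and
    \<open>t1\<close>; \<open>\<kappa>\<close> is the price of passing from one to the
    other.\<close>
  define \<kappa> where "\<kappa> = min 1 (ln t0 / ln t1)"
  have \<kappa>: "\<kappa> > 0" "\<kappa> \<le> 1" "\<kappa> * ln t1 \<le> ln t0" using ln_t by (auto simp: \<kappa>_def min_def field_simps)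
  \<comment> \<open>Chosen so that \<open>\<mu> * (1 + j) \<le> ln t1 + \<eta> * j\<close>.\<close>
  define \<mu> where "\<mu> = min (ln t1) \<eta>"
  have \<mu>: "\<mu> > 0" "\<mu> \<le> ln t1" "\<mu> \<le> \<eta>" using ln_t \<eta> by (auto simp: \<mu>_def)
  have ln_t_le: "ln t \<le> 0" if "0 < t" "t \<le> 1" for t :: real using that by simp
  have "\<gamma> + 1 > 0" using \<gamma> by simp
  note facts = log_modulus_log_facts[OF t0 this] log_modulus_log_facts[OF t1(1) \<gamma>]
  have "paired_branches T r 1 (1 * \<kappa> powr - \<gamma> / (\<gamma> * \<eta>)) 1 (max (\<mu> powr - \<gamma>) (log_modulus 0 \<gamma> t1 1))
      (1 / log_modulus 0 \<gamma> t1 1) (log_modulus 0 (\<gamma> + 1) t0 1) H \<gamma> (\<lambda>j. l ^ j)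
      (log_modulus 0 (\<gamma> + 1) t0) (log_modulus 0 \<gamma> t1)" if H: "H \<ge> 0" for H
  proof (rule paired_branchesI[where c = "\<lambda>j t. l ^ j * t" and s = "\<lambda>t. ln t0 - ln t"])
    show "(\<lambda>j. l ^ j) \<longlonglongrightarrow> 0" using l by (intro LIMSEQ_power_zero) auto
  next
    fix t :: real assume t: "0 < t" "t \<le> 1"
    show "0 < ln t0 - ln t" using ln_t_le[OF t] ln_t by simp
    have "\<kappa> * (ln t1 - ln t) \<le> ln t0 - ln t"
      using \<kappa> mult_right_mono[OF \<kappa>(2), of "- ln t"] ln_t_le[OF t] by (simp add: algebra_simps)
    then have "(ln t0 - ln t) powr - \<gamma> \<le> (\<kappa> * (ln t1 - ln t)) powr - \<gamma>"
      using \<kappa> \<gamma> ln_t ln_t_le[OF t] by (intro powr_mono2') auto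
    also have "\<dots> = \<kappa> powr - \<gamma> * log_modulus 0 \<gamma> t1 t"
      using t by (simp add: powr_mult log_modulus_log)
    finally show "(ln t0 - ln t) powr - \<gamma> \<le> \<kappa> powr - \<gamma> * log_modulus 0 \<gamma> t1 t" .
    show "l ^ j * t \<le> 1 * t" for j using t l by (intro mult_right_mono power_le_one) auto
    show "l ^ j * t \<le> l ^ j" for j using t l by (simp add: mult_le_cancel_left1)
    fix j d assume d: "0 \<le> d" "d \<le> 1" "d \<le> l ^ j * t"
    show "log_modulus 0 (\<gamma> + 1) t0 d \<le> 1 * (ln t0 - ln t + \<eta> * real j) powr (- \<gamma> - 1)"
    proof (cases "d = 0")
      case False
      with d have "d > 0" by simp
      moreover have "(ln t0 - ln d) powr (- \<gamma> - 1) \<le> (ln t0 - ln t + \<eta> * real j) powr (- \<gamma> - 1)"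
        using ln_gap[OF \<open>d > 0\<close> d(3) t(1)] ln_t ln_t_le[OF t] \<eta> \<gamma>
        by (intro powr_mono2') (auto intro!: add_pos_nonneg)
      ultimately show ?thesis by (simp add: log_modulus_log)
    qed simp
    show "log_modulus 0 \<gamma> t1 d \<le> \<mu> powr - \<gamma> * (1 + real j) powr - \<gamma>"
    proof (cases "d = 0")
      case False
      with d have "d > 0" by simp
      have "\<mu> * (1 + real j) \<le> ln t1 + \<eta> * real j"
        using \<mu> mult_right_mono[OF \<mu>(3), of "real j"] by (simp add: algebra_simps)
      also have "\<dots> \<le> ln t1 - ln d" using ln_gap[OF \<open>d > 0\<close> d(3) t(1)] ln_t_le[OF t] by simp
      finally have "(ln t1 - ln d) powr - \<gamma> \<le> (\<mu> * (1 + real j)) powr - \<gamma>"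
        using \<mu> \<gamma> by (intro powr_mono2') auto
      then show ?thesis using \<open>d > 0\<close> by (simp add: log_modulus_log powr_mult)
    qed simp
  qed (use assms r H \<eta> l branch t1 facts in auto)
  then show ?thesis by (intro exI allI impI)
qed

text \<open>With \<open>s t = t powr (- 1 / \<beta>)\<close> the rate is
  \<open>K * (s t + j) powr - \<beta>\<close>, whose power \<open>\<alpha>\<close> has exponent
  \<open>- \<alpha> * \<beta> = - \<gamma> - 1\<close>. The remaining
  \<open>s t powr - \<gamma>\<close> equals \<open>t powr (\<alpha> - 1 / \<beta>)\<close>, the
  origin of the exponent in \<open>\<omega>'\<close>.\<close>

lemma paired_branches_expansive:
  fixes T :: "'a::metric_space \<Rightarrow> 'a"
  assumes compact: "compact (UNIV :: 'a set)" and dist1: "\<And>x y :: 'a. dist x y \<le> 1"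
    and mixing: "topologically_mixing T" and fibre: "\<And>n x. finite {y. (T ^^ n) y = x}"
    and T: "ruelle_expansive (poly_rate K \<beta>) r T" and K: "K > 0" and \<beta>: "\<beta> > 1"
    and \<gamma>: "\<gamma> = \<alpha> * \<beta> - 1" "\<gamma> > 0"
    and t0: "t0 > 1" and t1: "admissible (\<alpha> - 1 / \<beta>) 0 t1"
  shows "\<exists>r K0 K1 K2 K3 K4 W e. \<forall>H\<ge>0. paired_branches T r K0 K1 K2 K3 K4 W H \<gamma> e
    (log_modulus \<alpha> 0 t0) (log_modulus (\<alpha> - 1 / \<beta>) 0 t1)"
proof -
  have r: "r > 0" using T by (simp add: ruelle_expansive_def)
  have branch: "\<exists>!v. (T ^^ n) v = y \<and> (\<forall>k\<le>n. dist ((T ^^ k) u) ((T ^^ k) v) \<le> poly_rate K \<beta> (n -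
    k) (dist x y))"
    if "n \<ge> 1" "dist x y < r" "(T ^^ n) u = x" for n x y u
    using T[unfolded ruelle_expansive_def, THEN conjunct2, THEN conjunct2, rule_format, OF that(1)
      conjI[OF that(2,3)]] .
  have t1: "t1 > 1" "concave_on {0..1} (log_modulus (\<alpha> - 1 / \<beta>) 0 t1)" using t1
    by (auto simp: admissible_def)
  define \<delta> where "\<delta> = \<alpha> - 1 / \<beta>"
  have \<delta>\<beta>: "\<beta> * \<delta> = \<gamma>" using \<beta> by (simp add: \<delta>_def \<gamma>(1) field_simps)
  then have \<delta>: "\<delta> > 0" using \<gamma>(2) \<beta> by (metis zero_less_mult_pos less_trans zero_less_one)
  have \<alpha>: "\<alpha> > 0" using \<delta> \<beta> unfolding \<delta>_def by (smt (verit) divide_pos_pos)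
  have \<alpha>\<beta>: "\<beta> * \<alpha> = \<gamma> + 1" by (simp add: \<gamma>(1) mult.commute)
  define K0 where "K0 = max 1 K"
  define s where "s t = t powr (- 1 / \<beta>)" for t :: real
  have s_ge: "s t \<ge> 1" if "0 < t" "t \<le> 1" for t
  proof -
    have "1 powr (- 1 / \<beta>) \<le> t powr (- 1 / \<beta>)"
      using that \<beta> by (intro powr_mono2') (auto simp: divide_le_0_iff)
    then show ?thesis by (simp add: s_def)
  qed
  have c: "poly_rate K \<beta> j t = K * (s t + real j) powr - \<beta>" if "0 < t" for j t
    using that by (simp add: poly_rate_def s_def)
  note facts = log_modulus_power_facts[OF t0 \<alpha>] log_modulus_power_facts[OF t1(1) \<delta>]
  have "paired_branches T r K0 (K powr \<alpha> * 1 / (\<gamma> * 1)) K0 (max (K powr \<delta>) (log_modulus \<delta> 0 t1 1))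
      (1 / log_modulus \<delta> 0 t1 1) (log_modulus \<alpha> 0 t0 1) H \<gamma> (\<lambda>j. K0 * (1 + real j) powr - \<beta>)
      (log_modulus \<alpha> 0 t0) (log_modulus \<delta> 0 t1)" if H: "H \<ge> 0" for H
  proof (rule paired_branchesI[where c = "poly_rate K \<beta>" and s = s])
    show "(\<lambda>j. K0 * (1 + real j) powr - \<beta>) \<longlonglongrightarrow> 0" using \<beta> by real_asymp
  next
    fix t :: real assume t: "0 < t" "t \<le> 1"
    show "0 < s t" using s_ge[OF t] by simp
    have "s t powr - \<gamma> = t powr \<delta>"
      unfolding s_def powr_powr using \<beta> by (simp add: \<delta>\<beta>[symmetric])
    then show "s t powr - \<gamma> \<le> 1 * log_modulus \<delta> 0 t1 t"
      using t by (simp add: log_modulus_power[OF t1(1)])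
    have "poly_rate K \<beta> j t \<le> K * s t powr - \<beta>" for j
      unfolding c[OF t(1)] using K \<beta> s_ge[OF t] by (intro mult_left_mono powr_mono2') auto
    also have "s t powr - \<beta> = t" unfolding s_def powr_powr using \<beta> t by simp
    finally have Kt: "poly_rate K \<beta> j t \<le> K * t" for j .
    have "K * t \<le> K0 * t" using t by (intro mult_right_mono) (auto simp: K0_def)
    then show "poly_rate K \<beta> j t \<le> K0 * t" for j using Kt[of j] by linarith
    have base: "(s t + real j) powr - \<beta> \<le> (1 + real j) powr - \<beta>" for j
      using \<beta> s_ge[OF t] by (intro powr_mono2') auto
    show "poly_rate K \<beta> j t \<le> K0 * (1 + real j) powr - \<beta>" for j
      unfolding c[OF t(1)] by (intro mult_mono base) (auto simp: K0_def)
    fix j d assume d: "0 \<le> d" "d \<le> 1" "d \<le> poly_rate K \<beta> j t"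
    have pow: "d powr \<theta> \<le> K powr \<theta> * (s t + real j) powr (- (\<beta> * \<theta>))" if "\<theta> > 0" for \<theta>
    proof -
      have "d powr \<theta> \<le> (K * (s t + real j) powr - \<beta>) powr \<theta>"
        using d that unfolding c[OF t(1)] by (intro powr_mono2) auto
      also have "\<dots> = K powr \<theta> * (s t + real j) powr (- (\<beta> * \<theta>))"
        by (simp add: powr_mult powr_powr)
      finally show ?thesis .
    qed
    show "log_modulus \<alpha> 0 t0 d \<le> K powr \<alpha> * (s t + 1 * real j) powr (- \<gamma> - 1)"
      using pow[OF \<alpha>] d by (simp add: log_modulus_power[OF t0] \<alpha>\<beta>)
    have "(s t + real j) powr - \<gamma> \<le> (1 + real j) powr - \<gamma>"
      using \<gamma>(2) s_ge[OF t] by (intro powr_mono2') auto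
    then have "K powr \<delta> * (s t + real j) powr - \<gamma> \<le> K powr \<delta> * (1 + real j) powr - \<gamma>"
      by (intro mult_left_mono) auto
    then show "log_modulus \<delta> 0 t1 d \<le> K powr \<delta> * (1 + real j) powr - \<gamma>"
      using pow[OF \<delta>] d by (simp add: log_modulus_power[OF t1(1)] \<delta>\<beta>)
  qed (use assms(1-4) \<gamma>(2) r H branch t1 facts in \<open>auto simp: K0_def poly_rate_def \<delta>_def\<close>)
  then show ?thesis unfolding \<delta>_def by (intro exI allI impI)
qed

text \<open>The locale is used twice: with \<open>H\<close> a constant of the given potential for
  existence and uniqueness, and with \<open>H = M\<close> for stability. The eigenvalue estimate
  carries bounds on the sup norms: adding one constant to both \<open>a\<close> and \<open>b\<close>
  preserves \<open>a - b\<close> and the Hoelder constants but multiplies both eigenvalues by its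
  exponential.\<close>

theorem theorem1p4:
  fixes T :: "'a::metric_space \<Rightarrow> 'a"
    and \<alpha> \<beta> t0 t1 \<gamma> :: real
    and \<omega> \<omega>' :: "real \<Rightarrow> real"
  assumes "compact (UNIV :: 'a set)"
    and "diameter (UNIV :: 'a set) = 1"
    and "\<forall>n. local_homeomorphism (T ^^ n)"
    and "topologically_mixing T"
    and cases:
      "(ruelle_expanding T \<and> \<beta> > 1 \<and>
          admissible 0 \<beta> t0 \<and> \<omega> = log_modulus 0 \<beta> t0 \<and>
          admissible 0 (\<beta> - 1) t1 \<and> \<omega>' = log_modulus 0 (\<beta> - 1) t1 \<and>
          \<gamma> = \<beta> - 1)
       \<or>
       ((\<exists>K r. K > 0 \<and> ruelle_expansive (poly_rate K \<beta>) r T) \<and> \<beta> > 1 \<and> \<alpha> > 1 / \<beta> \<and>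
          admissible \<alpha> 0 t0 \<and> \<omega> = log_modulus \<alpha> 0 t0 \<and>
          admissible (\<alpha> - 1 / \<beta>) 0 t1 \<and> \<omega>' = log_modulus (\<alpha> - 1 / \<beta>) 0 t1 \<and>
          \<gamma> = \<alpha> * \<beta> - 1)"
    and "\<gamma> > 0"
  shows
    "(\<forall>a. holder \<omega> a \<longrightarrow>
        ((\<exists>h l. eigenfunction T a h l) \<and>
         (\<forall>h h' l l'. eigenfunction T a h l \<and> eigenfunction T a h' l' \<longrightarrow>
            (\<exists>c>0. \<forall>x. h' x = c * h x)) \<and>
         (\<forall>h l. eigenfunction T a h l \<longrightarrow> holder \<omega>' h)) \<and>
        (\<exists>!m. \<exists>l. eigenmeasure T a m l) \<and>
        (\<forall>h l1 m l2. eigenfunction T a h l1 \<and> eigenmeasure T a m l2 \<longrightarrow> l1 = l2))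
     \<and>
     (\<forall>M>0. \<exists>C>0. \<forall>a b ha hb ma mb la lb.
        holder \<omega> a \<and> holder \<omega> b \<and> holder_const \<omega> a < M \<and> holder_const \<omega> b < M \<and>
        eigenfunction T a ha la \<and> eigenmeasure T a ma la \<and> (LINT x|ma. ha x) = 1 \<and>
        eigenfunction T b hb lb \<and> eigenmeasure T b mb lb \<and> (LINT x|mb. hb x) = 1 \<longrightarrow>
          wasserstein \<omega>' ma mb \<le> C * sup_norm (\<lambda>x. a x - b x) powr (\<gamma> / (\<gamma> + 1)) \<and>
          sup_norm (\<lambda>x. ha x - hb x) \<le> C * sup_norm (\<lambda>x. a x - b x) powr (\<gamma> / (\<gamma> + 1)) \<and>
          (sup_norm a < M \<and> sup_norm b < M \<longrightarrow>
             \<bar>la - lb\<bar> \<le> C * sup_norm (\<lambda>x. a x - b x) powr (\<gamma> / (\<gamma> + 1))))"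
proof -
  have compact: "compact (UNIV :: 'a set)" by fact
  have dist1: "dist x y \<le> 1" for x y :: 'a
    using diameter_bounded_bound[OF compact_imp_bounded[OF compact], of x y] assms(2) by simp
  have fibre: "finite {y. (T ^^ n) y = x}" for n x
    using assms(3) by (intro finite_fibre_local_homeomorphism compact) blast
  have "\<exists>r K0 K1 K2 K3 K4 W e. \<forall>H\<ge>0. paired_branches T r K0 K1 K2 K3 K4 W H \<gamma> e \<omega> \<omega>'"
    using cases
  proof (elim disjE conjE exE)
    assume 1: "ruelle_expanding T" "admissible 0 \<beta> t0" "\<omega> = log_modulus 0 \<beta> t0"
      "admissible 0 (\<beta> - 1) t1" "\<omega>' = log_modulus 0 (\<beta> - 1) t1" "\<gamma> = \<beta> - 1"
    have "\<beta> = \<gamma> + 1" using 1 by simp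
    then show ?thesis
      using paired_branches_expanding[OF compact dist1 assms(4) fibre 1(1) assms(6), of t0 t1] 1
      by (simp add: admissible_def)
  next
    fix K r assume 2: "K > 0" "ruelle_expansive (poly_rate K \<beta>) r T" "\<beta> > 1"
      "admissible \<alpha> 0 t0" "\<omega> = log_modulus \<alpha> 0 t0"
      "admissible (\<alpha> - 1 / \<beta>) 0 t1" "\<omega>' = log_modulus (\<alpha> - 1 / \<beta>) 0 t1" "\<gamma> = \<alpha> * \<beta> - 1"
    then have "t0 > 1" by (simp add: admissible_def)
    then show ?thesis
      unfolding 2(5,7)
      by (rule paired_branches_expansive[OF compact dist1 assms(4) fibre 2(2,1,3,8) assms(6) _ 2(6)])
  qed
  then obtain r K0 K1 K2 K3 K4 W e where
    paired: "\<And>H. H \<ge> 0 \<Longrightarrow> paired_branches T r K0 K1 K2 K3 K4 W H \<gamma> e \<omega> \<omega>'" by metis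
  note uniform = paired_branches.uniform_decay_exists[OF paired]
  show ?thesis
  proof (intro conjI[of "\<forall>a. holder \<omega> a \<longrightarrow> _ a"] allI impI)
    fix a :: "'a \<Rightarrow> real" assume "holder \<omega> a"
    then obtain C where C: "\<And>x y. \<bar>a x - a y\<bar> \<le> C * \<omega> (dist x y)" by (auto simp: holder_def)
    \<comment> \<open>The absolute value supplies the nonnegative \<open>H\<close> that
      \<open>paired\<close> asks for.\<close>
    obtain R C' B where "uniform_decay T r K0 K1 K2 K3 K4 W \<bar>C\<bar> \<gamma> e \<omega> \<omega>' R C' B"
      using uniform[of "\<bar>C\<bar>"] by auto
    then interpret uniform_decay T r K0 K1 K2 K3 K4 W "\<bar>C\<bar>" \<gamma> e \<omega> \<omega>' R C' B .
    have a: "pot a"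
      unfolding pot_def
    proof (intro allI)
      fix x y :: 'a
      have "C * \<omega> (dist x y) \<le> \<bar>C\<bar> * \<omega> (dist x y)"
        using \<omega>_bounds[of "dist x y"] dist1[of x y] by (intro mult_right_mono) auto
      with C[of x y] show "\<bar>a x - a y\<bar> \<le> \<bar>C\<bar> * \<omega> (dist x y)" by linarith
    qed
    obtain h l where h: "eigenfunction T a h l" using eigenfunction_exists[OF a] by blast
    obtain m where m: "eigenmeasure T a m l" using eigenmeasure_exists[OF pot_continuous[OF a] h]
      by blast
    show "((\<exists>h l. eigenfunction T a h l) \<and>
         (\<forall>h h' l l'. eigenfunction T a h l \<and> eigenfunction T a h' l' \<longrightarrow>
            (\<exists>c>0. \<forall>x. h' x = c * h x)) \<and>
         (\<forall>h l. eigenfunction T a h l \<longrightarrow> holder \<omega>' h)) \<and>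
        (\<exists>!m. \<exists>l. eigenmeasure T a m l) \<and>
        (\<forall>h l1 m l2. eigenfunction T a h l1 \<and> eigenmeasure T a m l2 \<longrightarrow> l1 = l2)"
    proof (intro conjI)
      show "\<exists>h l. eigenfunction T a h l" using h by blast
      show "\<forall>h h' l l'. eigenfunction T a h l \<and> eigenfunction T a h' l' \<longrightarrow> (\<exists>c>0. \<forall>x. h' x = c * h x)"
        using eigenfunction_unique by blast
      show "\<forall>h l. eigenfunction T a h l \<longrightarrow> holder \<omega>' h"
      proof (intro allI impI)
        fix h l assume h: "eigenfunction T a h l"
        fix x0 :: 'a
        have "\<bar>h x - h y\<bar> \<le> (C' * (R * h x0)) * \<omega>' (dist x y)" for x y
        proof -
          have "\<bar>h x - h y\<bar> \<le> C' * \<omega>' (dist x y) * h x" by (rule eigenfunction_le(2)[OF a h])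
          also have "\<dots> \<le> C' * \<omega>' (dist x y) * (R * h x0)"
            using C_nonneg eigenfunction_le(1)[OF a h] by (intro mult_left_mono) auto
          finally show ?thesis by (simp add: mult_ac)
        qed
        then show "holder \<omega>' h" unfolding holder_def by blast
      qed
      show "\<exists>!m. \<exists>l. eigenmeasure T a m l" using m eigenmeasure_unique[OF a] by blast
      show "\<forall>h l1 m l2. eigenfunction T a h l1 \<and> eigenmeasure T a m l2 \<longrightarrow> l1 = l2"
        using eigenvalues_agree by blast
    qed
  next
    fix M :: real assume M: "M > 0"
    obtain R C' B where "uniform_decay T r K0 K1 K2 K3 K4 W M \<gamma> e \<omega> \<omega>' R C' B"
      using uniform[of M] M by auto
    then interpret uniform_decay T r K0 K1 K2 K3 K4 W M \<gamma> e \<omega> \<omega>' R C' B .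
    \<comment> \<open>An infimum below \<open>M\<close> leaves some Hoelder constant below
      \<open>M\<close>; \<open>holder\<close> makes the set of constants nonempty.\<close>
    have pot: "pot a" if h: "holder \<omega> a" and lt: "holder_const \<omega> a < M" for a :: "'a \<Rightarrow> real"
    proof -
      have "{C. \<forall>x y. \<bar>a x - a y\<bar> \<le> C * \<omega> (dist x y)} \<noteq> {}" using h by (auto simp: holder_def)
      then obtain C where C: "\<And>x y. \<bar>a x - a y\<bar> \<le> C * \<omega> (dist x y)" "C < M"
        using cInf_lessD[OF _ lt[unfolded holder_const_def]] by auto
      show ?thesis
        unfolding pot_def
      proof (intro allI)
        fix x y :: 'a
        have "C * \<omega> (dist x y) \<le> M * \<omega> (dist x y)"
          using C(2) \<omega>_bounds[of "dist x y"] dist1[of x y] by (intro mult_right_mono) auto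
        with C(1)[of x y] show "\<bar>a x - a y\<bar> \<le> M * \<omega> (dist x y)" by linarith
      qed
    qed
    have le_sup_norm: "\<bar>f x\<bar> \<le> sup_norm f" if f: "continuous_on UNIV f" for f :: "'a \<Rightarrow> real" and x
    proof -
      obtain B where "\<And>x. \<bar>f x\<bar> \<le> B" using bounded_continuous_compact[OF compact f] by blast
      then show ?thesis unfolding sup_norm_def by (intro cSUP_upper bdd_aboveI2) auto
    qed
    have sup_norm_le: "sup_norm f \<le> B" if "\<And>x. \<bar>f x\<bar> \<le> B" for f :: "'a \<Rightarrow> real" and B
      unfolding sup_norm_def by (intro cSUP_least that) auto
    obtain C1 where C1: "C1 \<ge> 0"
      "\<And>a b ma mb la lb \<epsilon>. pot a \<Longrightarrow> pot b \<Longrightarrow> eigenmeasure T a ma la \<Longrightarrow> eigenmeasure T b mb lb \<Longrightarrow>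
        (\<And>x. \<bar>a x - b x\<bar> \<le> \<epsilon>) \<Longrightarrow> wasserstein \<omega>' ma mb \<le> C1 * \<epsilon> powr (\<gamma> / (\<gamma> + 1))"
      using eigenmeasure_stable by blast
    obtain C2 where C2: "C2 \<ge> 0"
      "\<And>a b ha hb ma mb la lb \<epsilon> x. pot a \<Longrightarrow> pot b \<Longrightarrow>
        eigenfunction T a ha la \<Longrightarrow> eigenmeasure T a ma la \<Longrightarrow> (LINT x|ma. ha x) = 1 \<Longrightarrow>
        eigenfunction T b hb lb \<Longrightarrow> eigenmeasure T b mb lb \<Longrightarrow> (LINT x|mb. hb x) = 1 \<Longrightarrow>
        (\<And>x. \<bar>a x - b x\<bar> \<le> \<epsilon>) \<Longrightarrow> \<bar>ha x - hb x\<bar> \<le> C2 * \<epsilon> powr (\<gamma> / (\<gamma> + 1))"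
      using eigenfunction_stable by blast
    obtain C3 where C3: "C3 \<ge> 0"
      "\<And>a b ma mb la lb \<epsilon>. pot a \<Longrightarrow> pot b \<Longrightarrow> eigenmeasure T a ma la \<Longrightarrow> eigenmeasure T b mb lb \<Longrightarrow>
        (\<And>x. a x \<le> M) \<Longrightarrow> (\<And>x. b x \<le> M) \<Longrightarrow> (\<And>x. \<bar>a x - b x\<bar> \<le> \<epsilon>) \<Longrightarrow> \<epsilon> \<le> 2 * M \<Longrightarrow>
        \<bar>la - lb\<bar> \<le> C3 * \<epsilon> powr (\<gamma> / (\<gamma> + 1))"
      using eigenvalue_stable[of M] by blast
    define C where "C = C1 + C2 + C3 + 1"
    have C: "C > 0" "C1 * z \<le> C * z" "C2 * z \<le> C * z" "C3 * z \<le> C * z" if "z \<ge> 0" for z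
      using C1(1) C2(1) C3(1) that by (auto simp: C_def intro!: mult_right_mono)
    show "\<exists>C>0. \<forall>a b ha hb ma mb la lb.
        holder \<omega> a \<and> holder \<omega> b \<and> holder_const \<omega> a < M \<and> holder_const \<omega> b < M \<and>
        eigenfunction T a ha la \<and> eigenmeasure T a ma la \<and> (LINT x|ma. ha x) = 1 \<and>
        eigenfunction T b hb lb \<and> eigenmeasure T b mb lb \<and> (LINT x|mb. hb x) = 1 \<longrightarrow>
          wasserstein \<omega>' ma mb \<le> C * sup_norm (\<lambda>x. a x - b x) powr (\<gamma> / (\<gamma> + 1)) \<and>
          sup_norm (\<lambda>x. ha x - hb x) \<le> C * sup_norm (\<lambda>x. a x - b x) powr (\<gamma> / (\<gamma> + 1)) \<and>
          (sup_norm a < M \<and> sup_norm b < M \<longrightarrow>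
             \<bar>la - lb\<bar> \<le> C * sup_norm (\<lambda>x. a x - b x) powr (\<gamma> / (\<gamma> + 1)))"
    proof (intro exI[of _ C] conjI allI impI; (elim conjE)?)
      show "C > 0" using C(1)[of 0] by simp
    next
      fix a b ha hb ma mb la lb
      assume ab: "holder \<omega> a" "holder \<omega> b" "holder_const \<omega> a < M" "holder_const \<omega> b < M"
        and ha: "eigenfunction T a ha la" "eigenmeasure T a ma la" "(LINT x|ma. ha x) = 1"
        and hb: "eigenfunction T b hb lb" "eigenmeasure T b mb lb" "(LINT x|mb. hb x) = 1"
      define \<epsilon> where "\<epsilon> = sup_norm (\<lambda>x. a x - b x)"
      define z where "z = \<epsilon> powr (\<gamma> / (\<gamma> + 1))"
      have z: "z \<ge> 0" by (simp add: z_def)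
      have a: "pot a" and b: "pot b" using ab pot by auto
      have cont: "continuous_on UNIV a" "continuous_on UNIV b" using a b
        by (auto intro: pot_continuous)
      have \<epsilon>: "\<bar>a x - b x\<bar> \<le> \<epsilon>" for x
        unfolding \<epsilon>_def by (rule le_sup_norm) (intro continuous_intros cont)
      show "wasserstein \<omega>' ma mb \<le> C * sup_norm (\<lambda>x. a x - b x) powr (\<gamma> / (\<gamma> + 1))"
        using C1(2)[OF a b ha(2) hb(2) \<epsilon>] C(2)[OF z] unfolding \<epsilon>_def[symmetric] z_def by linarith
      show "sup_norm (\<lambda>x. ha x - hb x) \<le> C * sup_norm (\<lambda>x. a x - b x) powr (\<gamma> / (\<gamma> + 1))"
        using C2(2)[OF a b ha hb \<epsilon>] C(3)[OF z] unfolding \<epsilon>_def[symmetric] z_def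
        by (intro sup_norm_le) (meson order_trans)
      assume M': "sup_norm a < M" "sup_norm b < M"
      have aM: "\<bar>a x\<bar> \<le> M" and bM: "\<bar>b x\<bar> \<le> M" for x
        using le_sup_norm[OF cont(1), of x] le_sup_norm[OF cont(2), of x] M' by auto
      have "\<bar>a x - b x\<bar> \<le> 2 * M" for x using aM[of x] bM[of x] by linarith
      then have "\<epsilon> \<le> 2 * M" unfolding \<epsilon>_def by (rule sup_norm_le)
      moreover have "a x \<le> M" "b x \<le> M" for x using aM[of x] bM[of x] by auto
      ultimately show "\<bar>la - lb\<bar> \<le> C * sup_norm (\<lambda>x. a x - b x) powr (\<gamma> / (\<gamma> + 1))"
        using C3(2)[OF a b ha(2) hb(2) _ _ \<epsilon>] C(4)[OF z] unfolding \<epsilon>_def[symmetric] z_def by fastforce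
    qed
  qed
qed

end
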